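(* The category $\mathsf{Pro}(\mathcal{A}^\omega)$ is categorically equivalent to $\mathsf{CA}\mathcal{A}$.
   Context: Setting: $\mathbf{L}$ is a finite algebra with an underlying bounded lattice $(L,\wedge,\vee,0,1)$, $0\neq 1$ (the lattice operations and the bounds belong to the signature of $\mathbf{L}$), and $\mathbf{L}$ is semi-primal: for every $n\ge 1$, every function $f\colon L^n\to L$ that preserves subalgebras (meaning $f(a_1,\dots,a_n)$ always lies in the subalgebra generated by $a_1,\dots,a_n$) is term-definable in $\mathbf{L}$. $\mathcal{A}=\mathbb{HSP}(\mathbf{L})$ is the variety generated by $\mathbf{L}$, considered as a category with homomorphisms, and $\mathcal{A}^\omega$ is its full subcategory of finite algebras. $\mathsf{Pro}(\mathsf{C})$ denotes the (free) completion of a category $\mathsf{C}$ under cofiltered limits. For $\ell\in L$, $T_\ell\colon L\to L$ is given by $T_\ell(\ell)=1$ and $T_\ell(x)=0$ for $x\ne\ell$; these are term-definable in $\mathbf{L}$ and hence interpreted in every $\mathbf{A}\in\mathcal{A}$. The Boolean skeleton $\mathfrak{S}(\mathbf{A})$ of $\mathbf{A}\in\mathcal{A}$ is the Boolean algebra on $\{a\in A\mid T_1(a)=a\}$ with $\wedge,\vee,0,1$ inherited from $\mathbf{A}$ and complement $T_0$. $\mathsf{CABA}$ is the category of complete atomic Boolean algebras with complete homomorphisms. The category $\mathsf{CA}\mathcal{A}$ has as objects the algebras $\mathbf{A}\in\mathcal{A}$ which have a complete lattice reduct and satisfy $\mathfrak{S}(\mathbf{A})\in\mathsf{CABA}$;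 its morphisms are the complete homomorphisms (homomorphisms preserving arbitrary joins and meets). *)

theory Defs
  imports "HOL-Algebra.Complete_Lattice" "HOL-Library.FuncSet"
begin

unbundle cardinal_syntax

section \<open>Universal algebra\<close>

text \<open>The elements of the type \<open>'f\<close> are the operation symbols. The lattice operations and the
  bounds are symbols of the signature.\<close>

record 'f signature =
  arity :: "'f \<Rightarrow> nat"
  meet_sym :: 'f
  join_sym :: 'f
  zero_sym :: 'f
  one_sym :: 'f

record ('f, 'a) algebra = "'a partial_object" +
  oper :: "'f \<Rightarrow> 'a list \<Rightarrow> 'a"

definition lattice_signature :: "'f signature \<Rightarrow> bool" where
  "lattice_signature \<Sigma> \<longleftrightarrow> arity \<Sigma> (meet_sym \<Sigma>) = 2 \<and> arity \<Sigma> (join_sym \<Sigma>) = 2 \<and>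
     arity \<Sigma> (zero_sym \<Sigma>) = 0 \<and> arity \<Sigma> (one_sym \<Sigma>) = 0"

definition tuples :: "nat \<Rightarrow> 'a set \<Rightarrow> 'a list set" where
  "tuples n S = {as. length as = n \<and> set as \<subseteq> S}"

definition subuniverse :: "'f signature \<Rightarrow> ('f, 'a) algebra \<Rightarrow> 'a set \<Rightarrow> bool" where
  "subuniverse \<Sigma> A S \<longleftrightarrow> S \<subseteq> carrier A \<and> (\<forall>f. \<forall>as \<in> tuples (arity \<Sigma> f) S. oper A f as \<in> S)"

definition is_algebra :: "'f signature \<Rightarrow> ('f, 'a) algebra \<Rightarrow> bool" where
  "is_algebra \<Sigma> A \<longleftrightarrow> subuniverse \<Sigma> A (carrier A)"

definition generated :: "'f signature \<Rightarrow> ('f, 'a) algebra \<Rightarrow> 'a set \<Rightarrow> 'a set" where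
  "generated \<Sigma> A X = \<Inter>{S. subuniverse \<Sigma> A S \<and> X \<subseteq> S}"

text \<open>Homomorphisms are extensional functions (\<open>undefined\<close> outside the carrier), so that equality
  of homomorphisms is equality on the carrier.\<close>

definition homs :: "'f signature \<Rightarrow> ('f, 'a) algebra \<Rightarrow> ('f, 'b) algebra \<Rightarrow> ('a \<Rightarrow> 'b) set" where
  "homs \<Sigma> A B = {h \<in> carrier A \<rightarrow>\<^sub>E carrier B.
     \<forall>f. \<forall>as \<in> tuples (arity \<Sigma> f) (carrier A). h (oper A f as) = oper B f (map h as)}"

definition power_algebra :: "('f, 'a) algebra \<Rightarrow> 'j set \<Rightarrow> ('f, 'j \<Rightarrow> 'a) algebra" where
  "power_algebra L J = \<lparr>carrier = J \<rightarrow>\<^sub>E carrier L,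
     oper = (\<lambda>f as. \<lambda>j\<in>J. oper L f (map (\<lambda>a. a j) as))\<rparr>"

text \<open>Membership of \<open>A\<close> in \<open>HSP(L)\<close>: \<open>A\<close> is a homomorphic image of a subalgebra \<open>S\<close> of a power of
  \<open>L\<close>. Taking the index set \<open>J\<close> of the power in the type \<open>'a \<Rightarrow> 'l\<close> is no loss of generality:
  if \<open>A\<close> is an image of a subalgebra of any power, choose a preimage \<open>p a\<close> of each element \<open>a\<close>;
  the subalgebra generated by these preimages still maps onto \<open>A\<close>, and its elements depend on an
  index \<open>j\<close> only through the function \<open>a \<mapsto> p a j\<close>.\<close>

definition HSP :: "'f signature \<Rightarrow> ('f, 'l) algebra \<Rightarrow> ('f, 'a) algebra \<Rightarrow> bool" where
  "HSP \<Sigma> L A \<longleftrightarrow> is_algebra \<Sigma> A \<and>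
     (\<exists>(J :: ('a \<Rightarrow> 'l) set) S h. subuniverse \<Sigma> (power_algebra L J) S \<and>
        h \<in> homs \<Sigma> (power_algebra L J\<lparr>carrier := S\<rparr>) A \<and> h ` S = carrier A)"

datatype 'f trm = Var nat | App 'f "'f trm list"

inductive is_term :: "'f signature \<Rightarrow> nat \<Rightarrow> 'f trm \<Rightarrow> bool" for \<Sigma> n where
  "i < n \<Longrightarrow> is_term \<Sigma> n (Var i)"
| "length ts = arity \<Sigma> f \<Longrightarrow> (\<forall>t \<in> set ts. is_term \<Sigma> n t) \<Longrightarrow> is_term \<Sigma> n (App f ts)"

primrec term_op :: "('f, 'a) algebra \<Rightarrow> 'f trm \<Rightarrow> 'a list \<Rightarrow> 'a" where
  "term_op A (Var i) = (\<lambda>as. as ! i)"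
| "term_op A (App f ts) = (\<lambda>as. oper A f (map (\<lambda>t. term_op A t as) ts))"

definition defines_term ::
    "'f signature \<Rightarrow> ('f, 'a) algebra \<Rightarrow> nat \<Rightarrow> ('a list \<Rightarrow> 'a) \<Rightarrow> 'f trm \<Rightarrow> bool" where
  "defines_term \<Sigma> L n f t \<longleftrightarrow>
     is_term \<Sigma> n t \<and> (\<forall>as \<in> tuples n (carrier L). term_op L t as = f as)"

definition semi_primal :: "'f signature \<Rightarrow> ('f, 'a) algebra \<Rightarrow> bool" where
  "semi_primal \<Sigma> L \<longleftrightarrow> (\<forall>n \<ge> 1. \<forall>f.
     (\<forall>as \<in> tuples n (carrier L). f as \<in> generated \<Sigma> L (set as)) \<longrightarrow>
     (\<exists>t. defines_term \<Sigma> L n f t))"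

section \<open>Lattice reducts and Boolean skeletons\<close>

abbreviation alg_meet :: "'f signature \<Rightarrow> ('f, 'a) algebra \<Rightarrow> 'a \<Rightarrow> 'a \<Rightarrow> 'a" where
  "alg_meet \<Sigma> A x y \<equiv> oper A (meet_sym \<Sigma>) [x, y]"
abbreviation alg_join :: "'f signature \<Rightarrow> ('f, 'a) algebra \<Rightarrow> 'a \<Rightarrow> 'a \<Rightarrow> 'a" where
  "alg_join \<Sigma> A x y \<equiv> oper A (join_sym \<Sigma>) [x, y]"
abbreviation alg_zero :: "'f signature \<Rightarrow> ('f, 'a) algebra \<Rightarrow> 'a" where
  "alg_zero \<Sigma> A \<equiv> oper A (zero_sym \<Sigma>) []"
abbreviation alg_one :: "'f signature \<Rightarrow> ('f, 'a) algebra \<Rightarrow> 'a" where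
  "alg_one \<Sigma> A \<equiv> oper A (one_sym \<Sigma>) []"

definition is_lattice :: "'a set \<Rightarrow> ('a \<Rightarrow> 'a \<Rightarrow> 'a) \<Rightarrow> ('a \<Rightarrow> 'a \<Rightarrow> 'a) \<Rightarrow> bool" where
  "is_lattice S m j \<longleftrightarrow> (\<forall>x\<in>S. \<forall>y\<in>S. m x y \<in> S \<and> j x y \<in> S) \<and>
     (\<forall>x\<in>S. \<forall>y\<in>S. m x y = m y x \<and> j x y = j y x \<and> m x (j x y) = x \<and> j x (m x y) = x) \<and>
     (\<forall>x\<in>S. \<forall>y\<in>S. \<forall>z\<in>S. m (m x y) z = m x (m y z) \<and> j (j x y) z = j x (j y z))"

definition is_bounded_lattice ::
    "'a set \<Rightarrow> ('a \<Rightarrow> 'a \<Rightarrow> 'a) \<Rightarrow> ('a \<Rightarrow> 'a \<Rightarrow> 'a) \<Rightarrow> 'a \<Rightarrow> 'a \<Rightarrow> bool" where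
  "is_bounded_lattice S m j z e \<longleftrightarrow>
     is_lattice S m j \<and> z \<in> S \<and> e \<in> S \<and> (\<forall>x\<in>S. m z x = z \<and> m x e = x)"

definition bounded_lattice_algebra :: "'f signature \<Rightarrow> ('f, 'a) algebra \<Rightarrow> bool" where
  "bounded_lattice_algebra \<Sigma> A \<longleftrightarrow>
     is_bounded_lattice (carrier A) (alg_meet \<Sigma> A) (alg_join \<Sigma> A) (alg_zero \<Sigma> A) (alg_one \<Sigma> A)"

definition meet_order :: "'a set \<Rightarrow> ('a \<Rightarrow> 'a \<Rightarrow> 'a) \<Rightarrow> 'a gorder" where
  "meet_order S m = \<lparr>carrier = S, eq = (=), le = (\<lambda>x y. m x y = x)\<rparr>"

abbreviation lattice_reduct :: "'f signature \<Rightarrow> ('f, 'a) algebra \<Rightarrow> 'a gorder" where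
  "lattice_reduct \<Sigma> A \<equiv> meet_order (carrier A) (alg_meet \<Sigma> A)"

record 'a bool_algebra = "'a partial_object" +
  bmeet :: "'a \<Rightarrow> 'a \<Rightarrow> 'a"
  bjoin :: "'a \<Rightarrow> 'a \<Rightarrow> 'a"
  bzero :: 'a
  bone :: 'a
  bcompl :: "'a \<Rightarrow> 'a"

definition is_bool_algebra :: "'a bool_algebra \<Rightarrow> bool" where
  "is_bool_algebra B \<longleftrightarrow>
     is_bounded_lattice (carrier B) (bmeet B) (bjoin B) (bzero B) (bone B) \<and>
     (\<forall>x\<in>carrier B. \<forall>y\<in>carrier B. \<forall>z\<in>carrier B.
        bmeet B x (bjoin B y z) = bjoin B (bmeet B x y) (bmeet B x z)) \<and>
     (\<forall>x\<in>carrier B. bcompl B x \<in> carrier B \<and>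
        bmeet B x (bcompl B x) = bzero B \<and> bjoin B x (bcompl B x) = bone B)"

definition atoms :: "'a bool_algebra \<Rightarrow> 'a set" where
  "atoms B = {a \<in> carrier B. a \<noteq> bzero B \<and>
     (\<forall>b\<in>carrier B. bmeet B b a = b \<longrightarrow> b = bzero B \<or> b = a)}"

definition CABA :: "'a bool_algebra \<Rightarrow> bool" where
  "CABA B \<longleftrightarrow> is_bool_algebra B \<and> complete_lattice (meet_order (carrier B) (bmeet B)) \<and>
     (\<forall>b\<in>carrier B. b \<noteq> bzero B \<longrightarrow> (\<exists>a\<in>atoms B. bmeet B a b = a))"

text \<open>The operation \<open>T\<^sub>l\<close> on an algebra \<open>A\<close> of the variety generated by \<open>L\<close> is the
  interpretation in \<open>A\<close> of a term that defines \<open>T\<^sub>l\<close> on \<open>L\<close>. Such a term exists when \<open>L\<close> is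
  semi-primal, and any two of them agree on every algebra in the variety.\<close>

definition T_term :: "'f signature \<Rightarrow> ('f, 'l) algebra \<Rightarrow> 'l \<Rightarrow> 'f trm" where
  "T_term \<Sigma> L l =
     (SOME t. defines_term \<Sigma> L 1 (\<lambda>as. if as ! 0 = l then alg_one \<Sigma> L else alg_zero \<Sigma> L) t)"

definition T_op :: "'f signature \<Rightarrow> ('f, 'l) algebra \<Rightarrow> 'l \<Rightarrow> ('f, 'a) algebra \<Rightarrow> 'a \<Rightarrow> 'a" where
  "T_op \<Sigma> L l A a = term_op A (T_term \<Sigma> L l) [a]"

definition skeleton :: "'f signature \<Rightarrow> ('f, 'l) algebra \<Rightarrow> ('f, 'a) algebra \<Rightarrow> 'a bool_algebra" where
  "skeleton \<Sigma> L A =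
     \<lparr>carrier = {a \<in> carrier A. T_op \<Sigma> L (alg_one \<Sigma> L) A a = a},
      bmeet = alg_meet \<Sigma> A, bjoin = alg_join \<Sigma> A, bzero = alg_zero \<Sigma> A, bone = alg_one \<Sigma> A,
      bcompl = T_op \<Sigma> L (alg_zero \<Sigma> L) A\<rparr>"

section \<open>Categories\<close>

text \<open>\<open>Comp C X Y Z g f\<close> is the composite of \<open>f : X \<rightarrow> Y\<close> and \<open>g : Y \<rightarrow> Z\<close>. Hom-sets of different
  pairs of objects need not be disjoint; an arrow is a morphism together with its two ends.\<close>

record ('o, 'm) cat =
  Ob :: "'o set"
  Hom :: "'o \<Rightarrow> 'o \<Rightarrow> 'm set"
  Id :: "'o \<Rightarrow> 'm"
  Comp :: "'o \<Rightarrow> 'o \<Rightarrow> 'o \<Rightarrow> 'm \<Rightarrow> 'm \<Rightarrow> 'm"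

locale category =
  fixes C :: "('o, 'm) cat"
  assumes Id_in: "X \<in> Ob C \<Longrightarrow> Id C X \<in> Hom C X X"
    and Comp_in: "\<lbrakk>X \<in> Ob C; Y \<in> Ob C; Z \<in> Ob C; f \<in> Hom C X Y; g \<in> Hom C Y Z\<rbrakk>
      \<Longrightarrow> Comp C X Y Z g f \<in> Hom C X Z"
    and Comp_Id: "\<lbrakk>X \<in> Ob C; Y \<in> Ob C; f \<in> Hom C X Y\<rbrakk> \<Longrightarrow> Comp C X X Y f (Id C X) = f"
    and Id_Comp: "\<lbrakk>X \<in> Ob C; Y \<in> Ob C; f \<in> Hom C X Y\<rbrakk> \<Longrightarrow> Comp C X Y Y (Id C Y) f = f"
    and Comp_assoc: "\<lbrakk>W \<in> Ob C; X \<in> Ob C; Y \<in> Ob C; Z \<in> Ob C;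
        f \<in> Hom C W X; g \<in> Hom C X Y; h \<in> Hom C Y Z\<rbrakk>
      \<Longrightarrow> Comp C W Y Z h (Comp C W X Y g f) = Comp C W X Z (Comp C X Y Z h g) f"

definition full_subcat :: "('o, 'm) cat \<Rightarrow> 'o set \<Rightarrow> ('o, 'm) cat" where
  "full_subcat C S = C\<lparr>Ob := Ob C \<inter> S\<rparr>"

record ('o, 'm, 'p, 'n) fctr =
  omap :: "'o \<Rightarrow> 'p"
  amap :: "'o \<Rightarrow> 'o \<Rightarrow> 'm \<Rightarrow> 'n"

locale is_functor =
  fixes C :: "('o, 'm) cat" and D :: "('p, 'n) cat" and F :: "('o, 'm, 'p, 'n) fctr"
  assumes omap_in: "X \<in> Ob C \<Longrightarrow> omap F X \<in> Ob D"
    and amap_in: "\<lbrakk>X \<in> Ob C; Y \<in> Ob C; f \<in> Hom C X Y\<rbrakk>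
      \<Longrightarrow> amap F X Y f \<in> Hom D (omap F X) (omap F Y)"
    and amap_Id: "X \<in> Ob C \<Longrightarrow> amap F X X (Id C X) = Id D (omap F X)"
    and amap_Comp: "\<lbrakk>X \<in> Ob C; Y \<in> Ob C; Z \<in> Ob C; f \<in> Hom C X Y; g \<in> Hom C Y Z\<rbrakk>
      \<Longrightarrow> amap F X Z (Comp C X Y Z g f) =
          Comp D (omap F X) (omap F Y) (omap F Z) (amap F Y Z g) (amap F X Y f)"

definition id_functor :: "('o, 'm, 'o, 'm) fctr" where
  "id_functor = \<lparr>omap = (\<lambda>X. X), amap = (\<lambda>X Y f. f)\<rparr>"

definition comp_functor ::
    "('p, 'n, 'q, 'r) fctr \<Rightarrow> ('o, 'm, 'p, 'n) fctr \<Rightarrow> ('o, 'm, 'q, 'r) fctr" where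
  "comp_functor G F = \<lparr>omap = (\<lambda>X. omap G (omap F X)),
     amap = (\<lambda>X Y f. amap G (omap F X) (omap F Y) (amap F X Y f))\<rparr>"

definition is_iso :: "('o, 'm) cat \<Rightarrow> 'o \<Rightarrow> 'o \<Rightarrow> 'm \<Rightarrow> bool" where
  "is_iso C X Y f \<longleftrightarrow> f \<in> Hom C X Y \<and>
     (\<exists>g \<in> Hom C Y X. Comp C X Y X g f = Id C X \<and> Comp C Y X Y f g = Id C Y)"

definition nat_isomorphic :: "('o, 'm) cat \<Rightarrow> ('p, 'n) cat \<Rightarrow>
    ('o, 'm, 'p, 'n) fctr \<Rightarrow> ('o, 'm, 'p, 'n) fctr \<Rightarrow> bool" where
  "nat_isomorphic C D F G \<longleftrightarrow> (\<exists>\<eta>.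
     (\<forall>X \<in> Ob C. is_iso D (omap F X) (omap G X) (\<eta> X)) \<and>
     (\<forall>X \<in> Ob C. \<forall>Y \<in> Ob C. \<forall>f \<in> Hom C X Y.
        Comp D (omap F X) (omap F Y) (omap G Y) (\<eta> Y) (amap F X Y f) =
        Comp D (omap F X) (omap G X) (omap G Y) (amap G X Y f) (\<eta> X)))"

definition equivalent_cats :: "('o, 'm) cat \<Rightarrow> ('p, 'n) cat \<Rightarrow> bool" where
  "equivalent_cats C D \<longleftrightarrow> category C \<and> category D \<and>
     (\<exists>F G. is_functor C D F \<and> is_functor D C G \<and>
        nat_isomorphic C C (comp_functor G F) id_functor \<and>
        nat_isomorphic D D (comp_functor F G) id_functor)"

section \<open>Completion under cofiltered limits\<close>

locale cofiltered = category +
  assumes nonempty: "Ob C \<noteq> {}"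
    and cone_pair: "\<lbrakk>i \<in> Ob C; j \<in> Ob C\<rbrakk> \<Longrightarrow> \<exists>k \<in> Ob C. Hom C k i \<noteq> {} \<and> Hom C k j \<noteq> {}"
    and cone_parallel: "\<lbrakk>i \<in> Ob C; j \<in> Ob C; u \<in> Hom C i j; v \<in> Hom C i j\<rbrakk>
      \<Longrightarrow> \<exists>k \<in> Ob C. \<exists>w \<in> Hom C k i. Comp C k i j u w = Comp C k i j v w"

definition arrows :: "('o, 'm) cat \<Rightarrow> ('o \<times> 'o \<times> 'm) set" where
  "arrows C = (SIGMA X : Ob C. SIGMA Y : Ob C. Hom C X Y)"

record ('k, 'o, 'm) diagram =
  shape :: "('k, 'k) cat"
  dia :: "('k, 'k, 'o, 'm) fctr"

text \<open>\<open>Pro \<kappa> C\<close> is the category of pro-objects of \<open>C\<close>: the objects are the cofiltered diagrams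
  \<open>X : I \<rightarrow> C\<close> with fewer than \<open>\<kappa>\<close> arrows in \<open>I\<close> (formally, the limits of these diagrams), and
  the set of morphisms from \<open>X : I \<rightarrow> C\<close> to \<open>Y : J \<rightarrow> C\<close> is the limit over \<open>j\<close> of the colimits over
  \<open>i\<close> of the sets \<open>C(X\<^sub>i, Y\<^sub>j)\<close>. The filtered colimit over \<open>i\<close> of \<open>C(X\<^sub>i, A)\<close> is the set of
  classes of pairs \<open>(i, f : X\<^sub>i \<rightarrow> A)\<close>, two pairs being equivalent if they agree on some \<open>X\<^sub>k\<close>.\<close>

definition germs :: "('o, 'm) cat \<Rightarrow> ('k, 'o, 'm) diagram \<Rightarrow> 'o \<Rightarrow> ('k \<times> 'm) set" where
  "germs C X A = (SIGMA i : Ob (shape X). Hom C (omap (dia X) i) A)"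

definition germ_rel ::
    "('o, 'm) cat \<Rightarrow> ('k, 'o, 'm) diagram \<Rightarrow> 'o \<Rightarrow> (('k \<times> 'm) \<times> ('k \<times> 'm)) set" where
  "germ_rel C X A = {((i, f), (i', f')). (i, f) \<in> germs C X A \<and> (i', f') \<in> germs C X A \<and>
     (\<exists>k \<in> Ob (shape X). \<exists>u \<in> Hom (shape X) k i. \<exists>v \<in> Hom (shape X) k i'.
        Comp C (omap (dia X) k) (omap (dia X) i) A f (amap (dia X) k i u) =
        Comp C (omap (dia X) k) (omap (dia X) i') A f' (amap (dia X) k i' v))}"

definition colim_hom :: "('o, 'm) cat \<Rightarrow> ('k, 'o, 'm) diagram \<Rightarrow> 'o \<Rightarrow> ('k \<times> 'm) set set" where
  "colim_hom C X A = germs C X A // germ_rel C X A"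

text \<open>The map from \<open>colim_hom C X A\<close> to \<open>colim_hom C X B\<close> induced by \<open>g : A \<rightarrow> B\<close>.\<close>

definition colim_map ::
    "('o, 'm) cat \<Rightarrow> ('k, 'o, 'm) diagram \<Rightarrow> 'o \<Rightarrow> 'o \<Rightarrow> 'm \<Rightarrow> ('k \<times> 'm) set \<Rightarrow> ('k \<times> 'm) set" where
  "colim_map C X A B g c = (\<Union>(i, f) \<in> c. germ_rel C X B `` {(i, Comp C (omap (dia X) i) A B g f)})"

definition pro_objects :: "'k rel \<Rightarrow> ('o, 'm) cat \<Rightarrow> ('k, 'o, 'm) diagram set" where
  "pro_objects \<kappa> C = {X. cofiltered (shape X) \<and> |arrows (shape X)| <o \<kappa> \<and>
     is_functor (shape X) C (dia X)}"

definition pro_hom :: "('o, 'm) cat \<Rightarrow> ('k, 'o, 'm) diagram \<Rightarrow> ('k, 'o, 'm) diagram \<Rightarrow>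
    ('k \<Rightarrow> ('k \<times> 'm) set) set" where
  "pro_hom C X Y = {\<phi> \<in> (\<Pi>\<^sub>E j \<in> Ob (shape Y). colim_hom C X (omap (dia Y) j)).
     \<forall>j \<in> Ob (shape Y). \<forall>j' \<in> Ob (shape Y). \<forall>u \<in> Hom (shape Y) j j'.
       colim_map C X (omap (dia Y) j) (omap (dia Y) j') (amap (dia Y) j j' u) (\<phi> j) = \<phi> j'}"

definition Pro :: "'k rel \<Rightarrow> ('o, 'm) cat \<Rightarrow>
    (('k, 'o, 'm) diagram, 'k \<Rightarrow> ('k \<times> 'm) set) cat" where
  "Pro \<kappa> C = \<lparr>Ob = pro_objects \<kappa> C, Hom = pro_hom C,
     Id = (\<lambda>X. \<lambda>i\<in>Ob (shape X). germ_rel C X (omap (dia X) i) `` {(i, Id C (omap (dia X) i))}),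
     Comp = (\<lambda>X Y Z \<psi> \<phi>. \<lambda>k\<in>Ob (shape Z).
       \<Union>(j, g) \<in> \<psi> k. colim_map C X (omap (dia Y) j) (omap (dia Z) k) g (\<phi> j))\<rparr>"

section \<open>The categories of algebras\<close>

definition Variety ::
    "'f signature \<Rightarrow> ('f, 'l) algebra \<Rightarrow> (('f, 'a) algebra, 'a \<Rightarrow> 'a) cat" where
  "Variety \<Sigma> L = \<lparr>Ob = {A. HSP \<Sigma> L A}, Hom = homs \<Sigma>,
     Id = (\<lambda>A. \<lambda>x\<in>carrier A. x), Comp = (\<lambda>A B D g f. compose (carrier A) g f)\<rparr>"

definition Variety_fin ::
    "'f signature \<Rightarrow> ('f, 'l) algebra \<Rightarrow> (('f, 'a) algebra, 'a \<Rightarrow> 'a) cat" where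
  "Variety_fin \<Sigma> L = full_subcat (Variety \<Sigma> L) {A. finite (carrier A)}"

definition complete_homs ::
    "'f signature \<Rightarrow> ('f, 'a) algebra \<Rightarrow> ('f, 'b) algebra \<Rightarrow> ('a \<Rightarrow> 'b) set" where
  "complete_homs \<Sigma> A B = {h \<in> homs \<Sigma> A B. \<forall>X \<subseteq> carrier A.
     h (\<Squnion>\<^bsub>lattice_reduct \<Sigma> A\<^esub> X) = \<Squnion>\<^bsub>lattice_reduct \<Sigma> B\<^esub> (h ` X) \<and>
     h (\<Sqinter>\<^bsub>lattice_reduct \<Sigma> A\<^esub> X) = \<Sqinter>\<^bsub>lattice_reduct \<Sigma> B\<^esub> (h ` X)}"

definition CA :: "'f signature \<Rightarrow> ('f, 'l) algebra \<Rightarrow> (('f, 'a) algebra, 'a \<Rightarrow> 'a) cat" where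
  "CA \<Sigma> L = \<lparr>Ob = {A. HSP \<Sigma> L A \<and> complete_lattice (lattice_reduct \<Sigma> A) \<and> CABA (skeleton \<Sigma> L A)},
     Hom = complete_homs \<Sigma>,
     Id = (\<lambda>A. \<lambda>x\<in>carrier A. x), Comp = (\<lambda>A B D g f. compose (carrier A) g f)\<rparr>"

text \<open>HOL has no set of all small sets, so smallness is measured by an infinite cardinal \<open>\<kappa>\<close>: a
  set is small if it has fewer than \<open>\<kappa>\<close> elements. If \<open>\<kappa>\<close> is the cardinality of a Grothendieck
  universe, or just a strong limit, then the small objects of \<open>CA\<close> are those with small carrier.
  They are also those with a small set of atoms in the skeleton, since
  \<open>2\<^sup>n \<le> |A| \<le> |L|\<^sup>n\<close> for an object \<open>A\<close> with \<open>n\<close> atoms. If \<open>\<kappa>\<close> is not a strong limit, a small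
  diagram of finite algebras can have a limit with \<open>\<kappa>\<close> or more elements; what remains small is
  the set of atoms, as in \<open>CA_atoms\<close>. This version needs no hypothesis on \<open>\<kappa>\<close> whose
  uncountable instances lie beyond HOL.\<close>

definition strong_limit :: "'k rel \<Rightarrow> bool" where
  "strong_limit \<kappa> \<longleftrightarrow> (\<forall>X :: 'k set. |X| <o \<kappa> \<longrightarrow> |Pow X| <o \<kappa>)"

definition CA_small ::
    "'k rel \<Rightarrow> 'f signature \<Rightarrow> ('f, 'l) algebra \<Rightarrow> (('f, 'a) algebra, 'a \<Rightarrow> 'a) cat" where
  "CA_small \<kappa> \<Sigma> L = full_subcat (CA \<Sigma> L) {A. |carrier A| <o \<kappa>}"

definition CA_atoms ::
    "'k rel \<Rightarrow> 'f signature \<Rightarrow> ('f, 'l) algebra \<Rightarrow> (('f, 'a) algebra, 'a \<Rightarrow> 'a) cat" where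
  "CA_atoms \<kappa> \<Sigma> L = full_subcat (CA \<Sigma> L) {A. |atoms (skeleton \<Sigma> L A)| <o \<kappa>}"

end

theory Submission
  imports Defs
begin

text \<open>Both categories are dual to the category of sets \<open>I\<close> with a subalgebra \<open>v i\<close> of \<open>L\<close> attached to
  each point. An algebra in \<open>CA\<close> is the product of its images under the complete homomorphisms to
  \<open>L\<close>: an atom \<open>a\<close> of the skeleton determines the homomorphism that sends \<open>x\<close> to the unique
  \<open>l\<close> with \<open>a \<le> T\<^sub>l(x)\<close>; identities of \<open>L\<close> make these maps homomorphisms and jointly injective,
  and joins of elements \<open>a \<and> x\<^sub>a\<close> give all families of values. A pro-object \<open>X\<close> is sent to
  the filtered colimit of the finite sets of homomorphisms \<open>X\<^sub>i \<rightarrow> L\<close>, the subalgebra attached to a germ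
  being the intersection of the images of its representatives. Finite algebras are finite products of
  subalgebras of \<open>L\<close>, and filtered colimits commute with finite products, so this functor is fully
  faithful. Any \<open>(I, v)\<close> comes from the diagram of the finite subsets of \<open>I\<close>.\<close>

section \<open>Equivalences of categories\<close>

text \<open>The category dual to both sides is \<open>weighted_sets\<close>, whose weights are
  arbitrary sets in \<open>'l set\<close>. The equivalence itself is never written down: two fully
  faithful functors into this category are compared through their essential images, and the weights
  that occur in these are subalgebras of \<open>L\<close>. Types shape much of the rest. Morphisms
  of the variety are maps \<open>'a => 'a\<close>, so \<open>L\<close> is replaced by a copy
  \<open>M\<close> in the type \<open>'a\<close>, and points of a pro-object become its morphisms to
  the constant pro-object \<open>M\<close>. Each product of subalgebras of \<open>L\<close> must
  have its elements coded in \<open>'a\<close>; they are coded first as subsets of a small set, and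
  the assumption on \<open>Pow X\<close> makes room for these. Shapes of diagrams live in
  \<open>'k\<close>, hence finite sets of points are coded in \<open>'k\<close> as well. An algebra
  of the variety is given as a quotient of a subpower, so no homomorphism to \<open>L\<close> is at
  hand. Identities survive quotients, and the identities for \<open>T\<close> and for an equality
  test bring the homomorphisms back. Semi-primality enters through such terms with values 0 and
  1.\<close>

definition fully_faithful ::
    "('o, 'm) cat \<Rightarrow> ('p, 'n) cat \<Rightarrow> ('o, 'm, 'p, 'n) fctr \<Rightarrow> bool" where
  "fully_faithful C D F \<longleftrightarrow> (\<forall>X \<in> Ob C. \<forall>Y \<in> Ob C.
     bij_betw (amap F X Y) (Hom C X Y) (Hom D (omap F X) (omap F Y)))"

lemma fully_faithful_inj:
  assumes "fully_faithful C D F" "X \<in> Ob C" "Y \<in> Ob C" "f \<in> Hom C X Y" "g \<in> Hom C X Y"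
    and "amap F X Y f = amap F X Y g"
  shows "f = g"
  using assms unfolding fully_faithful_def bij_betw_def inj_on_def by blast

lemma fully_faithful_surj:
  assumes "fully_faithful C D F" "X \<in> Ob C" "Y \<in> Ob C" "g \<in> Hom D (omap F X) (omap F Y)"
  obtains f where "f \<in> Hom C X Y" "amap F X Y f = g"
  using assms unfolding fully_faithful_def bij_betw_def by (metis imageE)

lemma (in category) iso_left_cancel:
  assumes "X \<in> Ob C" "Y \<in> Ob C" "Z \<in> Ob C" "is_iso C Y Z e" "f \<in> Hom C X Y" "g \<in> Hom C X Y"
    and "Comp C X Y Z e f = Comp C X Y Z e g"
  shows "f = g"
proof -
  obtain d where d: "d \<in> Hom C Z Y" "Comp C Y Z Y d e = Id C Y" and e: "e \<in> Hom C Y Z"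
    using assms(4) unfolding is_iso_def by blast
  have "Comp C X Z Y d (Comp C X Y Z e k) = k" if "k \<in> Hom C X Y" for k
    using Comp_assoc[OF assms(1) assms(2,3) assms(2) that e d(1)] d(2) Id_Comp assms(1,2) that by simp
  then show ?thesis using assms(5-7) by metis
qed

lemma (in category) iso_factor:
  assumes "X \<in> Ob C" "Y \<in> Ob C" "Z \<in> Ob C" "is_iso C Y Z e" "f \<in> Hom C X Z"
  obtains g where "g \<in> Hom C X Y" "Comp C X Y Z e g = f"
proof -
  obtain d where d: "d \<in> Hom C Z Y" "Comp C Z Y Z e d = Id C Z" and e: "e \<in> Hom C Y Z"
    using assms(4) unfolding is_iso_def by blast
  have "Comp C X Y Z e (Comp C X Z Y d f) = f"
    using Comp_assoc[OF assms(1) assms(3) assms(2) assms(3) assms(5) d(1) e] d(2) Id_Comp assms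
    by simp
  then show thesis using that Comp_in assms(1,2,3,5) d(1) by metis
qed

lemma (in category) iso_Comp:
  assumes "X \<in> Ob C" "Y \<in> Ob C" "Z \<in> Ob C" "is_iso C X Y e" "is_iso C Y Z k"
  shows "is_iso C X Z (Comp C X Y Z k e)"
proof -
  obtain d where d: "d \<in> Hom C Y X" "Comp C X Y X d e = Id C X" "Comp C Y X Y e d = Id C Y"
    and e: "e \<in> Hom C X Y"
    using assms(4) unfolding is_iso_def by blast
  obtain l where l: "l \<in> Hom C Z Y" "Comp C Y Z Y l k = Id C Y" "Comp C Z Y Z k l = Id C Z"
    and k: "k \<in> Hom C Y Z"
    using assms(5) unfolding is_iso_def by blast
  note O = assms(1-3)
  have ke: "Comp C X Y Z k e \<in> Hom C X Z" and dl: "Comp C Z Y X d l \<in> Hom C Z X"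
    using Comp_in O e k d(1) l(1) by blast+
  have "Comp C X Z X (Comp C Z Y X d l) (Comp C X Y Z k e) =
      Comp C X Y X d (Comp C X Z Y l (Comp C X Y Z k e))"
    using Comp_assoc[OF O(1) O(3) O(2) O(1) ke l(1) d(1)] by simp
  also have "\<dots> = Id C X"
    using Comp_assoc[OF O(1) O(2) O(3) O(2) e k l(1)] l(2) Id_Comp O e d(2) by simp
  finally have 1: "Comp C X Z X (Comp C Z Y X d l) (Comp C X Y Z k e) = Id C X" .
  have "Comp C Z X Z (Comp C X Y Z k e) (Comp C Z Y X d l) =
      Comp C Z Y Z k (Comp C Z X Y e (Comp C Z Y X d l))"
    using Comp_assoc[OF O(3) O(1) O(2) O(3) dl e k] by simp
  also have "\<dots> = Id C Z"
    using Comp_assoc[OF O(3) O(2) O(1) O(2) l(1) d(1) e] l(3) Id_Comp O l(1) d(3) by simp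
  finally show ?thesis using 1 ke dl unfolding is_iso_def by blast
qed

text \<open>Fullness lifts the inverse arrow, and faithfulness turns the two equations for it back
  into equations in \<open>C\<close>.\<close>

lemma fully_faithful_reflects_iso:
  assumes "category C" "category D" "is_functor C D F" "fully_faithful C D F"
    and O: "X \<in> Ob C" "Y \<in> Ob C" and f: "f \<in> Hom C X Y"
    and iso: "is_iso D (omap F X) (omap F Y) (amap F X Y f)"
  shows "is_iso C X Y f"
proof -
  interpret C: category C by fact
  interpret F: is_functor C D F by fact
  obtain d where d: "d \<in> Hom D (omap F Y) (omap F X)"
    "Comp D (omap F X) (omap F Y) (omap F X) d (amap F X Y f) = Id D (omap F X)"
    "Comp D (omap F Y) (omap F X) (omap F Y) (amap F X Y f) d = Id D (omap F Y)"
    using iso unfolding is_iso_def by blast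
  obtain g where g: "g \<in> Hom C Y X" "amap F Y X g = d"
    using fully_faithful_surj[OF assms(4) O(2,1) d(1)] by blast
  have "Comp C X Y X g f = Id C X"
    using fully_faithful_inj[OF assms(4) O(1,1)] C.Comp_in C.Id_in O f g d F.amap_Comp F.amap_Id
    by metis
  moreover have "Comp C Y X Y f g = Id C Y"
    using fully_faithful_inj[OF assms(4) O(2,2)] C.Comp_in C.Id_in O f g d F.amap_Comp F.amap_Id
    by metis
  ultimately show ?thesis using f g(1) unfolding is_iso_def by blast
qed

text \<open>The lift of \<open>F\<close> along \<open>G\<close> determined by the isomorphisms \<open>e X : G (h X) \<rightarrow> F X\<close>.\<close>

definition lift_functor :: "('p, 'n) cat \<Rightarrow> ('r, 's) cat \<Rightarrow> ('o, 'm, 'r, 's) fctr \<Rightarrow>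
    ('p, 'n, 'r, 's) fctr \<Rightarrow> ('o \<Rightarrow> 'p) \<Rightarrow> ('o \<Rightarrow> 's) \<Rightarrow> ('o, 'm, 'p, 'n) fctr" where
  "lift_functor D E F G h e = \<lparr>omap = h, amap = (\<lambda>X Y f. SOME g. g \<in> Hom D (h X) (h Y) \<and>
     Comp E (omap G (h X)) (omap G (h Y)) (omap F Y) (e Y) (amap G (h X) (h Y) g) =
     Comp E (omap G (h X)) (omap F X) (omap F Y) (amap F X Y f) (e X))\<rparr>"

section \<open>Lifting a functor along a fully faithful one, up to isomorphism on objects\<close>

locale functor_lift =
  C: category C + D: category D + E: category E + F: is_functor C E F + G: is_functor D E G
  for C :: "('o, 'm) cat" and D :: "('p, 'n) cat" and E :: "('r, 's) cat"
    and F :: "('o, 'm, 'r, 's) fctr" and G :: "('p, 'n, 'r, 's) fctr" +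
  fixes h :: "'o \<Rightarrow> 'p" and e :: "'o \<Rightarrow> 's"
  assumes ffG: "fully_faithful D E G"
    and h_in: "X \<in> Ob C \<Longrightarrow> h X \<in> Ob D"
    and e_iso: "X \<in> Ob C \<Longrightarrow> is_iso E (omap G (h X)) (omap F X) (e X)"
begin

abbreviation "H \<equiv> lift_functor D E F G h e"

lemma e_in: "X \<in> Ob C \<Longrightarrow> e X \<in> Hom E (omap G (h X)) (omap F X)"
  using e_iso unfolding is_iso_def by blast

lemma GH_in: "X \<in> Ob C \<Longrightarrow> omap G (h X) \<in> Ob E"
  by (simp add: G.omap_in h_in)

text \<open>The right-hand side of the square is an arrow into \<open>omap F Y\<close>. It factors
  through the isomorphism \<open>e Y\<close>, and the factor comes from \<open>D\<close> because
  \<open>G\<close> is full. So the choice in \<open>lift_functor\<close> is made from a nonempty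
  set.\<close>

lemma lift:
  assumes "X \<in> Ob C" "Y \<in> Ob C" "f \<in> Hom C X Y"
  shows "amap H X Y f \<in> Hom D (h X) (h Y)"
    and "Comp E (omap G (h X)) (omap G (h Y)) (omap F Y) (e Y) (amap G (h X) (h Y) (amap H X Y f)) =
     Comp E (omap G (h X)) (omap F X) (omap F Y) (amap F X Y f) (e X)"
proof -
  have "Comp E (omap G (h X)) (omap F X) (omap F Y) (amap F X Y f) (e X) \<in>
      Hom E (omap G (h X)) (omap F Y)"
    using E.Comp_in F.omap_in F.amap_in GH_in e_in assms by metis
  then obtain g' where g': "g' \<in> Hom E (omap G (h X)) (omap G (h Y))"
    "Comp E (omap G (h X)) (omap G (h Y)) (omap F Y) (e Y) g' =
     Comp E (omap G (h X)) (omap F X) (omap F Y) (amap F X Y f) (e X)"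
    using E.iso_factor GH_in F.omap_in e_iso assms by metis
  obtain g where "g \<in> Hom D (h X) (h Y)" "amap G (h X) (h Y) g = g'"
    using fully_faithful_surj[OF ffG] h_in assms g'(1) by metis
  then have "\<exists>g. g \<in> Hom D (h X) (h Y) \<and>
     Comp E (omap G (h X)) (omap G (h Y)) (omap F Y) (e Y) (amap G (h X) (h Y) g) =
     Comp E (omap G (h X)) (omap F X) (omap F Y) (amap F X Y f) (e X)" using g'(2) by blast
  from someI_ex[OF this] show "amap H X Y f \<in> Hom D (h X) (h Y)"
    "Comp E (omap G (h X)) (omap G (h Y)) (omap F Y) (e Y) (amap G (h X) (h Y) (amap H X Y f)) =
     Comp E (omap G (h X)) (omap F X) (omap F Y) (amap F X Y f) (e X)"
    unfolding lift_functor_def by simp_all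
qed

text \<open>The isomorphism \<open>e Y\<close> cancels on the left and \<open>G\<close> is faithful,
  so at most one arrow fills the square. Functoriality of \<open>H\<close> then amounts to pasting
  squares.\<close>

lemma lift_unique:
  assumes "X \<in> Ob C" "Y \<in> Ob C" "f \<in> Hom C X Y" "g \<in> Hom D (h X) (h Y)"
    and "Comp E (omap G (h X)) (omap G (h Y)) (omap F Y) (e Y) (amap G (h X) (h Y) g) =
     Comp E (omap G (h X)) (omap F X) (omap F Y) (amap F X Y f) (e X)"
  shows "amap H X Y f = g"
proof (rule fully_faithful_inj[OF ffG])
  show "amap G (h X) (h Y) (amap H X Y f) = amap G (h X) (h Y) g"
    using E.iso_left_cancel[OF GH_in GH_in F.omap_in e_iso] assms lift[OF assms(1-3)]
      G.amap_in h_in by metis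
qed (use assms lift h_in in auto)

lemma lift_is_functor: "is_functor C D H"
proof
  show "X \<in> Ob C \<Longrightarrow> omap H X \<in> Ob D" for X by (simp add: lift_functor_def h_in)
  show "\<lbrakk>X \<in> Ob C; Y \<in> Ob C; f \<in> Hom C X Y\<rbrakk> \<Longrightarrow> amap H X Y f \<in> Hom D (omap H X) (omap H Y)"
    for X Y f using lift(1) by (simp add: lift_functor_def)
  have hH: "omap H = h" by (simp add: lift_functor_def)
  show "amap H X X (Id C X) = Id D (omap H X)" if X: "X \<in> Ob C" for X
    unfolding hH
    by (rule lift_unique) (use X in \<open>auto simp: C.Id_in D.Id_in h_in G.amap_Id F.amap_Id
        E.Comp_Id E.Id_Comp GH_in F.omap_in e_in\<close>)
  show "amap H X Z (Comp C X Y Z g f) =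
      Comp D (omap H X) (omap H Y) (omap H Z) (amap H Y Z g) (amap H X Y f)"
    if O: "X \<in> Ob C" "Y \<in> Ob C" "Z \<in> Ob C" and f: "f \<in> Hom C X Y" and g: "g \<in> Hom C Y Z" for X Y Z f g
    unfolding hH
  proof (rule lift_unique)
    let ?X = "omap G (h X)" let ?Y = "omap G (h Y)" let ?Z = "omap G (h Z)"
    let ?f = "amap G (h X) (h Y) (amap H X Y f)" let ?g = "amap G (h Y) (h Z) (amap H Y Z g)"
    have in_E: "?X \<in> Ob E" "?Y \<in> Ob E" "?Z \<in> Ob E" "omap F X \<in> Ob E" "omap F Y \<in> Ob E" "omap F Z \<in> Ob E"
      using O GH_in F.omap_in by auto
    have fg: "?f \<in> Hom E ?X ?Y" "?g \<in> Hom E ?Y ?Z"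
      "amap F X Y f \<in> Hom E (omap F X) (omap F Y)" "amap F Y Z g \<in> Hom E (omap F Y) (omap F Z)"
      using O f g lift(1) h_in G.amap_in F.amap_in by auto
    have eq: "amap G (h X) (h Z) (Comp D (h X) (h Y) (h Z) (amap H Y Z g) (amap H X Y f)) =
        Comp E ?X ?Y ?Z ?g ?f"
      using O f g lift(1) h_in by (simp add: G.amap_Comp)
    have "Comp E ?X ?Z (omap F Z) (e Z) (Comp E ?X ?Y ?Z ?g ?f) =
        Comp E ?X ?Y (omap F Z) (Comp E ?Y ?Z (omap F Z) (e Z) ?g) ?f"
      using E.Comp_assoc in_E fg e_in O by metis
    also have "\<dots> = Comp E ?X ?Y (omap F Z) (Comp E ?Y (omap F Y) (omap F Z) (amap F Y Z g) (e Y)) ?f"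
      using lift(2)[OF O(2,3) g] by simp
    also have "\<dots> = Comp E ?X (omap F Y) (omap F Z) (amap F Y Z g) (Comp E ?X ?Y (omap F Y) (e Y) ?f)"
      using E.Comp_assoc in_E fg e_in O by metis
    also have "\<dots> = Comp E ?X (omap F Y) (omap F Z) (amap F Y Z g)
        (Comp E ?X (omap F X) (omap F Y) (amap F X Y f) (e X))"
      using lift(2)[OF O(1,2) f] by simp
    also have "\<dots> = Comp E ?X (omap F X) (omap F Z)
        (Comp E (omap F X) (omap F Y) (omap F Z) (amap F Y Z g) (amap F X Y f)) (e X)"
      using E.Comp_assoc in_E fg e_in O by metis
    finally show "Comp E ?X ?Z (omap F Z) (e Z) (amap G (h X) (h Z)
          (Comp D (h X) (h Y) (h Z) (amap H Y Z g) (amap H X Y f))) =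
        Comp E ?X (omap F X) (omap F Z) (amap F X Z (Comp C X Y Z g f)) (e X)"
      unfolding eq using F.amap_Comp O f g by simp
  qed (use O f g C.Comp_in D.Comp_in lift h_in in auto)
qed

end

text \<open>The component at \<open>X\<close> is obtained from the composite of
  \<open>d (h X)\<close>, from \<open>omap F (k (h X))\<close> to \<open>omap G (h X)\<close>, with
  \<open>e X\<close>, which continues to \<open>omap F X\<close>. It is an isomorphism between
  values of \<open>F\<close>, so it lifts to \<open>C\<close>; naturality is verified after applying
  \<open>F\<close>. Exchanging the roles of \<open>C\<close> and \<open>D\<close> gives the other
  half of an equivalence.\<close>

lemma lift_functor_inverse:
  assumes "functor_lift C D E F G h e" "functor_lift D C E G F k d"
  shows "nat_isomorphic C C
    (comp_functor (lift_functor C E G F k d) (lift_functor D E F G h e)) id_functor"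
proof -
  interpret hl: functor_lift C D E F G h e by fact
  interpret kl: functor_lift D C E G F k d by fact
  let ?H = "lift_functor D E F G h e" let ?K = "lift_functor C E G F k d"
  have H: "omap ?H = h" and K: "omap ?K = k" by (simp_all add: lift_functor_def)
  have iso: "is_iso E (omap F (k (h X))) (omap F X)
      (Comp E (omap F (k (h X))) (omap G (h X)) (omap F X) (e X) (d (h X)))" if "X \<in> Ob C" for X
    using that hl.E.iso_Comp hl.e_iso kl.e_iso hl.h_in kl.h_in hl.F.omap_in hl.G.omap_in by metis
  have "\<forall>X. \<exists>n. X \<in> Ob C \<longrightarrow> n \<in> Hom C (k (h X)) X \<and> amap F (k (h X)) X n =
      Comp E (omap F (k (h X))) (omap G (h X)) (omap F X) (e X) (d (h X))"
    using fully_faithful_surj[OF kl.ffG] iso hl.h_in kl.h_in unfolding is_iso_def by metis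
  then obtain n where n: "\<And>X. X \<in> Ob C \<Longrightarrow> n X \<in> Hom C (k (h X)) X"
    "\<And>X. X \<in> Ob C \<Longrightarrow> amap F (k (h X)) X (n X) =
      Comp E (omap F (k (h X))) (omap G (h X)) (omap F X) (e X) (d (h X))" by metis
  have n_iso: "is_iso C (k (h X)) X (n X)" if "X \<in> Ob C" for X
    by (rule fully_faithful_reflects_iso[OF hl.C.category_axioms hl.E.category_axioms
          hl.F.is_functor_axioms kl.ffG])
      (use that iso n hl.h_in kl.h_in in auto)
  have "Comp C (k (h X)) (k (h Y)) Y (n Y) (amap ?K (h X) (h Y) (amap ?H X Y f)) =
      Comp C (k (h X)) X Y f (n X)" if O: "X \<in> Ob C" "Y \<in> Ob C" and f: "f \<in> Hom C X Y" for X Y f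
  proof (rule fully_faithful_inj[OF kl.ffG])
    let ?f = "amap ?H X Y f" let ?ff = "amap ?K (h X) (h Y) ?f"
    have hf: "?f \<in> Hom D (h X) (h Y)" using hl.lift(1)[OF O f] .
    have khf: "?ff \<in> Hom C (k (h X)) (k (h Y))" using kl.lift(1)[OF hl.h_in hl.h_in hf] O by blast
    have O': "h X \<in> Ob D" "h Y \<in> Ob D" "k (h X) \<in> Ob C" "k (h Y) \<in> Ob C" using O hl.h_in kl.h_in by auto
    let ?A = "omap F (k (h X))" let ?B = "omap F (k (h Y))"
    let ?A' = "omap G (h X)" let ?B' = "omap G (h Y)"
    have in_E: "?A \<in> Ob E" "?B \<in> Ob E" "?A' \<in> Ob E" "?B' \<in> Ob E" "omap F X \<in> Ob E" "omap F Y \<in> Ob E"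
      using O O' hl.F.omap_in hl.G.omap_in by auto
    have arr: "amap F (k (h X)) (k (h Y)) ?ff \<in> Hom E ?A ?B" "amap G (h X) (h Y) ?f \<in> Hom E ?A' ?B'"
      "amap F X Y f \<in> Hom E (omap F X) (omap F Y)" "e X \<in> Hom E ?A' (omap F X)" "e Y \<in> Hom E ?B' (omap F Y)"
      "d (h X) \<in> Hom E ?A ?A'" "d (h Y) \<in> Hom E ?B ?B'"
      using hl.F.amap_in hl.G.amap_in O O' f hf khf hl.e_in kl.e_in by auto
    have "amap F (k (h X)) Y (Comp C (k (h X)) (k (h Y)) Y (n Y) ?ff) =
        Comp E ?A ?B (omap F Y) (Comp E ?B ?B' (omap F Y) (e Y) (d (h Y))) (amap F (k (h X)) (k (h Y)) ?ff)"
      using hl.F.amap_Comp O O' n khf by metis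
    also have "\<dots> = Comp E ?A ?B' (omap F Y) (e Y) (Comp E ?A ?B ?B' (d (h Y)) (amap F (k (h X)) (k (h Y)) ?ff))"
      using hl.E.Comp_assoc in_E arr by metis
    also have "\<dots> = Comp E ?A ?B' (omap F Y) (e Y) (Comp E ?A ?A' ?B' (amap G (h X) (h Y) ?f) (d (h X)))"
      using kl.lift(2)[OF O'(1,2) hf] by simp
    also have "\<dots> = Comp E ?A ?A' (omap F Y) (Comp E ?A' ?B' (omap F Y) (e Y) (amap G (h X) (h Y) ?f)) (d (h X))"
      using hl.E.Comp_assoc in_E arr by metis
    also have "\<dots> = Comp E ?A ?A' (omap F Y) (Comp E ?A' (omap F X) (omap F Y) (amap F X Y f) (e X)) (d (h X))"
      using hl.lift(2)[OF O f] by simp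
    also have "\<dots> = Comp E ?A (omap F X) (omap F Y) (amap F X Y f) (Comp E ?A ?A' (omap F X) (e X) (d (h X)))"
      using hl.E.Comp_assoc in_E arr by metis
    also have "\<dots> = amap F (k (h X)) Y (Comp C (k (h X)) X Y f (n X))"
      using hl.F.amap_Comp O O' n f by metis
    finally show "amap F (k (h X)) Y (Comp C (k (h X)) (k (h Y)) Y (n Y) ?ff) =
        amap F (k (h X)) Y (Comp C (k (h X)) X Y f (n X))" .
  qed (use O f n hl.h_in kl.h_in hl.lift kl.lift hl.C.Comp_in in auto)
  then show ?thesis
    unfolding nat_isomorphic_def comp_functor_def id_functor_def
    by (intro exI[of _ n]) (use n_iso H K in auto)
qed

text \<open>The two choices of objects and isomorphisms are made independently of each other.
  Whatever they are, the resulting lifts are mutually inverse up to natural isomorphism, because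
  both are tied to the same functors into \<open>E\<close>.\<close>

lemma equivalent_via_common_target:
  assumes "category C" "category D" "category E" "is_functor C E F" "is_functor D E G"
    and ff: "fully_faithful C E F" "fully_faithful D E G"
    and 1: "\<And>X. X \<in> Ob C \<Longrightarrow> \<exists>Y \<in> Ob D. \<exists>e. is_iso E (omap G Y) (omap F X) e"
    and 2: "\<And>Y. Y \<in> Ob D \<Longrightarrow> \<exists>X \<in> Ob C. \<exists>e. is_iso E (omap F X) (omap G Y) e"
  shows "equivalent_cats C D"
proof -
  obtain h e where he: "\<And>X. X \<in> Ob C \<Longrightarrow> h X \<in> Ob D \<and> is_iso E (omap G (h X)) (omap F X) (e X)"
    using 1 by metis
  obtain k d where kd: "\<And>Y. Y \<in> Ob D \<Longrightarrow> k Y \<in> Ob C \<and> is_iso E (omap F (k Y)) (omap G Y) (d Y)"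
    using 2 by metis
  have L1: "functor_lift C D E F G h e" and L2: "functor_lift D C E G F k d"
    using assms he kd unfolding functor_lift_def functor_lift_axioms_def by auto
  show ?thesis
    unfolding equivalent_cats_def
    using functor_lift.lift_is_functor[OF L1] functor_lift.lift_is_functor[OF L2]
      lift_functor_inverse[OF L1 L2] lift_functor_inverse[OF L2 L1] assms(1,2) by blast
qed

section \<open>Pro-objects\<close>

abbreviation idx :: "('k, 'o, 'm) diagram \<Rightarrow> 'k set" where "idx X \<equiv> Ob (shape X)"
abbreviation ihom :: "('k, 'o, 'm) diagram \<Rightarrow> 'k \<Rightarrow> 'k \<Rightarrow> 'k set" where "ihom X \<equiv> Hom (shape X)"
abbreviation obj :: "('k, 'o, 'm) diagram \<Rightarrow> 'k \<Rightarrow> 'o" where "obj X \<equiv> omap (dia X)"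
abbreviation arr :: "('k, 'o, 'm) diagram \<Rightarrow> 'k \<Rightarrow> 'k \<Rightarrow> 'k \<Rightarrow> 'm" where "arr X \<equiv> amap (dia X)"

abbreviation restr :: "('o, 'm) cat \<Rightarrow> ('k, 'o, 'm) diagram \<Rightarrow> 'o \<Rightarrow> 'm \<Rightarrow> 'k \<Rightarrow> 'k \<Rightarrow> 'k \<Rightarrow> 'm" where
  "restr C X A f k i u \<equiv> Comp C (obj X k) (obj X i) A f (arr X k i u)"


definition germ :: "('o, 'm) cat \<Rightarrow> ('k, 'o, 'm) diagram \<Rightarrow> 'o \<Rightarrow> 'k \<Rightarrow> 'm \<Rightarrow> ('k \<times> 'm) set" where
  "germ C X A i f = germ_rel C X A `` {(i, f)}"

locale cofiltered_diagram = C: category C + I: cofiltered "shape X" + X: is_functor "shape X" C "dia X"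
  for C :: "('o, 'm) cat" and X :: "('k, 'o, 'm) diagram"
begin

lemma germ_relI:
  assumes "(i, f) \<in> germs C X A" "(i', f') \<in> germs C X A" "k \<in> idx X"
    "u \<in> ihom X k i" "v \<in> ihom X k i'"
    "restr C X A f k i u =
     restr C X A f' k i' v"
  shows "((i, f), (i', f')) \<in> germ_rel C X A"
  using assms unfolding germ_rel_def by blast

lemma germ_relE:
  assumes "((i, f), (i', f')) \<in> germ_rel C X A"
  obtains k u v where "(i, f) \<in> germs C X A" "(i', f') \<in> germs C X A" "k \<in> idx X"
    "u \<in> ihom X k i" "v \<in> ihom X k i'"
    "restr C X A f k i u =
     restr C X A f' k i' v"
  using assms unfolding germ_rel_def by blast

lemma germsD: "(i, f) \<in> germs C X A \<longleftrightarrow> i \<in> idx X \<and> f \<in> Hom C (obj X i) A"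
  unfolding germs_def by blast

lemma restrict_comp:
  assumes "A \<in> Ob C" "(i, f) \<in> germs C X A" "k \<in> idx X" "l \<in> idx X"
    "u \<in> ihom X k i" "a \<in> ihom X l k"
  shows "restr C X A f l i (Comp (shape X) l k i u a) =
    Comp C (obj X l) (obj X k) A
      (restr C X A f k i u) (arr X l k a)"
proof -
  have "i \<in> idx X" "f \<in> Hom C (obj X i) A" using assms(2) germsD by auto
  with assms show ?thesis
    using C.Comp_assoc X.amap_Comp X.amap_in X.omap_in by metis
qed

text \<open>An index over both \<open>k\<close> and \<open>l\<close> gives two composites to
  \<open>i\<close>, and an arrow equalizing these makes the square commute. This is the Ore
  condition behind transitivity of \<open>germ_rel\<close>.\<close>

lemma cospan_complete:
  assumes "k \<in> idx X" "l \<in> idx X" "i \<in> idx X"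
    "v \<in> ihom X k i" "s \<in> ihom X l i"
  obtains m a b where "m \<in> idx X" "a \<in> ihom X m k" "b \<in> ihom X m l"
    "Comp (shape X) m k i v a = Comp (shape X) m l i s b"
proof -
  obtain n a b where n: "n \<in> idx X" "a \<in> ihom X n k" "b \<in> ihom X n l"
    using I.cone_pair[OF assms(1,2)] by blast
  obtain m w where m: "m \<in> idx X" "w \<in> ihom X m n"
    "Comp (shape X) m n i (Comp (shape X) n k i v a) w =
     Comp (shape X) m n i (Comp (shape X) n l i s b) w"
    using I.cone_parallel[OF n(1) assms(3)] I.Comp_in assms n by metis
  have "Comp (shape X) m k i v (Comp (shape X) m n k a w) =
      Comp (shape X) m l i s (Comp (shape X) m n l b w)"
    using I.Comp_assoc assms n m by metis
  then show thesis using that m n assms I.Comp_in by metis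
qed

lemma equiv_germ_rel:
  assumes A: "A \<in> Ob C"
  shows "equiv (germs C X A) (germ_rel C X A)"
proof (rule equivI)
  show "refl_on (germs C X A) (germ_rel C X A)"
  proof (rule refl_onI)
    fix x assume "x \<in> germs C X A"
    then show "(x, x) \<in> germ_rel C X A"
      by (cases x) (use I.Id_in in \<open>auto intro!: germ_relI simp: germsD\<close>)
  qed
  show "sym (germ_rel C X A)"
    by (rule symI) (auto elim!: germ_relE intro: germ_relI)
  show "germ_rel C X A \<subseteq> germs C X A \<times> germs C X A"
    unfolding germ_rel_def by blast
  show "trans (germ_rel C X A)"
  proof (rule transI)
    fix x y z assume xy: "(x, y) \<in> germ_rel C X A" and yz: "(y, z) \<in> germ_rel C X A"
    obtain i f i' f' i'' f'' where [simp]: "x = (i, f)" "y = (i', f')" "z = (i'', f'')"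
      by (metis surj_pair)
    obtain k u v where k: "(i, f) \<in> germs C X A" "(i', f') \<in> germs C X A" "k \<in> idx X"
      "u \<in> ihom X k i" "v \<in> ihom X k i'"
      "restr C X A f k i u =
       restr C X A f' k i' v"
      using xy by (auto elim: germ_relE)
    obtain l s t where l: "(i', f') \<in> germs C X A" "(i'', f'') \<in> germs C X A" "l \<in> idx X"
      "s \<in> ihom X l i'" "t \<in> ihom X l i''"
      "restr C X A f' l i' s =
       restr C X A f'' l i'' t"
      using yz by (auto elim: germ_relE)
    \<comment> \<open>The two agreements hold over \<open>k\<close> and over \<open>l\<close>. They
      can be chained once the two paths to the middle index \<open>i'\<close> coincide.\<close>
    obtain m a b where m: "m \<in> idx X" "a \<in> ihom X m k" "b \<in> ihom X m l"
      "Comp (shape X) m k i' v a = Comp (shape X) m l i' s b"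
      using cospan_complete[OF k(3) l(3) _ k(5) l(4)] k(2) germsD by blast
    have "restr C X A f m i (Comp (shape X) m k i u a) =
        restr C X A f'' m i'' (Comp (shape X) m l i'' t b)"
      using restrict_comp[OF A k(1,3) m(1) k(4) m(2)] restrict_comp[OF A k(2,3) m(1) k(5) m(2)]
        restrict_comp[OF A l(1,3) m(1) l(4) m(3)] restrict_comp[OF A l(2,3) m(1) l(5) m(3)]
        k(6) l(6) m(4) by simp
    moreover have "Comp (shape X) m k i u a \<in> ihom X m i"
      "Comp (shape X) m l i'' t b \<in> ihom X m i''"
      using I.Comp_in k l m germsD by blast+
    ultimately show "(x, z) \<in> germ_rel C X A" using k(1) l(2) m(1) by (auto intro: germ_relI)
  qed
qed

lemma germ_in:
  assumes "i \<in> idx X" "f \<in> Hom C (obj X i) A"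
  shows "germ C X A i f \<in> colim_hom C X A"
  using assms unfolding germ_def colim_hom_def by (auto simp: germsD intro: quotientI)

lemma colim_homE:
  assumes "c \<in> colim_hom C X A"
  obtains i f where "i \<in> idx X" "f \<in> Hom C (obj X i) A" "c = germ C X A i f"
proof -
  obtain x where "x \<in> germs C X A" "c = germ_rel C X A `` {x}"
    using assms unfolding colim_hom_def by (rule quotientE)
  then show thesis using that germsD unfolding germ_def by (metis surj_pair)
qed

lemma germ_self:
  assumes "A \<in> Ob C" "i \<in> idx X" "f \<in> Hom C (obj X i) A"
  shows "(i, f) \<in> germ C X A i f"
  using equiv_class_self[OF equiv_germ_rel[OF assms(1)]] assms unfolding germ_def by (simp add: germsD)

lemma mem_colim:
  assumes "A \<in> Ob C" "c \<in> colim_hom C X A" "(i, f) \<in> c"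
  shows "i \<in> idx X" "f \<in> Hom C (obj X i) A" "c = germ C X A i f"
proof -
  have e: "equiv (germs C X A) (germ_rel C X A)" using equiv_germ_rel assms by blast
  obtain x where x: "x \<in> germs C X A" "c = germ_rel C X A `` {x}"
    using assms(2) unfolding colim_hom_def by (rule quotientE)
  then have "(x, (i, f)) \<in> germ_rel C X A" using assms(3) by simp
  then show "i \<in> idx X" "f \<in> Hom C (obj X i) A" "c = germ C X A i f"
    using e x equiv_class_eq[OF e] germsD unfolding germ_def germ_rel_def by blast+
qed

lemma germ_eq_iff:
  assumes "A \<in> Ob C" "i \<in> idx X" "f \<in> Hom C (obj X i) A"
    "i' \<in> idx X" "f' \<in> Hom C (obj X i') A"
  shows "germ C X A i f = germ C X A i' f' \<longleftrightarrow> (\<exists>k \<in> idx X. \<exists>u \<in> ihom X k i. \<exists>v \<in> ihom X k i'.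
     restr C X A f k i u =
     restr C X A f' k i' v)"
  using eq_equiv_class_iff[OF equiv_germ_rel[OF assms(1)], of "(i, f)" "(i', f')"] assms
  unfolding germ_def germ_rel_def by (simp add: germsD)

text \<open>The agreement is witnessed at \<open>k\<close> itself, by the identity on one side and
  \<open>u\<close> on the other. This is how representatives are moved to a common index.\<close>

lemma germ_restrict:
  assumes "A \<in> Ob C" "i \<in> idx X" "f \<in> Hom C (obj X i) A"
    "k \<in> idx X" "u \<in> ihom X k i"
  shows "germ C X A k (restr C X A f k i u) = germ C X A i f"
proof -
  have in_C: "obj X k \<in> Ob C" "obj X i \<in> Ob C" "arr X k i u \<in> Hom C (obj X k) (obj X i)"
    using assms X.omap_in X.amap_in by auto
  have f': "restr C X A f k i u \<in> Hom C (obj X k) A"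
    using C.Comp_in in_C assms by blast
  show ?thesis
    unfolding germ_eq_iff[OF assms(1) assms(4) f' assms(2,3)]
    by (rule bexI[OF _ assms(4)], rule bexI[OF _ I.Id_in[OF assms(4)]], rule bexI[OF _ assms(5)])
      (use in_C assms f' X.amap_Id C.Comp_Id in auto)
qed

text \<open>The union in \<open>colim_map\<close> runs over all representatives of a class. Two
  representatives that agree at \<open>k\<close> still agree there after composition with
  \<open>g\<close>, so all the sets in the union are one and the same class.\<close>

lemma colim_map_germ:
  assumes "A \<in> Ob C" "B \<in> Ob C" "g \<in> Hom C A B" "i \<in> idx X" "f \<in> Hom C (obj X i) A"
  shows "colim_map C X A B g (germ C X A i f) = germ C X B i (Comp C (obj X i) A B g f)"
proof -
  have *: "germ C X B i' (Comp C (obj X i') A B g f') = germ C X B i (Comp C (obj X i) A B g f)"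
    if "(i', f') \<in> germ C X A i f" for i' f'
  proof -
    have m: "i' \<in> idx X" "f' \<in> Hom C (obj X i') A" "germ C X A i f = germ C X A i' f'"
      using mem_colim[OF assms(1) germ_in[OF assms(4,5)] that] by auto
    obtain k u v where k: "k \<in> idx X" "u \<in> ihom X k i" "v \<in> ihom X k i'"
      "restr C X A f k i u =
       restr C X A f' k i' v"
      using germ_eq_iff[OF assms(1) assms(4,5) m(1,2)] m(3) by blast
    have "Comp C (obj X k) (obj X i) B (Comp C (obj X i) A B g f) (arr X k i u) =
        Comp C (obj X k) (obj X i') B (Comp C (obj X i') A B g f') (arr X k i' v)"
      using C.Comp_assoc X.omap_in X.amap_in assms k m by metis
    then show ?thesis using germ_restrict C.Comp_in X.omap_in assms m k by metis
  qed
  have "colim_map C X A B g (germ C X A i f) =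
      (\<Union>(i', f') \<in> germ C X A i f. germ C X B i' (Comp C (obj X i') A B g f'))"
    unfolding colim_map_def germ_def ..
  also have "\<dots> = germ C X B i (Comp C (obj X i) A B g f)"
    using * germ_self[OF assms(1,4,5)] by fast
  finally show ?thesis .
qed

lemma colim_map_in:
  assumes "A \<in> Ob C" "B \<in> Ob C" "g \<in> Hom C A B" "c \<in> colim_hom C X A"
  shows "colim_map C X A B g c \<in> colim_hom C X B"
  using assms(4)
proof (rule colim_homE)
  fix i f assume "i \<in> idx X" "f \<in> Hom C (obj X i) A" "c = germ C X A i f"
  then show ?thesis using colim_map_germ[OF assms(1-3)] germ_in C.Comp_in X.omap_in assms by metis
qed

lemma colim_map_Id:
  assumes "A \<in> Ob C" "c \<in> colim_hom C X A"
  shows "colim_map C X A A (Id C A) c = c"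
  using assms(2)
proof (rule colim_homE)
  fix i f assume "i \<in> idx X" "f \<in> Hom C (obj X i) A" "c = germ C X A i f"
  then show ?thesis using colim_map_germ C.Id_in C.Id_Comp X.omap_in assms by metis
qed

lemma colim_map_Comp:
  assumes "A \<in> Ob C" "B \<in> Ob C" "D \<in> Ob C" "g \<in> Hom C A B" "h \<in> Hom C B D" "c \<in> colim_hom C X A"
  shows "colim_map C X B D h (colim_map C X A B g c) = colim_map C X A D (Comp C A B D h g) c"
  using assms(6)
proof (rule colim_homE)
  fix i f assume *: "i \<in> idx X" "f \<in> Hom C (obj X i) A" "c = germ C X A i f"
  have "obj X i \<in> Ob C" using * X.omap_in by blast
  then have "Comp C (obj X i) A B g f \<in> Hom C (obj X i) B"
    "Comp C A B D h g \<in> Hom C A D"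
    "Comp C (obj X i) A D (Comp C A B D h g) f = Comp C (obj X i) B D h (Comp C (obj X i) A B g f)"
    using C.Comp_in C.Comp_assoc assms * by metis+
  then show ?thesis using colim_map_germ assms * by metis
qed

section \<open>Finitely many germs treated at one index\<close>

lemma finite_cone:
  assumes "finite S" "S \<subseteq> idx X"
  obtains k where "k \<in> idx X" "\<And>i. i \<in> S \<Longrightarrow> ihom X k i \<noteq> {}"
proof -
  have "\<exists>k \<in> idx X. \<forall>i \<in> S. ihom X k i \<noteq> {}"
    using assms
  proof (induction S)
    case empty
    then show ?case using I.nonempty by blast
  next
    case (insert i S)
    then obtain k where k: "k \<in> idx X" "\<forall>i \<in> S. ihom X k i \<noteq> {}" by auto
    obtain l where l: "l \<in> idx X" "ihom X l k \<noteq> {}" "ihom X l i \<noteq> {}"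
      using I.cone_pair[of k i] k insert.prems by blast
    have "ihom X l j \<noteq> {}" if j: "j \<in> S" for j
    proof -
      obtain u v where "u \<in> ihom X l k" "v \<in> ihom X k j" using l k j by blast
      then have "Comp (shape X) l k j v u \<in> ihom X l j"
        using I.Comp_in[OF l(1) k(1)] insert.prems j by blast
      then show ?thesis by blast
    qed
    then show ?case using l by blast
  qed
  then show thesis using that by blast
qed

text \<open>The last conclusion records that each new representative is a restriction of the given
  one. Images of homomorphisms can therefore only shrink, which matters for weights.\<close>

lemma finite_common_index:
  assumes "finite P" "\<And>p. p \<in> P \<Longrightarrow> B p \<in> Ob C"
    "\<And>p. p \<in> P \<Longrightarrow> (i p, f p) \<in> germs C X (B p)"
  obtains k g where "k \<in> idx X" "\<And>p. p \<in> P \<Longrightarrow> g p \<in> Hom C (obj X k) (B p)"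
    "\<And>p. p \<in> P \<Longrightarrow> germ C X (B p) k (g p) = germ C X (B p) (i p) (f p)"
    "\<And>p. p \<in> P \<Longrightarrow> \<exists>u \<in> ihom X k (i p).
       g p = restr C X (B p) (f p) k (i p) u"
proof -
  have "i ` P \<subseteq> idx X" using assms(3) germsD by blast
  then obtain k where k: "k \<in> idx X" "\<And>p. p \<in> P \<Longrightarrow> ihom X k (i p) \<noteq> {}"
    using finite_cone[of "i ` P"] assms(1) by (metis finite_imageI imageI)
  define u where "u p = (SOME u. u \<in> ihom X k (i p))" for p
  have u: "u p \<in> ihom X k (i p)" if "p \<in> P" for p
    unfolding u_def using k(2)[OF that] by (simp add: some_in_eq)
  let ?g = "\<lambda>p. restr C X (B p) (f p) k (i p) (u p)"
  show thesis
  proof (rule that[of k ?g])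
    fix p assume p: "p \<in> P"
    have "i p \<in> idx X" "f p \<in> Hom C (obj X (i p)) (B p)"
      using assms(3)[OF p] germsD by auto
    then show "?g p \<in> Hom C (obj X k) (B p)"
      "germ C X (B p) k (?g p) = germ C X (B p) (i p) (f p)"
      using C.Comp_in X.amap_in X.omap_in germ_restrict assms(2) p k(1) u by auto
  qed (use k u in auto)
qed

text \<open>Equality of germs gives agreement one pair at a time, along arrows that depend on the
  pair. By induction a single arrow serves finitely many pairs.\<close>

lemma finite_common_equalizer:
  assumes "finite P" "B \<in> Ob C" "\<And>p. p \<in> P \<Longrightarrow> f p \<in> Hom C (obj X i) B"
    "\<And>p. p \<in> P \<Longrightarrow> f' p \<in> Hom C (obj X i) B" "i \<in> idx X"
    "\<And>p. p \<in> P \<Longrightarrow> germ C X B i (f p) = germ C X B i (f' p)"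
  shows "\<exists>k \<in> idx X. \<exists>u \<in> ihom X k i. \<forall>p \<in> P.
     restr C X B (f p) k i u =
     restr C X B (f' p) k i u"
  using assms
proof (induction P)
  case empty
  then show ?case using I.Id_in by blast
next
  case (insert p P)
  then obtain k u where k: "k \<in> idx X" "u \<in> ihom X k i" "\<forall>p \<in> P.
     restr C X B (f p) k i u =
     restr C X B (f' p) k i u" by auto
  let ?R = "\<lambda>q k u. restr C X B q k i u"
  have fp: "f p \<in> Hom C (obj X i) B" "f' p \<in> Hom C (obj X i) B"
    using insert.prems by auto
  obtain l v w where l: "l \<in> idx X" "v \<in> ihom X l i" "w \<in> ihom X l i"
    "?R (f p) l v = ?R (f' p) l w"
    using germ_eq_iff[OF assms(2) \<open>i \<in> idx X\<close> fp(1) \<open>i \<in> idx X\<close> fp(2)]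
      insert.prems(5)[OF insertI1] by auto
  \<comment> \<open>The germs of \<open>f p\<close> and \<open>f' p\<close> agree along two possibly
    different arrows \<open>v\<close> and \<open>w\<close> into \<open>i\<close>. Passing to
    \<open>n\<close> identifies these arrows, after which one arrow restricts both maps.\<close>
  obtain n s where n: "n \<in> idx X" "s \<in> ihom X n l"
    "Comp (shape X) n l i v s = Comp (shape X) n l i w s"
    using I.cone_parallel[OF l(1) \<open>i \<in> idx X\<close> l(2,3)] by blast
  obtain m a b where m: "m \<in> idx X" "a \<in> ihom X m k" "b \<in> ihom X m n"
    "Comp (shape X) m k i u a = Comp (shape X) m n i (Comp (shape X) n l i v s) b"
    using cospan_complete[OF k(1) n(1) \<open>i \<in> idx X\<close> k(2)] I.Comp_in l n \<open>i \<in> idx X\<close> by metis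
  have g: "(i, q) \<in> germs C X B" if "q \<in> Hom C (obj X i) B" for q
    using that germsD \<open>i \<in> idx X\<close> by blast
  have vs: "Comp (shape X) n l i v s \<in> ihom X n i" and ws: "Comp (shape X) n l i w s \<in> ihom X n i"
    using I.Comp_in l n \<open>i \<in> idx X\<close> by blast+
  have "?R (f p) n (Comp (shape X) n l i v s) = ?R (f' p) n (Comp (shape X) n l i w s)"
    using restrict_comp[OF assms(2) g l(1) n(1) l(2) n(2)] restrict_comp[OF assms(2) g l(1) n(1) l(3) n(2)] fp l(4)
    by simp
  then have "?R (f p) m (Comp (shape X) m k i u a) = ?R (f' p) m (Comp (shape X) m k i u a)"
    using restrict_comp[OF assms(2) g n(1) m(1) vs m(3)] fp m(4) n(3) by simp
  moreover have "?R (f q) m (Comp (shape X) m k i u a) = ?R (f' q) m (Comp (shape X) m k i u a)" if "q \<in> P" for q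
    using restrict_comp[OF assms(2) g k(1) m(1) k(2) m(2)] k(3) that insert.prems by simp
  moreover have "Comp (shape X) m k i u a \<in> ihom X m i"
    using I.Comp_in k m \<open>i \<in> idx X\<close> by blast
  ultimately show ?case using m(1) by blast
qed

end

text \<open>\<open>pro_act C X Y A \<phi>\<close> is precomposition with \<open>\<phi> : X \<rightarrow> Y\<close> of morphisms from the
  pro-object \<open>Y\<close> to the constant pro-object \<open>A\<close>.\<close>

definition pro_act :: "('o, 'm) cat \<Rightarrow> ('k, 'o, 'm) diagram \<Rightarrow> ('k, 'o, 'm) diagram \<Rightarrow> 'o \<Rightarrow>
    ('k \<Rightarrow> ('k \<times> 'm) set) \<Rightarrow> ('k \<times> 'm) set \<Rightarrow> ('k \<times> 'm) set" where
  "pro_act C X Y A \<phi> d = (\<Union>(j, g) \<in> d. colim_map C X (obj Y j) A g (\<phi> j))"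

lemma pro_hom_in:
  "\<phi> \<in> pro_hom C X Y \<Longrightarrow> j \<in> idx Y \<Longrightarrow> \<phi> j \<in> colim_hom C X (obj Y j)"
  unfolding pro_hom_def by (auto simp: PiE_mem)

lemma pro_hom_compat:
  "\<phi> \<in> pro_hom C X Y \<Longrightarrow> j \<in> idx Y \<Longrightarrow> j' \<in> idx Y \<Longrightarrow> u \<in> ihom Y j j' \<Longrightarrow>
   colim_map C X (obj Y j) (obj Y j') (arr Y j j' u) (\<phi> j) = \<phi> j'"
  unfolding pro_hom_def by blast

lemma pro_hom_ext:
  "\<phi> \<in> pro_hom C X Y \<Longrightarrow> \<psi> \<in> pro_hom C X Y \<Longrightarrow> (\<And>j. j \<in> idx Y \<Longrightarrow> \<phi> j = \<psi> j) \<Longrightarrow> \<phi> = \<psi>"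
  unfolding pro_hom_def by (auto intro: PiE_ext)

section \<open>The action of pro-morphisms on germs\<close>

locale cofiltered_diagrams = X: cofiltered_diagram C X + Y: cofiltered_diagram C Y
  for C :: "('o, 'm) cat" and X Y :: "('k, 'o, 'm) diagram"
begin

text \<open>Moving a representative of \<open>d\<close> back along an arrow of the shape of
  \<open>Y\<close> leaves the result unchanged, by the compatibility of the family \<phi>. Any two
  representatives have a common restriction, so the union in \<open>pro_act\<close> is a union of
  equal classes.\<close>

lemma pro_act_germ:
  assumes "\<phi> \<in> pro_hom C X Y" "A \<in> Ob C" "j \<in> idx Y" "g \<in> Hom C (obj Y j) A"
  shows "pro_act C X Y A \<phi> (germ C Y A j g) = colim_map C X (obj Y j) A g (\<phi> j)"
proof -
  let ?Y = "obj Y"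
  have res: "colim_map C X (?Y k) A (restr C Y A f k i u) (\<phi> k) =
      colim_map C X (?Y i) A f (\<phi> i)"
    if "k \<in> idx Y" "i \<in> idx Y" "f \<in> Hom C (?Y i) A" "u \<in> ihom Y k i" for k i f u
  proof -
    have "colim_map C X (?Y i) A f (\<phi> i) =
        colim_map C X (?Y i) A f (colim_map C X (?Y k) (?Y i) (arr Y k i u) (\<phi> k))"
      using pro_hom_compat[OF assms(1) that(1,2,4)] by simp
    also have "\<dots> = colim_map C X (?Y k) A (restr C Y A f k i u) (\<phi> k)"
      by (rule X.colim_map_Comp) (use that assms Y.X.omap_in Y.X.amap_in pro_hom_in in auto)
    finally show ?thesis by simp
  qed
  have "colim_map C X (?Y j') A g' (\<phi> j') = colim_map C X (?Y j) A g (\<phi> j)"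
    if "(j', g') \<in> germ C Y A j g" for j' g'
  proof -
    have m: "j' \<in> idx Y" "g' \<in> Hom C (?Y j') A" "germ C Y A j g = germ C Y A j' g'"
      using Y.mem_colim[OF assms(2) Y.germ_in[OF assms(3,4)] that] by auto
    then show ?thesis
      using Y.germ_eq_iff[OF assms(2-4) m(1,2)] res assms(3,4) by metis
  qed
  then show ?thesis
    unfolding pro_act_def using Y.germ_self[OF assms(2-4)] by fast
qed

lemma pro_act_in:
  assumes "\<phi> \<in> pro_hom C X Y" "A \<in> Ob C" "d \<in> colim_hom C Y A"
  shows "pro_act C X Y A \<phi> d \<in> colim_hom C X A"
  using assms(3)
proof (rule Y.colim_homE)
  fix j g assume "j \<in> idx Y" "g \<in> Hom C (obj Y j) A" "d = germ C Y A j g"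
  then show ?thesis
    using pro_act_germ X.colim_map_in Y.X.omap_in pro_hom_in assms by metis
qed

lemma pro_act_natural:
  assumes "\<phi> \<in> pro_hom C X Y" "A \<in> Ob C" "B \<in> Ob C" "h \<in> Hom C A B" "d \<in> colim_hom C Y A"
  shows "pro_act C X Y B \<phi> (colim_map C Y A B h d) = colim_map C X A B h (pro_act C X Y A \<phi> d)"
  using assms(5)
proof (rule Y.colim_homE)
  fix j g assume *: "j \<in> idx Y" "g \<in> Hom C (obj Y j) A" "d = germ C Y A j g"
  have j: "obj Y j \<in> Ob C" "\<phi> j \<in> colim_hom C X (obj Y j)"
    using * Y.X.omap_in pro_hom_in assms by auto
  have "pro_act C X Y B \<phi> (colim_map C Y A B h d) = pro_act C X Y B \<phi> (germ C Y B j (Comp C (obj Y j) A B h g))"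
    using Y.colim_map_germ * assms by simp
  also have "\<dots> = colim_map C X (obj Y j) B (Comp C (obj Y j) A B h g) (\<phi> j)"
    using pro_act_germ[OF assms(1,3) *(1)] X.C.Comp_in[OF j(1) assms(2,3) *(2) assms(4)] by blast
  also have "\<dots> = colim_map C X A B h (colim_map C X (obj Y j) A g (\<phi> j))"
    using X.colim_map_Comp[OF j(1) assms(2,3) *(2) assms(4) j(2)] by simp
  finally show ?thesis using pro_act_germ[OF assms(1,2) *(1,2)] * by simp
qed

end

lemma pro_objectsD:
  assumes "category C" "X \<in> pro_objects \<kappa> C"
  shows "cofiltered_diagram C X"
  using assms unfolding pro_objects_def cofiltered_diagram_def by simp

text \<open>A component of \<psi> is itself a morphism from \<open>Y\<close> to a constant
  pro-object, so composition is the action of \<phi> in each component. The laws of the category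
  \<open>Pro\<close> thus become laws of this action.\<close>

lemma pro_Comp: "Comp (Pro \<kappa> C) X Y Z \<psi> \<phi> =
  (\<lambda>k\<in>idx Z. pro_act C X Y (obj Z k) \<phi> (\<psi> k))"
  unfolding Pro_def pro_act_def by simp

lemma pro_Id: "Id (Pro \<kappa> C) X =
  (\<lambda>i\<in>idx X. germ C X (obj X i) i (Id C (obj X i)))"
  unfolding Pro_def germ_def by simp

lemma pro_simps: "Ob (Pro \<kappa> C) = pro_objects \<kappa> C" "Hom (Pro \<kappa> C) = pro_hom C"
  unfolding Pro_def by simp_all

lemma (in cofiltered_diagram) pro_Id_in: "Id (Pro \<kappa> C) X \<in> pro_hom C X X"
proof -
  let ?X = "obj X"
  have "colim_map C X (?X j) (?X j') (arr X j j' u) (germ C X (?X j) j (Id C (?X j))) =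
      germ C X (?X j') j' (Id C (?X j'))"
    if "j \<in> idx X" "j' \<in> idx X" "u \<in> ihom X j j'" for j j' u
  proof -
    have in_C: "?X j \<in> Ob C" "?X j' \<in> Ob C" "arr X j j' u \<in> Hom C (?X j) (?X j')"
      using that X.omap_in X.amap_in by auto
    have "germ C X (?X j') j' (Id C (?X j')) = germ C X (?X j') j (arr X j j' u)"
      using germ_restrict[OF in_C(2) that(2) C.Id_in[OF in_C(2)] that(1,3)] C.Id_Comp in_C by simp
    then show ?thesis
      using colim_map_germ[OF in_C that(1) C.Id_in] in_C C.Comp_Id by simp
  qed
  then show ?thesis
    unfolding pro_Id pro_hom_def using germ_in C.Id_in X.omap_in by (auto simp: restrict_def)
qed

lemma (in cofiltered_diagram) pro_act_Id:
  assumes "A \<in> Ob C" "d \<in> colim_hom C X A"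
  shows "pro_act C X X A (Id (Pro \<kappa> C) X) d = d"
proof -
  interpret cofiltered_diagrams C X X ..
  show ?thesis using assms(2)
  proof (rule colim_homE)
    fix j g assume *: "j \<in> idx X" "g \<in> Hom C (obj X j) A" "d = germ C X A j g"
    have "obj X j \<in> Ob C" using * X.omap_in by blast
    then show ?thesis
      unfolding *(3) pro_act_germ[OF pro_Id_in assms(1) *(1,2)]
      using colim_map_germ[OF _ assms(1) *(2,1)] C.Id_in C.Comp_Id * assms by (simp add: pro_Id)
  qed
qed

locale cofiltered_diagrams3 =
  XY: cofiltered_diagrams C X Y + YZ: cofiltered_diagrams C Y Z + XZ: cofiltered_diagrams C X Z
  for C :: "('o, 'm) cat" and X Y Z :: "('k, 'o, 'm) diagram"
begin

lemma pro_Comp_in: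
  assumes "\<phi> \<in> pro_hom C X Y" "\<psi> \<in> pro_hom C Y Z"
  shows "Comp (Pro \<kappa> C) X Y Z \<psi> \<phi> \<in> pro_hom C X Z"
proof -
  let ?Z = "obj Z"
  have "colim_map C X (?Z j) (?Z j') (arr Z j j' u) (pro_act C X Y (?Z j) \<phi> (\<psi> j)) =
      pro_act C X Y (?Z j') \<phi> (\<psi> j')"
    if "j \<in> idx Z" "j' \<in> idx Z" "u \<in> ihom Z j j'" for j j' u
    using XY.pro_act_natural[OF assms(1), of "?Z j" "?Z j'"] YZ.Y.X.omap_in YZ.Y.X.amap_in
      pro_hom_in[OF assms(2)] pro_hom_compat[OF assms(2)] that by metis
  then show ?thesis
    unfolding pro_Comp pro_hom_def
    using XY.pro_act_in[OF assms(1)] pro_hom_in[OF assms(2)] YZ.Y.X.omap_in by (auto simp: restrict_def)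
qed

text \<open>On a germ given by \<open>g\<close>, both sides push the component of \<psi> forward
  along \<open>g\<close> and act by \<phi>, in different orders. Naturality of the action exchanges
  the two.\<close>

lemma pro_act_Comp:
  assumes "\<phi> \<in> pro_hom C X Y" "\<psi> \<in> pro_hom C Y Z" "A \<in> Ob C" "d \<in> colim_hom C Z A"
  shows "pro_act C X Z A (Comp (Pro \<kappa> C) X Y Z \<psi> \<phi>) d = pro_act C X Y A \<phi> (pro_act C Y Z A \<psi> d)"
  using assms(4)
proof (rule YZ.Y.colim_homE)
  fix j g assume *: "j \<in> idx Z" "g \<in> Hom C (obj Z j) A" "d = germ C Z A j g"
  have j: "obj Z j \<in> Ob C" "\<psi> j \<in> colim_hom C Y (obj Z j)"
    using * YZ.Y.X.omap_in pro_hom_in assms by auto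
  show ?thesis
    unfolding *(3) XZ.pro_act_germ[OF pro_Comp_in[OF assms(1,2)] assms(3) *(1,2)]
      YZ.pro_act_germ[OF assms(2,3) *(1,2)]
    using XY.pro_act_natural[OF assms(1) j(1) assms(3) *(2) j(2)] * by (simp add: pro_Comp)
qed

end

lemma category_Pro:
  assumes "category C"
  shows "category (Pro \<kappa> C)"
proof -
  have cd: "cofiltered_diagram C X" if "X \<in> pro_objects \<kappa> C" for X
    using pro_objectsD[OF assms that] .
  have cd2: "cofiltered_diagrams C X Y" if "X \<in> pro_objects \<kappa> C" "Y \<in> pro_objects \<kappa> C" for X Y
    using cd that unfolding cofiltered_diagrams_def by blast
  have cd3: "cofiltered_diagrams3 C X Y Z"
    if "X \<in> pro_objects \<kappa> C" "Y \<in> pro_objects \<kappa> C" "Z \<in> pro_objects \<kappa> C" for X Y Z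
    using cd2 that unfolding cofiltered_diagrams3_def by blast
  have om: "obj X j \<in> Ob C" if "X \<in> pro_objects \<kappa> C" "j \<in> idx X" for X j
    using is_functor.omap_in that unfolding pro_objects_def by fast
  have Comp_in: "Comp (Pro \<kappa> C) X Y Z \<psi> \<phi> \<in> pro_hom C X Z"
    if "X \<in> pro_objects \<kappa> C" "Y \<in> pro_objects \<kappa> C" "Z \<in> pro_objects \<kappa> C"
      "\<phi> \<in> pro_hom C X Y" "\<psi> \<in> pro_hom C Y Z" for X Y Z \<phi> \<psi>
    using cofiltered_diagrams3.pro_Comp_in cd3 that by blast
  have Id_in: "Id (Pro \<kappa> C) X \<in> pro_hom C X X" if "X \<in> pro_objects \<kappa> C" for X
    using cofiltered_diagram.pro_Id_in cd that by blast
  show ?thesis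
  proof (unfold_locales, unfold pro_simps)
    fix X Y f assume O: "X \<in> pro_objects \<kappa> C" "Y \<in> pro_objects \<kappa> C" and f: "f \<in> pro_hom C X Y"
    show "Comp (Pro \<kappa> C) X X Y f (Id (Pro \<kappa> C) X) = f"
    proof (rule pro_hom_ext[of _ C X Y])
      fix j assume "j \<in> idx Y"
      then show "Comp (Pro \<kappa> C) X X Y f (Id (Pro \<kappa> C) X) j = f j"
        using cofiltered_diagram.pro_act_Id[OF cd[OF O(1)] om[OF O(2)] pro_hom_in[OF f]]
        by (simp add: pro_Comp)
    qed (use O f Comp_in Id_in in auto)
    show "Comp (Pro \<kappa> C) X Y Y (Id (Pro \<kappa> C) Y) f = f"
    proof (rule pro_hom_ext[of _ C X Y])
      fix j assume j: "j \<in> idx Y"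
      have jC: "obj Y j \<in> Ob C" using om O j by blast
      interpret cofiltered_diagrams C X Y using cd2 O by blast
      show "Comp (Pro \<kappa> C) X Y Y (Id (Pro \<kappa> C) Y) f j = f j"
        using pro_act_germ[OF f jC j] X.C.Id_in[OF jC] X.colim_map_Id[OF jC] pro_hom_in[OF f j] j
        by (simp add: pro_Comp pro_Id)
    qed (use O f Comp_in Id_in in auto)
  next
    fix W X Y Z f g h
    assume O: "W \<in> pro_objects \<kappa> C" "X \<in> pro_objects \<kappa> C" "Y \<in> pro_objects \<kappa> C" "Z \<in> pro_objects \<kappa> C"
      and fgh: "f \<in> pro_hom C W X" "g \<in> pro_hom C X Y" "h \<in> pro_hom C Y Z"
    show "Comp (Pro \<kappa> C) W Y Z h (Comp (Pro \<kappa> C) W X Y g f) =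
        Comp (Pro \<kappa> C) W X Z (Comp (Pro \<kappa> C) X Y Z h g) f"
    proof (rule pro_hom_ext[of _ C W Z])
      fix j assume j: "j \<in> idx Z"
      show "Comp (Pro \<kappa> C) W Y Z h (Comp (Pro \<kappa> C) W X Y g f) j =
          Comp (Pro \<kappa> C) W X Z (Comp (Pro \<kappa> C) X Y Z h g) f j"
        using cofiltered_diagrams3.pro_act_Comp[OF cd3 fgh(1,2)] O om j pro_hom_in[OF fgh(3) j]
        by (simp add: pro_Comp)
    qed (use O fgh Comp_in in auto)
  qed (use Comp_in Id_in in auto)
qed

section \<open>Homomorphisms and the lattice reduct\<close>

lemma tuplesI: "length as = n \<Longrightarrow> (\<And>a. a \<in> set as \<Longrightarrow> a \<in> S) \<Longrightarrow> as \<in> tuples n S"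
  unfolding tuples_def by auto

lemma tuples_map: "as \<in> tuples n S \<Longrightarrow> (\<And>a. a \<in> S \<Longrightarrow> h a \<in> T) \<Longrightarrow> map h as \<in> tuples n T"
  unfolding tuples_def by auto

lemma oper_closed: "is_algebra \<Sigma> A \<Longrightarrow> as \<in> tuples (arity \<Sigma> f) (carrier A) \<Longrightarrow> oper A f as \<in> carrier A"
  unfolding is_algebra_def subuniverse_def by blast

lemma homs_closed: "h \<in> homs \<Sigma> A B \<Longrightarrow> x \<in> carrier A \<Longrightarrow> h x \<in> carrier B"
  unfolding homs_def by (auto simp: PiE_mem)

lemma homs_oper: "h \<in> homs \<Sigma> A B \<Longrightarrow> as \<in> tuples (arity \<Sigma> f) (carrier A) \<Longrightarrow>
    h (oper A f as) = oper B f (map h as)"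
  unfolding homs_def by blast

lemma homs_ext: "h \<in> homs \<Sigma> A B \<Longrightarrow> h' \<in> homs \<Sigma> A B \<Longrightarrow> (\<And>x. x \<in> carrier A \<Longrightarrow> h x = h' x) \<Longrightarrow> h = h'"
  unfolding homs_def by (auto intro: PiE_ext)

lemma homsI:
  assumes "\<And>x. x \<in> carrier A \<Longrightarrow> h x \<in> carrier B" "h \<in> extensional (carrier A)"
    "\<And>f as. as \<in> tuples (arity \<Sigma> f) (carrier A) \<Longrightarrow> h (oper A f as) = oper B f (map h as)"
  shows "h \<in> homs \<Sigma> A B"
  using assms unfolding homs_def by (auto simp: PiE_def)

lemma homs_compose:
  assumes "is_algebra \<Sigma> A" "f \<in> homs \<Sigma> A B" "g \<in> homs \<Sigma> B D"
  shows "compose (carrier A) g f \<in> homs \<Sigma> A D"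
proof (rule homsI)
  fix h as assume as: "as \<in> tuples (arity \<Sigma> h) (carrier A)"
  have eq: "map (compose (carrier A) g f) as = map g (map f as)"
    using as unfolding tuples_def by (auto simp: compose_def)
  have "map f as \<in> tuples (arity \<Sigma> h) (carrier B)"
    using tuples_map[OF as] homs_closed[OF assms(2)] by blast
  from homs_oper[OF assms(3) this] homs_oper[OF assms(2) as]
  show "compose (carrier A) g f (oper A h as) = oper D h (map (compose (carrier A) g f) as)"
    unfolding eq using oper_closed[OF assms(1) as] by (simp add: compose_def)
qed (use assms in \<open>auto simp: compose_def homs_closed\<close>)

lemma homs_id: "is_algebra \<Sigma> A \<Longrightarrow> (\<lambda>x\<in>carrier A. x) \<in> homs \<Sigma> A A"
proof (rule homsI)
  fix f as assume A: "is_algebra \<Sigma> A" and as: "as \<in> tuples (arity \<Sigma> f) (carrier A)"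
  have "map (\<lambda>x\<in>carrier A. x) as = as"
    using as unfolding tuples_def by (intro map_idI) auto
  then show "(\<lambda>x\<in>carrier A. x) (oper A f as) = oper A f (map (\<lambda>x\<in>carrier A. x) as)"
    using oper_closed[OF A as] by simp
qed auto

lemma term_op_closed:
  assumes "is_algebra \<Sigma> A" "is_term \<Sigma> n t" "as \<in> tuples n (carrier A)"
  shows "term_op A t as \<in> carrier A"
  using assms(2)
proof induction
  case (1 i)
  then show ?case using assms(3) unfolding tuples_def by auto
next
  case (2 ts f)
  then show ?case using assms(1) by (auto intro!: oper_closed tuplesI)
qed

lemma homs_term_op:
  assumes "is_algebra \<Sigma> A" "h \<in> homs \<Sigma> A B" "is_term \<Sigma> n t" "as \<in> tuples n (carrier A)"
  shows "h (term_op A t as) = term_op B t (map h as)"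
  using assms(3)
proof induction
  case (1 i)
  then show ?case using assms(4) unfolding tuples_def by auto
next
  case (2 ts f)
  have "map (\<lambda>t. term_op A t as) ts \<in> tuples (arity \<Sigma> f) (carrier A)"
    using 2 term_op_closed[OF assms(1) _ assms(4)] by (auto intro!: tuplesI)
  from homs_oper[OF assms(2) this] 2 show ?case
    by (auto intro!: arg_cong[where f = "oper B f"])
qed

context
  fixes \<Sigma> :: "'f signature"
  assumes sig: "lattice_signature \<Sigma>"
begin

lemma lattice_ops_closed:
  assumes "is_algebra \<Sigma> A"
  shows "x \<in> carrier A \<Longrightarrow> y \<in> carrier A \<Longrightarrow> alg_meet \<Sigma> A x y \<in> carrier A"
    "x \<in> carrier A \<Longrightarrow> y \<in> carrier A \<Longrightarrow> alg_join \<Sigma> A x y \<in> carrier A"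
    "alg_zero \<Sigma> A \<in> carrier A" "alg_one \<Sigma> A \<in> carrier A"
  using sig assms unfolding lattice_signature_def
  by (auto intro!: oper_closed[OF assms] tuplesI)

lemma homs_lattice_ops:
  assumes "h \<in> homs \<Sigma> A B"
  shows "x \<in> carrier A \<Longrightarrow> y \<in> carrier A \<Longrightarrow> h (alg_meet \<Sigma> A x y) = alg_meet \<Sigma> B (h x) (h y)"
    "x \<in> carrier A \<Longrightarrow> y \<in> carrier A \<Longrightarrow> h (alg_join \<Sigma> A x y) = alg_join \<Sigma> B (h x) (h y)"
    "h (alg_zero \<Sigma> A) = alg_zero \<Sigma> B" "h (alg_one \<Sigma> A) = alg_one \<Sigma> B"
proof -
  show "x \<in> carrier A \<Longrightarrow> y \<in> carrier A \<Longrightarrow> h (alg_meet \<Sigma> A x y) = alg_meet \<Sigma> B (h x) (h y)"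
    using homs_oper[OF assms, of "[x, y]" "meet_sym \<Sigma>"] sig unfolding lattice_signature_def tuples_def by simp
  show "x \<in> carrier A \<Longrightarrow> y \<in> carrier A \<Longrightarrow> h (alg_join \<Sigma> A x y) = alg_join \<Sigma> B (h x) (h y)"
    using homs_oper[OF assms, of "[x, y]" "join_sym \<Sigma>"] sig unfolding lattice_signature_def tuples_def by simp
  show "h (alg_zero \<Sigma> A) = alg_zero \<Sigma> B"
    using homs_oper[OF assms, of "[]" "zero_sym \<Sigma>"] sig unfolding lattice_signature_def tuples_def by simp
  show "h (alg_one \<Sigma> A) = alg_one \<Sigma> B"
    using homs_oper[OF assms, of "[]" "one_sym \<Sigma>"] sig unfolding lattice_signature_def tuples_def by simp
qed

text \<open>The laws are equations, and every element of \<open>A\<close> is the image of an element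
  of \<open>S\<close>, where they hold.\<close>

lemma bounded_lattice_quotient:
  assumes S: "is_algebra \<Sigma> S" "bounded_lattice_algebra \<Sigma> S" and q: "q \<in> homs \<Sigma> S A" "q ` carrier S = carrier A"
  shows "bounded_lattice_algebra \<Sigma> A"
proof -
  have l: "\<exists>s \<in> carrier S. x = q s" if "x \<in> carrier A" for x using q(2) that by blast
  note h = homs_lattice_ops[OF q(1), symmetric] and c = lattice_ops_closed[OF S(1)]
  note ls = S(2)[unfolded bounded_lattice_algebra_def is_bounded_lattice_def is_lattice_def]
  have 1: "alg_meet \<Sigma> A x y \<in> carrier A \<and> alg_join \<Sigma> A x y \<in> carrier A \<and> alg_meet \<Sigma> A x y = alg_meet \<Sigma> A y x \<and>
      alg_join \<Sigma> A x y = alg_join \<Sigma> A y x \<and> alg_meet \<Sigma> A x (alg_join \<Sigma> A x y) = x \<and>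
      alg_join \<Sigma> A x (alg_meet \<Sigma> A x y) = x" if "x \<in> carrier A" "y \<in> carrier A" for x y
    using l[OF that(1)] l[OF that(2)] homs_closed[OF q(1)] ls by (auto simp: h c)
  have 2: "alg_meet \<Sigma> A (alg_meet \<Sigma> A x y) z = alg_meet \<Sigma> A x (alg_meet \<Sigma> A y z) \<and>
      alg_join \<Sigma> A (alg_join \<Sigma> A x y) z = alg_join \<Sigma> A x (alg_join \<Sigma> A y z)"
    if "x \<in> carrier A" "y \<in> carrier A" "z \<in> carrier A" for x y z
    using l[OF that(1)] l[OF that(2)] l[OF that(3)] ls by (auto simp: h c)
  have 3: "alg_meet \<Sigma> A (alg_zero \<Sigma> A) x = alg_zero \<Sigma> A \<and> alg_meet \<Sigma> A x (alg_one \<Sigma> A) = x"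
    if "x \<in> carrier A" for x
    using l[OF that] ls by (auto simp: h c)
  have 4: "alg_zero \<Sigma> A \<in> carrier A" "alg_one \<Sigma> A \<in> carrier A"
    using homs_closed[OF q(1)] c by (auto simp: h)
  show ?thesis
    unfolding bounded_lattice_algebra_def is_bounded_lattice_def is_lattice_def using 1 2 3 4 by blast
qed

end

section \<open>Laws of bounded lattices, with the order written as \<open>m x y = x\<close>\<close>

locale bounded_lattice_alg =
  fixes \<Sigma> :: "'f signature" and A :: "('f, 'a) algebra"
  assumes bl: "bounded_lattice_algebra \<Sigma> A"
begin

abbreviation "m \<equiv> alg_meet \<Sigma> A"
abbreviation "j \<equiv> alg_join \<Sigma> A"
abbreviation "z \<equiv> alg_zero \<Sigma> A"
abbreviation "e \<equiv> alg_one \<Sigma> A"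

lemmas laws = bl[unfolded bounded_lattice_algebra_def is_bounded_lattice_def is_lattice_def]

lemma closed [simp]:
  "x \<in> carrier A \<Longrightarrow> y \<in> carrier A \<Longrightarrow> m x y \<in> carrier A"
  "x \<in> carrier A \<Longrightarrow> y \<in> carrier A \<Longrightarrow> j x y \<in> carrier A"
  "z \<in> carrier A" "e \<in> carrier A"
  using laws by auto

lemma comm: "x \<in> carrier A \<Longrightarrow> y \<in> carrier A \<Longrightarrow> m x y = m y x"
  "x \<in> carrier A \<Longrightarrow> y \<in> carrier A \<Longrightarrow> j x y = j y x"
  using laws by blast+

lemma assoc:
  "x \<in> carrier A \<Longrightarrow> y \<in> carrier A \<Longrightarrow> w \<in> carrier A \<Longrightarrow> m (m x y) w = m x (m y w)"
  "x \<in> carrier A \<Longrightarrow> y \<in> carrier A \<Longrightarrow> w \<in> carrier A \<Longrightarrow> j (j x y) w = j x (j y w)"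
  using laws by blast+

lemma absorb: "x \<in> carrier A \<Longrightarrow> y \<in> carrier A \<Longrightarrow> m x (j x y) = x"
  "x \<in> carrier A \<Longrightarrow> y \<in> carrier A \<Longrightarrow> j x (m x y) = x"
  using laws by blast+

lemma bounds [simp]: "x \<in> carrier A \<Longrightarrow> m z x = z" "x \<in> carrier A \<Longrightarrow> m x e = x"
  "x \<in> carrier A \<Longrightarrow> m x z = z" "x \<in> carrier A \<Longrightarrow> m e x = x"
  using laws comm(1) by (auto simp: closed)

lemma idem [simp]: "x \<in> carrier A \<Longrightarrow> m x x = x" "x \<in> carrier A \<Longrightarrow> j x x = x"
  using absorb closed by metis+

lemma bounds_join [simp]: "x \<in> carrier A \<Longrightarrow> j z x = x" "x \<in> carrier A \<Longrightarrow> j x z = x"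
  "x \<in> carrier A \<Longrightarrow> j x e = e" "x \<in> carrier A \<Longrightarrow> j e x = e"
  using absorb[of x z] absorb[of e x] comm(2) by (auto simp: closed)

lemma le_join_iff: "x \<in> carrier A \<Longrightarrow> y \<in> carrier A \<Longrightarrow> m x y = x \<longleftrightarrow> j x y = y"
  using absorb comm by metis

lemma le_trans:
  "x \<in> carrier A \<Longrightarrow> y \<in> carrier A \<Longrightarrow> w \<in> carrier A \<Longrightarrow> m x y = x \<Longrightarrow> m y w = y \<Longrightarrow> m x w = x"
  using assoc(1) by metis

lemma le_antisym: "x \<in> carrier A \<Longrightarrow> y \<in> carrier A \<Longrightarrow> m x y = x \<Longrightarrow> m y x = y \<Longrightarrow> x = y"
  using comm(1) by metis

lemma meet_greatest: "x \<in> carrier A \<Longrightarrow> y \<in> carrier A \<Longrightarrow> w \<in> carrier A \<Longrightarrow>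
    m w x = w \<Longrightarrow> m w y = w \<Longrightarrow> m w (m x y) = w"
  using assoc(1) by metis

lemma meet_lower: "x \<in> carrier A \<Longrightarrow> y \<in> carrier A \<Longrightarrow> m (m x y) x = m x y"
  "x \<in> carrier A \<Longrightarrow> y \<in> carrier A \<Longrightarrow> m (m x y) y = m x y"
  using assoc(1) comm(1) idem(1) closed(1) by metis+

lemma join_least: "x \<in> carrier A \<Longrightarrow> y \<in> carrier A \<Longrightarrow> w \<in> carrier A \<Longrightarrow>
    m x w = x \<Longrightarrow> m y w = y \<Longrightarrow> m (j x y) w = j x y"
  by (simp add: le_join_iff assoc(2))

lemma join_upper: "x \<in> carrier A \<Longrightarrow> y \<in> carrier A \<Longrightarrow> m x (j x y) = x"
  "x \<in> carrier A \<Longrightarrow> y \<in> carrier A \<Longrightarrow> m y (j x y) = y"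
  using absorb(1) comm(2) by metis+

end

text \<open>A relation instead of the choice operators of the library: a witness can be exhibited
  and compared coordinatewise. The set \<open>K\<close> is a parameter because the skeleton is
  treated with the meet of the whole algebra.\<close>

definition lub :: "'a set \<Rightarrow> ('a \<Rightarrow> 'a \<Rightarrow> 'a) \<Rightarrow> 'a set \<Rightarrow> 'a \<Rightarrow> bool" where
  "lub K m X s \<longleftrightarrow> s \<in> K \<and> (\<forall>x\<in>X. m x s = x) \<and> (\<forall>u\<in>K. (\<forall>x\<in>X. m x u = x) \<longrightarrow> m s u = s)"

definition glb :: "'a set \<Rightarrow> ('a \<Rightarrow> 'a \<Rightarrow> 'a) \<Rightarrow> 'a set \<Rightarrow> 'a \<Rightarrow> bool" where
  "glb K m X s \<longleftrightarrow> s \<in> K \<and> (\<forall>x\<in>X. m s x = s) \<and> (\<forall>u\<in>K. (\<forall>x\<in>X. m u x = u) \<longrightarrow> m u s = u)"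

lemma least_iff_lub: "X \<subseteq> K \<Longrightarrow> least (meet_order K m) s (Upper (meet_order K m) X) \<longleftrightarrow> lub K m X s"
  unfolding least_def Upper_def meet_order_def lub_def by (simp add: subset_iff) blast

lemma greatest_iff_glb: "X \<subseteq> K \<Longrightarrow> greatest (meet_order K m) s (Lower (meet_order K m) X) \<longleftrightarrow> glb K m X s"
  unfolding greatest_def Lower_def meet_order_def glb_def by (simp add: subset_iff) blast

lemma complete_lattice_lub:
  assumes "complete_lattice (meet_order K m)" "X \<subseteq> K"
  shows "\<exists>s. lub K m X s"
proof -
  have "X \<subseteq> carrier (meet_order K m)" using assms(2) by (simp add: meet_order_def)
  then show ?thesis
    using complete_lattice.sup_exists[OF assms(1)] least_iff_lub[OF assms(2)] by metis
qed

lemma complete_latticeI: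
  assumes "\<And>x. x \<in> K \<Longrightarrow> m x x = x" "\<And>x y. x \<in> K \<Longrightarrow> y \<in> K \<Longrightarrow> m x y = x \<Longrightarrow> m y x = y \<Longrightarrow> x = y"
    "\<And>x y w. x \<in> K \<Longrightarrow> y \<in> K \<Longrightarrow> w \<in> K \<Longrightarrow> m x y = x \<Longrightarrow> m y w = y \<Longrightarrow> m x w = x"
    "\<And>X. X \<subseteq> K \<Longrightarrow> \<exists>s. lub K m X s" "\<And>X. X \<subseteq> K \<Longrightarrow> \<exists>s. glb K m X s"
  shows "complete_lattice (meet_order K m)"
proof -
  let ?L = "meet_order K m"
  have "partial_order ?L"
    by (unfold_locales; (simp add: meet_order_def)?; (blast intro: assms(1-3))?)
  moreover have "\<exists>s. least ?L s (Upper ?L X)" "\<exists>s. greatest ?L s (Lower ?L X)" if "X \<subseteq> carrier ?L" for X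
  proof -
    have "X \<subseteq> K" using that by (simp add: meet_order_def)
    then show "\<exists>s. least ?L s (Upper ?L X)" "\<exists>s. greatest ?L s (Lower ?L X)"
      using assms(4,5) least_iff_lub greatest_iff_glb by metis+
  qed
  ultimately show ?thesis
    unfolding complete_lattice_def complete_lattice_axioms_def by blast
qed

lemma sup_eq_lub:
  assumes "\<And>x y. x \<in> K \<Longrightarrow> y \<in> K \<Longrightarrow> m x y = m y x" "X \<subseteq> K" "lub K m X s"
  shows "\<Squnion>\<^bsub>meet_order K m\<^esub> X = s"
  unfolding sup_def
proof (rule some_equality)
  show "least (meet_order K m) s (Upper (meet_order K m) X)" using assms least_iff_lub by metis
  fix t assume "least (meet_order K m) t (Upper (meet_order K m) X)"
  then have "lub K m X t" using least_iff_lub assms(2) by metis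
  then show "t = s" using assms unfolding lub_def by metis
qed

lemma inf_eq_glb:
  assumes "\<And>x y. x \<in> K \<Longrightarrow> y \<in> K \<Longrightarrow> m x y = m y x" "X \<subseteq> K" "glb K m X s"
  shows "\<Sqinter>\<^bsub>meet_order K m\<^esub> X = s"
  unfolding inf_def
proof (rule some_equality)
  show "greatest (meet_order K m) s (Lower (meet_order K m) X)" using assms greatest_iff_glb by metis
  fix t assume "greatest (meet_order K m) t (Lower (meet_order K m) X)"
  then have "glb K m X t" using greatest_iff_glb assms(2) by metis
  then show "t = s" using assms unfolding glb_def by metis
qed

context bounded_lattice_alg
begin

lemma lub_empty: "lub (carrier A) m {} z"
  unfolding lub_def by simp

lemma glb_empty: "glb (carrier A) m {} e"
  unfolding glb_def by simp

lemma lub_insert: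
  assumes "x \<in> carrier A" "X \<subseteq> carrier A" "lub (carrier A) m X s"
  shows "lub (carrier A) m (insert x X) (j x s)"
proof -
  have s: "s \<in> carrier A" using assms(3) unfolding lub_def by blast
  have "m y (j x s) = y" if "y \<in> X" for y
    using le_trans[of y s "j x s"] join_upper[of x s] assms that s closed unfolding lub_def by blast
  then show ?thesis
    using assms s join_upper[of x s] join_least[of x s] unfolding lub_def by simp
qed

lemma glb_insert:
  assumes "x \<in> carrier A" "X \<subseteq> carrier A" "glb (carrier A) m X t"
  shows "glb (carrier A) m (insert x X) (m x t)"
proof -
  have t: "t \<in> carrier A" using assms(3) unfolding glb_def by blast
  have "m (m x t) y = m x t" if "y \<in> X" for y
    using le_trans[of "m x t" t y] meet_lower[of x t] assms that t closed unfolding glb_def by blast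
  then show ?thesis
    using assms t meet_lower[of x t] meet_greatest[of x t] unfolding glb_def by simp
qed

text \<open>A finite join or meet is iterated from binary ones, starting at a bound. It therefore
  stays in any sublattice \<open>W\<close> that contains the bounds, although it is taken in the
  whole carrier. The set \<open>W\<close> will be the set of values of one coordinate.\<close>

lemma finite_lub_glb:
  assumes "finite X" "X \<subseteq> W" "W \<subseteq> carrier A" "z \<in> W" "e \<in> W"
    "\<And>x y. x \<in> W \<Longrightarrow> y \<in> W \<Longrightarrow> m x y \<in> W \<and> j x y \<in> W"
  shows "(\<exists>s \<in> W. lub (carrier A) m X s) \<and> (\<exists>s \<in> W. glb (carrier A) m X s)"
  using assms(1,2)
proof (induction X)
  case empty
  then show ?case using lub_empty glb_empty assms by blast
next
  case (insert x X)
  then have "x \<in> carrier A" "X \<subseteq> carrier A" using assms(3) by auto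
  then show ?case using lub_insert glb_insert insert assms(6) by (meson insert_subset)
qed

lemma finite_complete_lattice:
  assumes "finite (carrier A)"
  shows "complete_lattice (lattice_reduct \<Sigma> A)"
proof (rule complete_latticeI)
  fix X assume "X \<subseteq> carrier A"
  then have "(\<exists>s \<in> carrier A. lub (carrier A) m X s) \<and> (\<exists>s \<in> carrier A. glb (carrier A) m X s)"
    using assms finite_subset by (intro finite_lub_glb) auto
  then show "\<exists>s. lub (carrier A) m X s" "\<exists>s. glb (carrier A) m X s" by auto
qed (fact idem(1), fact le_antisym, fact le_trans)

lemma sup_eq: "X \<subseteq> carrier A \<Longrightarrow> lub (carrier A) m X s \<Longrightarrow> \<Squnion>\<^bsub>lattice_reduct \<Sigma> A\<^esub> X = s"
  by (rule sup_eq_lub) (rule comm(1))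

lemma inf_eq: "X \<subseteq> carrier A \<Longrightarrow> glb (carrier A) m X s \<Longrightarrow> \<Sqinter>\<^bsub>lattice_reduct \<Sigma> A\<^esub> X = s"
  by (rule inf_eq_glb) (rule comm(1))

end

lemma complete_homsI:
  assumes "bounded_lattice_algebra \<Sigma> A" "bounded_lattice_algebra \<Sigma> B" "h \<in> homs \<Sigma> A B"
    "\<And>X. X \<subseteq> carrier A \<Longrightarrow> \<exists>s. lub (carrier A) (alg_meet \<Sigma> A) X s \<and> lub (carrier B) (alg_meet \<Sigma> B) (h ` X) (h s)"
    "\<And>X. X \<subseteq> carrier A \<Longrightarrow> \<exists>s. glb (carrier A) (alg_meet \<Sigma> A) X s \<and> glb (carrier B) (alg_meet \<Sigma> B) (h ` X) (h s)"
  shows "h \<in> complete_homs \<Sigma> A B"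
proof -
  interpret A: bounded_lattice_alg \<Sigma> A using assms by (simp add: bounded_lattice_alg_def)
  interpret B: bounded_lattice_alg \<Sigma> B using assms by (simp add: bounded_lattice_alg_def)
  have "h (\<Squnion>\<^bsub>lattice_reduct \<Sigma> A\<^esub> X) = \<Squnion>\<^bsub>lattice_reduct \<Sigma> B\<^esub> (h ` X) \<and>
     h (\<Sqinter>\<^bsub>lattice_reduct \<Sigma> A\<^esub> X) = \<Sqinter>\<^bsub>lattice_reduct \<Sigma> B\<^esub> (h ` X)" if X: "X \<subseteq> carrier A" for X
  proof -
    have hX: "h ` X \<subseteq> carrier B" using X homs_closed[OF assms(3)] by blast
    obtain s t where s: "lub (carrier A) A.m X s" "lub (carrier B) B.m (h ` X) (h s)"
      and t: "glb (carrier A) A.m X t" "glb (carrier B) B.m (h ` X) (h t)"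
      using assms(4,5)[OF X] by blast
    show ?thesis
      unfolding A.sup_eq[OF X s(1)] A.inf_eq[OF X t(1)] B.sup_eq[OF hX s(2)] B.inf_eq[OF hX t(2)]
      by simp
  qed
  then show ?thesis unfolding complete_homs_def using assms(3) by blast
qed

text \<open>In a finite algebra every join or meet is an iterated binary one, with a bound for the
  empty set, and a homomorphism preserves all of these.\<close>

lemma finite_homs_complete:
  assumes "lattice_signature \<Sigma>" "bounded_lattice_algebra \<Sigma> A" "bounded_lattice_algebra \<Sigma> B"
    "h \<in> homs \<Sigma> A B" "finite (carrier A)"
  shows "h \<in> complete_homs \<Sigma> A B"
proof (rule complete_homsI[OF assms(2-4)])
  interpret A: bounded_lattice_alg \<Sigma> A using assms by (simp add: bounded_lattice_alg_def)
  interpret B: bounded_lattice_alg \<Sigma> B using assms by (simp add: bounded_lattice_alg_def)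
  fix X assume X: "X \<subseteq> carrier A"
  then have "finite X" using assms(5) finite_subset by blast
  then show "\<exists>s. lub (carrier A) A.m X s \<and> lub (carrier B) B.m (h ` X) (h s)" using X
  proof (induction X)
    case empty
    then show ?case using A.lub_empty B.lub_empty homs_lattice_ops(3)[OF assms(1,4)] by auto
  next
    case (insert x X)
    then obtain s where s: "lub (carrier A) A.m X s" "lub (carrier B) B.m (h ` X) (h s)" by auto
    have c: "x \<in> carrier A" "X \<subseteq> carrier A" "s \<in> carrier A" "h x \<in> carrier B" "h ` X \<subseteq> carrier B"
      using insert.prems s(1) homs_closed[OF assms(4)] unfolding lub_def by auto
    show ?case
      using A.lub_insert[OF c(1,2) s(1)] B.lub_insert[OF c(4,5) s(2)] homs_lattice_ops(2)[OF assms(1,4) c(1,3)]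
      by (intro exI[of _ "A.j x s"]) simp
  qed
  from \<open>finite X\<close> show "\<exists>s. glb (carrier A) A.m X s \<and> glb (carrier B) B.m (h ` X) (h s)" using X
  proof (induction X)
    case empty
    then show ?case using A.glb_empty B.glb_empty homs_lattice_ops(4)[OF assms(1,4)] by auto
  next
    case (insert x X)
    then obtain s where s: "glb (carrier A) A.m X s" "glb (carrier B) B.m (h ` X) (h s)" by auto
    have c: "x \<in> carrier A" "X \<subseteq> carrier A" "s \<in> carrier A" "h x \<in> carrier B" "h ` X \<subseteq> carrier B"
      using insert.prems s(1) homs_closed[OF assms(4)] unfolding glb_def by auto
    show ?case
      using A.glb_insert[OF c(1,2) s(1)] B.glb_insert[OF c(4,5) s(2)] homs_lattice_ops(1)[OF assms(1,4) c(1,3)]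
      by (intro exI[of _ "A.m x s"]) simp
  qed
qed

section \<open>The variety generated by a semi-primal algebra\<close>

locale semiprimal =
  fixes \<Sigma> :: "'f signature" and L :: "('f, 'l) algebra"
  assumes sig: "lattice_signature \<Sigma>" and alg_L: "is_algebra \<Sigma> L" and fin_L: "finite (carrier L)"
    and bl_L: "bounded_lattice_algebra \<Sigma> L" and zero_one: "alg_zero \<Sigma> L \<noteq> alg_one \<Sigma> L"
    and sp: "semi_primal \<Sigma> L"

sublocale semiprimal \<subseteq> L: bounded_lattice_alg \<Sigma> L
  using bl_L by (simp add: bounded_lattice_alg_def)

context semiprimal
begin

abbreviation "z0 \<equiv> alg_zero \<Sigma> L"
abbreviation "o1 \<equiv> alg_one \<Sigma> L"
abbreviation "T l A x \<equiv> T_op \<Sigma> L l A x"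

text \<open>Every subalgebra contains 0 and 1 because they are constants of the signature. So a
  function with only these values preserves subalgebras, and semi-primality supplies a term for
  it.\<close>

lemma ex_indicator_term:
  assumes "n \<ge> 1"
  shows "\<exists>t. defines_term \<Sigma> L n (\<lambda>as. if P as then o1 else z0) t"
proof -
  have "o1 \<in> S" "z0 \<in> S" if "subuniverse \<Sigma> L S" for S
    using that sig unfolding subuniverse_def lattice_signature_def tuples_def
    by (metis (mono_tags, lifting) empty_subsetI list.set(1) list.size(3) mem_Collect_eq)+
  then have "o1 \<in> generated \<Sigma> L X" "z0 \<in> generated \<Sigma> L X" for X
    unfolding generated_def by blast+
  then show ?thesis using sp assms unfolding semi_primal_def by simp
qed

definition eq_term :: "'f trm" where
  "eq_term = (SOME t. defines_term \<Sigma> L 2 (\<lambda>as. if as ! 0 = as ! 1 then o1 else z0) t)"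

text \<open>The Boolean truth value of \<open>x = y\<close>, extended from \<open>L\<close> to the
  variety by its term. It transfers the separation of elements to the skeleton.\<close>

definition eq_op :: "('f, 'a) algebra \<Rightarrow> 'a \<Rightarrow> 'a \<Rightarrow> 'a" where
  "eq_op A x y = term_op A eq_term [x, y]"

lemma T_term: "defines_term \<Sigma> L 1 (\<lambda>as. if as ! 0 = l then o1 else z0) (T_term \<Sigma> L l)"
  unfolding T_term_def by (rule someI_ex) (simp add: ex_indicator_term)

lemma eq_term: "defines_term \<Sigma> L 2 (\<lambda>as. if as ! 0 = as ! 1 then o1 else z0) eq_term"
  unfolding eq_term_def by (rule someI_ex) (simp add: ex_indicator_term)

lemma T_L [simp]: "x \<in> carrier L \<Longrightarrow> T l L x = (if x = l then o1 else z0)"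
  using T_term[of l] unfolding defines_term_def T_op_def tuples_def by simp

lemma eq_op_L [simp]: "x \<in> carrier L \<Longrightarrow> y \<in> carrier L \<Longrightarrow> eq_op L x y = (if x = y then o1 else z0)"
  using eq_term unfolding defines_term_def eq_op_def tuples_def by simp

lemma T_closed: "is_algebra \<Sigma> A \<Longrightarrow> x \<in> carrier A \<Longrightarrow> T l A x \<in> carrier A"
  unfolding T_op_def using term_op_closed[of \<Sigma> A 1 "T_term \<Sigma> L l" "[x]"] T_term[of l]
  unfolding defines_term_def tuples_def by simp

lemma eq_op_closed: "is_algebra \<Sigma> A \<Longrightarrow> x \<in> carrier A \<Longrightarrow> y \<in> carrier A \<Longrightarrow> eq_op A x y \<in> carrier A"
  unfolding eq_op_def using term_op_closed[of \<Sigma> A 2 eq_term "[x, y]"] eq_term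
  unfolding defines_term_def tuples_def by simp

lemma homs_T: "is_algebra \<Sigma> A \<Longrightarrow> h \<in> homs \<Sigma> A B \<Longrightarrow> x \<in> carrier A \<Longrightarrow> h (T l A x) = T l B (h x)"
  unfolding T_op_def using homs_term_op[of \<Sigma> A h B 1 "T_term \<Sigma> L l" "[x]"] T_term[of l]
  unfolding defines_term_def tuples_def by simp

lemma homs_eq_op: "is_algebra \<Sigma> A \<Longrightarrow> h \<in> homs \<Sigma> A B \<Longrightarrow> x \<in> carrier A \<Longrightarrow> y \<in> carrier A \<Longrightarrow>
    h (eq_op A x y) = eq_op B (h x) (h y)"
  unfolding eq_op_def using homs_term_op[of \<Sigma> A h B 2 eq_term "[x, y]"] eq_term
  unfolding defines_term_def tuples_def by simp

text \<open>The join over \<open>ls\<close> of the elements \<open>a\<close> meet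
  \<open>T l A x\<close>. With \<open>ls\<close> listing all of \<open>L\<close> and
  \<open>a\<close> Boolean it returns \<open>a\<close>, which says that every \<open>x\<close> takes
  some value in \<open>L\<close> everywhere on \<open>a\<close>.\<close>

definition join_T :: "('f, 'a) algebra \<Rightarrow> 'a \<Rightarrow> 'a \<Rightarrow> 'l list \<Rightarrow> 'a" where
  "join_T A a x ls = foldr (\<lambda>l r. alg_join \<Sigma> A (alg_meet \<Sigma> A a (T l A x)) r) ls (alg_zero \<Sigma> A)"

text \<open>The truth value of the conjunction of the statements \<open>x = l\<close> over the pairs
  in the list. It describes one line of the operation table of \<open>L\<close>.\<close>

definition meet_T :: "('f, 'a) algebra \<Rightarrow> ('l \<times> 'a) list \<Rightarrow> 'a" where
  "meet_T A ps = foldr (\<lambda>(l, x) r. alg_meet \<Sigma> A (T l A x) r) ps (alg_one \<Sigma> A)"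

lemma join_T_closed:
  "is_algebra \<Sigma> A \<Longrightarrow> a \<in> carrier A \<Longrightarrow> x \<in> carrier A \<Longrightarrow> join_T A a x ls \<in> carrier A"
  unfolding join_T_def by (induction ls) (auto simp: lattice_ops_closed[OF sig] T_closed)

lemma meet_T_closed: "is_algebra \<Sigma> A \<Longrightarrow> snd ` set ps \<subseteq> carrier A \<Longrightarrow> meet_T A ps \<in> carrier A"
  unfolding meet_T_def by (induction ps) (auto simp: lattice_ops_closed[OF sig] T_closed)

lemma homs_join_T:
  assumes "is_algebra \<Sigma> A" "h \<in> homs \<Sigma> A B" "a \<in> carrier A" "x \<in> carrier A"
  shows "h (join_T A a x ls) = join_T B (h a) (h x) ls"
proof (induction ls)
  case Nil
  then show ?case using homs_lattice_ops[OF sig assms(2)] unfolding join_T_def by simp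
next
  case (Cons l ls)
  then show ?case
    using homs_lattice_ops[OF sig assms(2)] join_T_closed[OF assms(1,3,4), of ls] homs_T[OF assms(1,2)]
      lattice_ops_closed[OF sig assms(1)] T_closed[OF assms(1)] assms
    unfolding join_T_def by simp
qed

lemma homs_meet_T:
  assumes "is_algebra \<Sigma> A" "h \<in> homs \<Sigma> A B" "snd ` set ps \<subseteq> carrier A"
  shows "h (meet_T A ps) = meet_T B (map (map_prod id h) ps)"
  using assms(3)
proof (induction ps)
  case Nil
  then show ?case using homs_lattice_ops[OF sig assms(2)] unfolding meet_T_def by simp
next
  case (Cons p ps)
  then show ?case
    using homs_lattice_ops[OF sig assms(2)] meet_T_closed[OF assms(1), of ps] homs_T[OF assms(1,2)]
      T_closed[OF assms(1)]
    unfolding meet_T_def by (auto split: prod.splits)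
qed

lemma join_T_L:
  assumes "a = o1 \<or> a = z0" "x \<in> carrier L"
  shows "join_T L a x ls = (if x \<in> set ls then a else z0)"
  using assms unfolding join_T_def by (induction ls) auto

lemma meet_T_L:
  assumes "snd ` set ps \<subseteq> carrier L"
  shows "meet_T L ps = (if \<forall>(l, x) \<in> set ps. l = x then o1 else z0)"
  using assms unfolding meet_T_def by (induction ps) auto

text \<open>Up to isomorphism these are the subalgebras of powers of \<open>L\<close>. In them an
  equation can be verified after each homomorphism to \<open>L\<close>.\<close>

definition separated :: "('f, 'a) algebra \<Rightarrow> bool" where
  "separated A \<longleftrightarrow> is_algebra \<Sigma> A \<and>
     (\<forall>x \<in> carrier A. \<forall>y \<in> carrier A. (\<forall>p \<in> homs \<Sigma> A L. p x = p y) \<longrightarrow> x = y)"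

lemma separated_eqI:
  "separated A \<Longrightarrow> x \<in> carrier A \<Longrightarrow> y \<in> carrier A \<Longrightarrow> (\<And>p. p \<in> homs \<Sigma> A L \<Longrightarrow> p x = p y) \<Longrightarrow> x = y"
  unfolding separated_def by blast

lemma separated_alg: "separated A \<Longrightarrow> is_algebra \<Sigma> A"
  unfolding separated_def by blast

lemma HSP_alg: "HSP \<Sigma> L A \<Longrightarrow> is_algebra \<Sigma> A"
  unfolding HSP_def by blast

lemma separated_subpower:
  assumes "subuniverse \<Sigma> (power_algebra L J) S"
  shows "separated (power_algebra L J\<lparr>carrier := S\<rparr>)"
proof -
  let ?S = "power_algebra L J\<lparr>carrier := S\<rparr>"
  have alg: "is_algebra \<Sigma> ?S"
    using assms unfolding is_algebra_def subuniverse_def power_algebra_def by simp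
  have SJ: "S \<subseteq> J \<rightarrow>\<^sub>E carrier L"
    using assms unfolding subuniverse_def power_algebra_def by simp
  have "(\<lambda>s\<in>S. s j) \<in> homs \<Sigma> ?S L" if j: "j \<in> J" for j
  proof (rule homsI)
    fix f as assume as: "as \<in> tuples (arity \<Sigma> f) (carrier ?S)"
    have "map (\<lambda>s\<in>S. s j) as = map (\<lambda>a. a j) as"
      using as unfolding tuples_def by auto
    then show "(\<lambda>s\<in>S. s j) (oper ?S f as) = oper L f (map (\<lambda>s\<in>S. s j) as)"
      using oper_closed[OF alg as] j by (simp add: power_algebra_def del: map_eq_conv)
  qed (use SJ j in \<open>auto simp: PiE_mem\<close>)
  moreover have "x = y" if "x \<in> S" "y \<in> S" "\<And>j. j \<in> J \<Longrightarrow> x j = y j" for x y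
    using that SJ by (meson PiE_ext subsetD)
  ultimately have "x = y" if "x \<in> S" "y \<in> S" "\<forall>p \<in> homs \<Sigma> ?S L. p x = p y" for x y
    using that by (metis restrict_apply')
  then show ?thesis unfolding separated_def using alg by simp
qed

lemma HSP_quotient:
  assumes "HSP \<Sigma> L (A :: ('f, 'a) algebra)"
  obtains S :: "('f, ('a \<Rightarrow> 'l) \<Rightarrow> 'l) algebra" and q
  where "separated S" "q \<in> homs \<Sigma> S A" "q ` carrier S = carrier A"
proof -
  obtain J :: "('a \<Rightarrow> 'l) set" and S q where S: "subuniverse \<Sigma> (power_algebra L J) S"
    "q \<in> homs \<Sigma> (power_algebra L J\<lparr>carrier := S\<rparr>) A" "q ` S = carrier A"
    using assms unfolding HSP_def by blast
  show thesis
    using that[OF separated_subpower[OF S(1)] S(2)] S(3) by simp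
qed

text \<open>Evaluation embeds \<open>A\<close> in the power of \<open>L\<close> indexed by its
  homomorphisms to \<open>L\<close>, and these have exactly the index type that \<open>HSP\<close>
  prescribes. The inverse of the embedding serves as the quotient map.\<close>

lemma separated_HSP:
  assumes "separated (A :: ('f, 'a) algebra)"
  shows "HSP \<Sigma> L A"
proof -
  let ?J = "homs \<Sigma> A L" let ?P = "power_algebra L ?J"
  define \<epsilon> where "\<epsilon> x = (\<lambda>p\<in>?J. p x)" for x
  let ?S = "\<epsilon> ` carrier A"
  have alg: "is_algebra \<Sigma> A" using separated_alg[OF assms] .
  have inj: "inj_on \<epsilon> (carrier A)"
  proof (rule inj_onI)
    fix x y assume xy: "x \<in> carrier A" "y \<in> carrier A" "\<epsilon> x = \<epsilon> y"
    have "p x = p y" if "p \<in> ?J" for p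
    proof -
      have "\<epsilon> x p = \<epsilon> y p" using xy(3) by simp
      then show ?thesis using that unfolding \<epsilon>_def by simp
    qed
    then show "x = y" by (rule separated_eqI[OF assms xy(1,2)])
  qed
  have op: "oper ?P f (map \<epsilon> as) = \<epsilon> (oper A f as)" if as: "as \<in> tuples (arity \<Sigma> f) (carrier A)" for f as
  proof
    fix p
    show "oper ?P f (map \<epsilon> as) p = \<epsilon> (oper A f as) p"
    proof (cases "p \<in> ?J")
      case True
      then have "map (\<lambda>a. a p) (map \<epsilon> as) = map p as" by (auto simp: \<epsilon>_def)
      then show ?thesis using True homs_oper[OF True as] by (simp add: power_algebra_def \<epsilon>_def o_def)
    qed (simp add: power_algebra_def \<epsilon>_def)
  qed
  have lift: "\<exists>as \<in> tuples n (carrier A). bs = map \<epsilon> as" if "bs \<in> tuples n ?S" for bs n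
  proof -
    have "map \<epsilon> (map (inv_into (carrier A) \<epsilon>) bs) = bs"
      unfolding map_map by (rule map_idI) (use that in \<open>auto simp: tuples_def f_inv_into_f\<close>)
    moreover have "map (inv_into (carrier A) \<epsilon>) bs \<in> tuples n (carrier A)"
      using that by (auto simp: tuples_def inv_into_into)
    ultimately show ?thesis by metis
  qed
  have sub: "subuniverse \<Sigma> ?P ?S"
    unfolding subuniverse_def
  proof (intro conjI allI ballI)
    show "?S \<subseteq> carrier ?P" by (auto simp: \<epsilon>_def power_algebra_def homs_closed)
    fix f bs assume "bs \<in> tuples (arity \<Sigma> f) ?S"
    then show "oper ?P f bs \<in> ?S" using lift op oper_closed[OF alg] by (metis imageI)
  qed
  let ?q = "\<lambda>s\<in>?S. inv_into (carrier A) \<epsilon> s"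
  have "?q \<in> homs \<Sigma> (?P\<lparr>carrier := ?S\<rparr>) A"
  proof (rule homsI)
    fix f bs assume "bs \<in> tuples (arity \<Sigma> f) (carrier (?P\<lparr>carrier := ?S\<rparr>))"
    then obtain as where as: "as \<in> tuples (arity \<Sigma> f) (carrier A)" "bs = map \<epsilon> as" using lift by auto
    have "map ?q bs = as"
      unfolding as(2) map_map
    proof (rule map_idI)
      fix x assume "x \<in> set as"
      then have "x \<in> carrier A" using as(1) unfolding tuples_def by auto
      then show "(?q \<circ> \<epsilon>) x = x" using inj by simp
    qed
    then show "?q (oper (?P\<lparr>carrier := ?S\<rparr>) f bs) = oper A f (map ?q bs)"
      using op[OF as(1)] oper_closed[OF alg as(1)] inj as(2) by simp
  qed (auto simp: inv_into_into)
  moreover have "?q ` ?S = carrier A" using inj by (force simp: image_iff)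
  ultimately show ?thesis unfolding HSP_def using alg sub by blast
qed

lemma separated_bounded_lattice:
  assumes "separated A"
  shows "bounded_lattice_algebra \<Sigma> A"
proof -
  note alg = separated_alg[OF assms]
  note h = homs_lattice_ops[OF sig] and c = lattice_ops_closed[OF sig alg]
  note i = separated_eqI[OF assms]
  show ?thesis
    unfolding bounded_lattice_algebra_def is_bounded_lattice_def is_lattice_def
    by (auto simp: c h homs_closed L.assoc L.absorb intro!: i) (auto simp: c h homs_closed L.comm)
qed

lemma HSP_bounded_lattice: "HSP \<Sigma> L A \<Longrightarrow> bounded_lattice_algebra \<Sigma> A"
  using HSP_quotient bounded_lattice_quotient[OF sig] separated_alg separated_bounded_lattice by metis

lemma homs_01: "p \<in> homs \<Sigma> A L \<Longrightarrow> is_algebra \<Sigma> A \<Longrightarrow> x \<in> carrier A \<Longrightarrow> T o1 A x = x \<Longrightarrow> p x = o1 \<or> p x = z0"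
  using homs_T[of A p L x o1] homs_closed[of p \<Sigma> A L x] by (metis T_L)

end

section \<open>Identities of \<open>L\<close> transferred to an algebra of the variety\<close>

locale HSP_algebra = semiprimal \<Sigma> L for \<Sigma> :: "'f signature" and L :: "('f, 'l) algebra" +
  fixes A :: "('f, 'a) algebra"
  assumes HSP: "HSP \<Sigma> L A"

sublocale HSP_algebra \<subseteq> bounded_lattice_alg \<Sigma> A
  using HSP_bounded_lattice[OF HSP] by (simp add: bounded_lattice_alg_def)

context HSP_algebra
begin

lemmas alg = HSP_alg[OF HSP]
lemmas TA_closed [simp] = T_closed[OF alg]

text \<open>Each identity is checked on a subalgebra of a power of \<open>L\<close> that maps onto \<open>A\<close>, and there
  after applying the homomorphisms to \<open>L\<close>.\<close>

lemma identities:
  assumes x: "x \<in> carrier A" and y: "y \<in> carrier A"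
  shows T_T: "T o1 A (T l A x) = T l A x"
    and T_disjoint: "k \<noteq> l \<Longrightarrow> m (T k A x) (T l A x) = z"
    and T_cover: "set ls = carrier L \<Longrightarrow> join_T A (T o1 A y) x ls = T o1 A y"
    and T_le_eq_op: "m (m (T l A x) (T l A y)) (eq_op A x y) = m (T l A x) (T l A y)"
    and meet_eq_op: "m x (eq_op A x y) = m y (eq_op A x y)"
    and T_eq_op: "T o1 A (eq_op A x y) = eq_op A x y"
    and compl_meet: "m (T o1 A x) (T z0 A (T o1 A x)) = z"
    and compl_compl: "T z0 A (T z0 A (T o1 A x)) = T o1 A x"
    and skel_split: "j (m (T o1 A x) (T o1 A y)) (m (T o1 A x) (T z0 A (T o1 A y))) = T o1 A x"
    and skel_meet: "T o1 A (m (T o1 A x) (T o1 A y)) = m (T o1 A x) (T o1 A y)"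
    and compl_zero: "T z0 A z = e"
proof -
  obtain S :: "('f, ('a \<Rightarrow> 'l) \<Rightarrow> 'l) algebra" and q where
    S: "separated S" and q: "q \<in> homs \<Sigma> S A" "q ` carrier S = carrier A"
    using HSP_quotient[OF HSP] .
  obtain s t where st: "s \<in> carrier S" "x = q s" "t \<in> carrier S" "y = q t"
    using x y q(2) by blast
  note aS = separated_alg[OF S]
  note h = homs_lattice_ops[OF sig] homs_T[OF aS] homs_eq_op[OF aS] homs_join_T[OF aS]
  note c = lattice_ops_closed[OF sig aS] T_closed[OF aS] eq_op_closed[OF aS] join_T_closed[OF aS]
  \<comment> \<open>Reading these equations backwards pulls \<open>q\<close> out of both sides of an
    identity. What remains is an equation in \<open>S\<close>, which \<open>S_eqI\<close> sends to
    \<open>L\<close>.\<close>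
  note r = h[OF q(1), symmetric]
  have S_eqI: "a = b" if "a \<in> carrier S" "b \<in> carrier S" "\<And>p. p \<in> homs \<Sigma> S L \<Longrightarrow> p a = p b" for a b
    by (rule separated_eqI[OF S]) (use that in auto)
  note zo = zero_one zero_one[symmetric]
  show "T o1 A (T l A x) = T l A x"
    unfolding st using st(1,3) by (simp add: r c, intro arg_cong[where f = q] S_eqI) (auto simp: c h homs_closed zo)
  show "m (T k A x) (T l A x) = z" if "k \<noteq> l"
    unfolding st using st(1,3) that by (simp add: r c, intro arg_cong[where f = q] S_eqI) (auto simp: c h homs_closed zo)
  show "join_T A (T o1 A y) x ls = T o1 A y" if "set ls = carrier L"
    unfolding st using st(1,3) that by (simp add: r c, intro arg_cong[where f = q] S_eqI) (auto simp: c h homs_closed zo join_T_L)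
  show "m (m (T l A x) (T l A y)) (eq_op A x y) = m (T l A x) (T l A y)"
    unfolding st using st(1,3) by (simp add: r c, intro arg_cong[where f = q] S_eqI) (auto simp: c h homs_closed zo)
  show "m x (eq_op A x y) = m y (eq_op A x y)"
    unfolding st using st(1,3) by (simp add: r c, intro arg_cong[where f = q] S_eqI) (auto simp: c h homs_closed zo)
  show "T o1 A (eq_op A x y) = eq_op A x y"
    unfolding st using st(1,3) by (simp add: r c, intro arg_cong[where f = q] S_eqI) (auto simp: c h homs_closed zo)
  show "m (T o1 A x) (T z0 A (T o1 A x)) = z"
    unfolding st using st(1,3) by (simp add: r c, intro arg_cong[where f = q] S_eqI) (auto simp: c h homs_closed zo)
  show "T z0 A (T z0 A (T o1 A x)) = T o1 A x"
    unfolding st using st(1,3) by (simp add: r c, intro arg_cong[where f = q] S_eqI) (auto simp: c h homs_closed zo)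
  show "j (m (T o1 A x) (T o1 A y)) (m (T o1 A x) (T z0 A (T o1 A y))) = T o1 A x"
    unfolding st using st(1,3) by (simp add: r c, intro arg_cong[where f = q] S_eqI) (auto simp: c h homs_closed zo)
  show "T o1 A (m (T o1 A x) (T o1 A y)) = m (T o1 A x) (T o1 A y)"
    unfolding st using st(1,3) by (simp add: r c, intro arg_cong[where f = q] S_eqI) (auto simp: c h homs_closed zo)
  show "T z0 A z = e"
    unfolding st using st(1,3) by (simp add: r c, intro arg_cong[where f = q] S_eqI) (auto simp: c h homs_closed zo)
qed

text \<open>If the arguments equal \<open>ls\<close>, then the value of the operation is
  \<open>oper L f ls\<close>. In \<open>L\<close> the left factor is 1 exactly in that case and 0
  otherwise, so the inequality holds there; it then passes to \<open>S\<close> and to the quotient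
  \<open>A\<close>. This is what makes the map attached to an atom a homomorphism.\<close>

lemma meet_T_oper:
  assumes ls: "ls \<in> tuples (arity \<Sigma> f) (carrier L)" and xs: "xs \<in> tuples (arity \<Sigma> f) (carrier A)"
  shows "m (meet_T A (zip ls xs)) (T (oper L f ls) A (oper A f xs)) = meet_T A (zip ls xs)"
proof -
  obtain S :: "('f, ('a \<Rightarrow> 'l) \<Rightarrow> 'l) algebra" and q where
    S: "separated S" and q: "q \<in> homs \<Sigma> S A" "q ` carrier S = carrier A"
    using HSP_quotient[OF HSP] .
  note aS = separated_alg[OF S]
  define ss where "ss = map (inv_into (carrier S) q) xs"
  have ss: "ss \<in> tuples (arity \<Sigma> f) (carrier S)"
    unfolding ss_def using xs q(2) by (auto simp: tuples_def inv_into_into)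
  have xs_eq: "xs = map q ss"
    unfolding ss_def map_map by (rule map_idI[symmetric]) (use xs q(2) in \<open>auto simp: tuples_def f_inv_into_f\<close>)
  have z: "snd ` set (zip ls ss) \<subseteq> carrier S"
    using ss by (auto simp: tuples_def dest: set_zip_rightD)
  have zm: "map (map_prod id p) (zip ls ss) = zip ls (map p ss)" for p :: "_ \<Rightarrow> 'l"
    by (simp add: zip_map2 map_prod_def id_def)
  have zq: "map (map_prod id q) (zip ls ss) = zip ls (map q ss)"
    by (simp add: zip_map2 map_prod_def id_def)
  have mc: "meet_T S (zip ls ss) \<in> carrier S" "oper S f ss \<in> carrier S"
    using meet_T_closed[OF aS z] oper_closed[OF aS ss] by auto
  have "alg_meet \<Sigma> S (meet_T S (zip ls ss)) (T (oper L f ls) S (oper S f ss)) = meet_T S (zip ls ss)"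
  proof (rule separated_eqI[OF S])
    fix p assume p: "p \<in> homs \<Sigma> S L"
    have ps: "map p ss \<in> tuples (arity \<Sigma> f) (carrier L)"
      using tuples_map[OF ss] homs_closed[OF p] by blast
    have snd: "snd ` set (zip ls (map p ss)) \<subseteq> carrier L"
      using ps by (force simp: tuples_def dest: set_zip_rightD)
    have pm: "p (meet_T S (zip ls ss)) = (if map p ss = ls then o1 else z0)"
    proof -
      have "(\<forall>(l, x) \<in> set (zip ls (map p ss)). l = x) \<longleftrightarrow> map p ss = ls"
        using list_all2_iff[of "(=)" ls "map p ss"] ls ss
        unfolding tuples_def list.rel_eq by (auto simp del: map_eq_conv)
      then show ?thesis unfolding homs_meet_T[OF aS p z] zm meet_T_L[OF snd] by simp
    qed
    have pT: "p (T (oper L f ls) S (oper S f ss)) = (if oper L f (map p ss) = oper L f ls then o1 else z0)"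
      using homs_T[OF aS p mc(2)] homs_oper[OF p ss] oper_closed[OF alg_L ps] by simp
    show "p (alg_meet \<Sigma> S (meet_T S (zip ls ss)) (T (oper L f ls) S (oper S f ss))) = p (meet_T S (zip ls ss))"
      using homs_lattice_ops(1)[OF sig p mc(1) T_closed[OF aS mc(2)]] pm pT by auto
  qed (use mc lattice_ops_closed[OF sig aS] T_closed[OF aS] in auto)
  then have "q (alg_meet \<Sigma> S (meet_T S (zip ls ss)) (T (oper L f ls) S (oper S f ss))) = q (meet_T S (zip ls ss))"
    by simp
  then show ?thesis
    using homs_lattice_ops(1)[OF sig q(1) mc(1) T_closed[OF aS mc(2)]] homs_T[OF aS q(1) mc(2)]
      homs_oper[OF q(1) ss] homs_meet_T[OF aS q(1) z] zq xs_eq by simp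
qed

end

section \<open>Complete algebras with atomic skeleton are products\<close>

context HSP_algebra
begin

abbreviation "skel \<equiv> carrier (skeleton \<Sigma> L A)"

lemma skel_iff: "x \<in> skel \<longleftrightarrow> x \<in> carrier A \<and> T o1 A x = x"
  unfolding skeleton_def by simp

lemma skel_T [simp]: "x \<in> carrier A \<Longrightarrow> T l A x \<in> skel"
  by (simp add: skel_iff T_T)

lemma skel_meet_closed: "x \<in> skel \<Longrightarrow> y \<in> skel \<Longrightarrow> m x y \<in> skel"
  using skel_meet[of x y] by (simp add: skel_iff)

text \<open>In \<open>identities\<close> a Boolean element appears as \<open>T o1 A x\<close> with
  \<open>x\<close> arbitrary, so that those are equations with unrestricted variables. On the
  skeleton \<open>T o1 A x\<close> is \<open>x\<close> itself, which gives the forms used from here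
  on.\<close>

lemma skel_compl: "x \<in> skel \<Longrightarrow> m x (T z0 A x) = z" "x \<in> skel \<Longrightarrow> T z0 A (T z0 A x) = x"
  "x \<in> skel \<Longrightarrow> y \<in> skel \<Longrightarrow> j (m x y) (m x (T z0 A y)) = x"
  using compl_meet[of x x] compl_compl[of x x] skel_split[of x y] by (simp_all add: skel_iff)

lemma skel_eqI: "x \<in> skel \<Longrightarrow> T z0 A x = z \<Longrightarrow> x = e"
  using skel_compl(2) compl_zero closed(3) by metis

lemma atoms_iff: "a \<in> atoms (skeleton \<Sigma> L A) \<longleftrightarrow> a \<in> skel \<and> a \<noteq> z \<and> (\<forall>b \<in> skel. m b a = b \<longrightarrow> b = z \<or> b = a)"
  unfolding atoms_def by (simp add: skeleton_def)

abbreviation "atms \<equiv> atoms (skeleton \<Sigma> L A)"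

lemma atom_carrier: "a \<in> atms \<Longrightarrow> a \<in> carrier A"
  by (simp add: atoms_iff skel_iff)

lemma atom_cases:
  assumes "a \<in> atms" "b \<in> skel"
  shows "m a b = a \<or> m a b = z"
proof -
  have ab: "a \<in> skel" "a \<in> carrier A" "b \<in> carrier A" using assms by (auto simp: atoms_iff skel_iff)
  have "m (m a b) a = m a b" using meet_lower(1) ab by blast
  moreover have "m a b \<in> skel" using skel_meet_closed ab assms by blast
  ultimately show ?thesis using assms(1) unfolding atoms_iff by blast
qed

lemma join_T_zero:
  assumes "a \<in> carrier A" "x \<in> carrier A" "\<And>l. l \<in> set ls \<Longrightarrow> m a (T l A x) = z"
  shows "join_T A a x ls = z"
  using assms(3) unfolding join_T_def by (induction ls) simp_all

text \<open>Otherwise the atom is disjoint from every \<open>T l A x\<close>, hence from their join.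
  But these elements cover the atom, so it would be 0.\<close>

lemma atom_T_ex:
  assumes "a \<in> atms" "x \<in> carrier A"
  shows "\<exists>l \<in> carrier L. m a (T l A x) = a"
proof (rule ccontr)
  assume n: "\<not> ?thesis"
  obtain ls where ls: "set ls = carrier L" using finite_list[OF fin_L] by blast
  have "m a (T l A x) = z" if "l \<in> set ls" for l
    using atom_cases[OF assms(1) skel_T[OF assms(2), of l]] n that ls by auto
  then have "join_T A a x ls = z" using join_T_zero atom_carrier assms by blast
  moreover have "join_T A a x ls = a"
    using T_cover[OF assms(2) atom_carrier[OF assms(1)] ls] assms(1) by (simp add: atoms_iff skel_iff)
  ultimately show False using assms(1) by (simp add: atoms_iff)
qed

lemma atom_T_unique:
  assumes "a \<in> atms" "x \<in> carrier A" "m a (T k A x) = a" "m a (T l A x) = a"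
  shows "k = l"
proof (rule ccontr)
  assume "k \<noteq> l"
  then have "m (T k A x) (T l A x) = z" using T_disjoint[OF assms(2,2)] by blast
  moreover have "m a (m (T k A x) (T l A x)) = a"
    using meet_greatest[OF _ _ atom_carrier[OF assms(1)]] assms by simp
  ultimately show False using assms(1) atom_carrier[OF assms(1)] by (simp add: atoms_iff)
qed

definition atom_hom :: "'a \<Rightarrow> 'a \<Rightarrow> 'l" where
  "atom_hom a = (\<lambda>x\<in>carrier A. THE l. l \<in> carrier L \<and> m a (T l A x) = a)"

lemma atom_hom_eqI:
  assumes "a \<in> atms" "x \<in> carrier A" "l \<in> carrier L" "m a (T l A x) = a"
  shows "atom_hom a x = l"
  unfolding atom_hom_def using assms atom_T_unique by (auto intro!: the_equality)

lemma atom_hom: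
  assumes "a \<in> atms" "x \<in> carrier A"
  shows "atom_hom a x \<in> carrier L" "m a (T (atom_hom a x) A x) = a"
  using atom_T_ex[OF assms] atom_hom_eqI[OF assms] by auto

lemma atom_le_meet_T:
  assumes "a \<in> carrier A" "\<And>l x. (l, x) \<in> set ps \<Longrightarrow> x \<in> carrier A \<and> m a (T l A x) = a"
  shows "m a (meet_T A ps) = a"
  using assms(2)
proof (induction ps)
  case Nil
  then show ?case using assms(1) by (simp add: meet_T_def)
next
  case (Cons p ps)
  obtain l x where p: "p = (l, x)" by fastforce
  have 1: "x \<in> carrier A" "m a (T l A x) = a" using Cons.prems p by auto
  have "snd ` set ps \<subseteq> carrier A" using Cons.prems by force
  then have 2: "meet_T A ps \<in> carrier A" using meet_T_closed[OF alg] by blast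
  have 3: "m a (meet_T A ps) = a" by (rule Cons.IH) (use Cons.prems in auto)
  have "m a (m (T l A x) (meet_T A ps)) = a"
    by (rule meet_greatest) (use 1 2 3 assms(1) in auto)
  then show ?case by (simp add: p meet_T_def)
qed

lemma atom_hom_homs:
  assumes a: "a \<in> atms"
  shows "atom_hom a \<in> homs \<Sigma> A L"
proof (rule homsI)
  fix f xs assume xs: "xs \<in> tuples (arity \<Sigma> f) (carrier A)"
  let ?ls = "map (atom_hom a) xs"
  have ls: "?ls \<in> tuples (arity \<Sigma> f) (carrier L)"
    using tuples_map[OF xs] atom_hom(1)[OF a] by blast
  have z: "snd ` set (zip ?ls xs) \<subseteq> carrier A"
    using xs by (auto simp: tuples_def dest!: set_zip_rightD)
  have xc: "oper A f xs \<in> carrier A" using oper_closed[OF alg xs] .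
  have "m a (meet_T A (zip ?ls xs)) = a"
  proof (rule atom_le_meet_T[OF atom_carrier[OF a]])
    fix l x assume "(l, x) \<in> set (zip ?ls xs)"
    then have "l = atom_hom a x" "x \<in> set xs" by (auto simp: zip_map1 zip_same_conv_map)
    then show "x \<in> carrier A \<and> m a (T l A x) = a" using xs atom_hom(2)[OF a] by (auto simp: tuples_def)
  qed
  \<comment> \<open>The atom lies below the truth value of \<open>xs = ?ls\<close>, and that lies
    below the truth value of the corresponding result.\<close>
  then have "m a (T (oper L f ?ls) A (oper A f xs)) = a"
    by (rule le_trans[rotated 3]) (use meet_T_oper[OF ls xs] meet_T_closed[OF alg z] xc atom_carrier[OF a] in auto)
  then show "atom_hom a (oper A f xs) = oper L f ?ls"
    using atom_hom_eqI[OF a xc] oper_closed[OF alg_L ls] by blast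
qed (use atom_hom[OF a] in \<open>auto simp: atom_hom_def\<close>)

lemma atom_hom_self: "a \<in> atms \<Longrightarrow> atom_hom a a = o1"
  using atom_hom_eqI[of a a o1] by (simp add: atoms_iff skel_iff)

end

context semiprimal
begin

text \<open>An internal form of the statement that \<open>A\<close> is the product of the images of
  the maps \<open>\<pi> i\<close>. The index set is left free: atoms, homomorphisms, germs and
  finite sets of points all serve in turn.\<close>

definition product_rep :: "('f, 'a) algebra \<Rightarrow> 'i set \<Rightarrow> ('i \<Rightarrow> 'a \<Rightarrow> 'l) \<Rightarrow> bool" where
  "product_rep A I \<pi> \<longleftrightarrow> is_algebra \<Sigma> A \<and> (\<forall>i\<in>I. \<pi> i \<in> homs \<Sigma> A L) \<and>
     (\<forall>x\<in>carrier A. \<forall>y\<in>carrier A. (\<forall>i\<in>I. \<pi> i x = \<pi> i y) \<longrightarrow> x = y) \<and>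
     (\<forall>s. (\<forall>i\<in>I. s i \<in> \<pi> i ` carrier A) \<longrightarrow> (\<exists>x\<in>carrier A. \<forall>i\<in>I. \<pi> i x = s i))"

end

context HSP_algebra
begin

lemma atomic_product_rep:
  assumes complete: "complete_lattice (lattice_reduct \<Sigma> A)"
    and atomic: "\<And>b. b \<in> skel \<Longrightarrow> b \<noteq> z \<Longrightarrow> \<exists>a\<in>atms. m a b = a"
  shows "product_rep A atms atom_hom"
  unfolding product_rep_def
proof (intro conjI ballI allI impI alg atom_hom_homs)
  fix x y assume xy: "x \<in> carrier A" "y \<in> carrier A" "\<forall>a\<in>atms. atom_hom a x = atom_hom a y"
  let ?E = "eq_op A x y"
  have E: "?E \<in> carrier A" "?E \<in> skel" using eq_op_closed[OF alg] T_eq_op xy by (auto simp: skel_iff)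
  \<comment> \<open>A nonzero complement of the truth value \<open>?E\<close> would contain an atom.
    At that atom \<open>x\<close> and \<open>y\<close> have the same value, so the atom also lies
    below \<open>?E\<close>, which is absurd. Once \<open>?E\<close> is 1, \<open>meet_eq_op\<close>
    reads \<open>x = y\<close>.\<close>
  have "T z0 A ?E = z"
  proof (rule ccontr)
    assume "T z0 A ?E \<noteq> z"
    then obtain a where a: "a \<in> atms" "m a (T z0 A ?E) = a" using atomic[OF skel_T[OF E(1)]] by blast
    note ac = atom_carrier[OF a(1)]
    let ?l = "atom_hom a x"
    have "m a (m (T ?l A x) (T ?l A y)) = a"
      by (rule meet_greatest) (use atom_hom(2)[OF a(1)] xy ac a(1) in \<open>auto, metis\<close>)
    then have "m a ?E = a"
      by (rule le_trans[rotated 3]) (use T_le_eq_op[OF xy(1,2)] ac xy E in auto)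
    then have "m a (m ?E (T z0 A ?E)) = a"
      by (intro meet_greatest) (use ac E a in auto)
    then show False using skel_compl(1)[OF E(2)] ac a(1) by (simp add: atoms_iff)
  qed
  then have "?E = e" using skel_eqI E by blast
  then show "x = y" using meet_eq_op[OF xy(1,2)] xy by simp
next
  fix s assume s: "\<forall>a\<in>atms. s a \<in> atom_hom a ` carrier A"
  then have "\<forall>a\<in>atms. \<exists>x. x \<in> carrier A \<and> atom_hom a x = s a" by (metis imageE)
  then obtain r where r: "\<And>a. a \<in> atms \<Longrightarrow> r a \<in> carrier A" "\<And>a. a \<in> atms \<Longrightarrow> atom_hom a (r a) = s a"
    by metis
  \<comment> \<open>Cutting \<open>r a\<close> down to the atom \<open>a\<close> keeps its value at
    \<open>a\<close> and makes the pieces disjoint. Their join is meant to have all the prescribed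
    values.\<close>
  let ?X = "(\<lambda>a. m a (r a)) ` atms"
  have X: "?X \<subseteq> carrier A" using r(1) atom_carrier by auto
  obtain x where x: "lub (carrier A) m ?X x" using complete_lattice_lub[OF complete X] by blast
  have xc: "x \<in> carrier A" using x unfolding lub_def by blast
  have "atom_hom a x = s a" if a: "a \<in> atms" for a
  proof -
    note ac = atom_carrier[OF a] and h = homs_lattice_ops[OF sig atom_hom_homs[OF a]]
    have sL: "s a \<in> carrier L" "atom_hom a x \<in> carrier L"
      using atom_hom(1)[OF a r(1)[OF a]] atom_hom(1)[OF a xc] r(2)[OF a] by auto
    have har: "atom_hom a (m a (r a)) = s a"
      using h(1)[OF ac r(1)[OF a]] atom_hom_self[OF a] r(2)[OF a] sL by simp
    have "m (m a (r a)) x = m a (r a)" using x a unfolding lub_def by blast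
    then have 1: "L.m (s a) (atom_hom a x) = s a"
      using h(1)[of "m a (r a)" x] har ac r(1)[OF a] xc by simp
    \<comment> \<open>The join is at least the piece at \<open>a\<close>; for the opposite
      inequality at \<open>a\<close> an upper bound of all pieces is needed. The element
      \<open>?y\<close> is the piece at \<open>a\<close> joined with the part of \<open>x\<close>
      outside \<open>a\<close>. Every other atom lies below the complement of \<open>a\<close>, so
      \<open>?y\<close> bounds the other pieces too, and its value at \<open>a\<close> is
      \<open>s a\<close>.\<close>
    let ?y = "j (m x (T z0 A a)) (m a (r a))"
    have yc: "?y \<in> carrier A" using xc ac r(1)[OF a] by simp
    have "m w ?y = w" if w: "w \<in> ?X" for w
    proof -
      obtain b where b: "b \<in> atms" "w = m b (r b)" using w by blast
      note bc = atom_carrier[OF b(1)]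
      have wc: "w \<in> carrier A" using X w by blast
      show ?thesis
      proof (cases "b = a")
        case True
        then show ?thesis using join_upper(2)[of "m x (T z0 A a)" "m a (r a)"] xc ac r(1)[OF a] b by simp
      next
        case False
        have ba: "m b a = z" using atom_cases[OF b(1), of a] a b(1) False by (auto simp: atoms_iff)
        have bs: "b \<in> skel" "a \<in> skel" using a b by (auto simp: atoms_iff)
        have "m b (T z0 A a) = b" using skel_compl(3)[OF bs] ba bc ac by simp
        then have "m w (T z0 A a) = w"
          using le_trans[of w b "T z0 A a"] meet_lower(1)[OF bc r(1)[OF b(1)]] b bc ac wc by simp
        moreover have "m w x = w" using x w unfolding lub_def by blast
        ultimately have "m w (m x (T z0 A a)) = w" using meet_greatest wc xc ac by simp
        then show ?thesis
          using le_trans[of w "m x (T z0 A a)" ?y] join_upper(1)[of "m x (T z0 A a)" "m a (r a)"]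
            wc xc ac r(1)[OF a] by simp
      qed
    qed
    then have "m x ?y = x" using x yc unfolding lub_def by blast
    then have "L.m (atom_hom a x) (atom_hom a ?y) = atom_hom a x" using h(1)[OF xc yc] by simp
    moreover have "atom_hom a ?y = s a"
      using har h(1,2) homs_T[OF alg atom_hom_homs[OF a] ac, of z0] atom_hom_self[OF a] xc ac r(1)[OF a] sL
        zero_one by simp
    ultimately show ?thesis using L.le_antisym[OF sL] 1 by simp
  qed
  then show "\<exists>x\<in>carrier A. \<forall>a\<in>atms. atom_hom a x = s a" using xc by blast
qed

text \<open>Only atomicity of the skeleton remains: a nonzero element that is not an atom has a
  nonzero proper part, with strictly fewer elements below it.\<close>

lemma finite_product_rep:
  assumes "finite (carrier A)"
  shows "product_rep A atms atom_hom"
proof (rule atomic_product_rep[OF finite_complete_lattice[OF assms]])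
  fix b assume b: "b \<in> skel" "b \<noteq> z"
  let ?below = "\<lambda>b. {c \<in> skel. m c b = c}"
  have fin: "finite (?below b)" for b
    using finite_subset[OF _ assms] by (auto simp: skel_iff)
  show "\<exists>a\<in>atms. m a b = a"
    using b
  proof (induction "card (?below b)" arbitrary: b rule: less_induct)
    case less
    show ?case
    proof (cases "b \<in> atms")
      case True
      then show ?thesis using less.prems by (auto simp: skel_iff intro!: bexI[of _ b])
    next
      case False
      then obtain c where c: "c \<in> skel" "m c b = c" "c \<noteq> z" "c \<noteq> b"
        using less.prems by (auto simp: atoms_iff)
      have cc: "b \<in> carrier A" "c \<in> carrier A" using c less.prems by (auto simp: skel_iff)
      have "?below c \<subseteq> ?below b"
        using le_trans[OF _ cc(2,1)] c(2) by (auto simp: skel_iff)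
      moreover have "b \<notin> ?below c" using le_antisym[OF cc(2,1)] c by auto
      moreover have "b \<in> ?below b" using less.prems cc by simp
      ultimately have "card (?below c) < card (?below b)"
        by (metis (no_types, lifting) fin psubsetI psubset_card_mono)
      from less.hyps[OF this c(1,3)] obtain a where a: "a \<in> atms" "m a c = a" by blast
      have "m a b = a" using le_trans[OF _ cc(2,1) a(2) c(2)] atom_carrier[OF a(1)] by blast
      with a(1) show ?thesis by blast
    qed
  qed
qed

end

section \<open>Products of subalgebras\<close>

locale product = semiprimal \<Sigma> L for \<Sigma> :: "'f signature" and L :: "('f, 'l) algebra" +
  fixes A :: "('f, 'a) algebra" and I :: "'i set" and \<pi> :: "'i \<Rightarrow> 'a \<Rightarrow> 'l"
  assumes rep: "product_rep A I \<pi>"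
begin

lemma alg_A: "is_algebra \<Sigma> A"
  and proj: "i \<in> I \<Longrightarrow> \<pi> i \<in> homs \<Sigma> A L"
  and eqI: "x \<in> carrier A \<Longrightarrow> y \<in> carrier A \<Longrightarrow> (\<And>i. i \<in> I \<Longrightarrow> \<pi> i x = \<pi> i y) \<Longrightarrow> x = y"
  and fill: "(\<And>i. i \<in> I \<Longrightarrow> s i \<in> \<pi> i ` carrier A) \<Longrightarrow> \<exists>x\<in>carrier A. \<forall>i\<in>I. \<pi> i x = s i"
  using rep unfolding product_rep_def by blast+

lemma separated: "separated A"
  unfolding separated_def using alg_A proj eqI by blast

end

sublocale product \<subseteq> HSP_algebra \<Sigma> L A
  by unfold_locales (rule separated_HSP[OF separated])

context product
begin

lemma proj_simps:
  assumes "i \<in> I"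
  shows "x \<in> carrier A \<Longrightarrow> \<pi> i x \<in> carrier L"
    "x \<in> carrier A \<Longrightarrow> y \<in> carrier A \<Longrightarrow> \<pi> i (m x y) = L.m (\<pi> i x) (\<pi> i y)"
    "x \<in> carrier A \<Longrightarrow> y \<in> carrier A \<Longrightarrow> \<pi> i (j x y) = L.j (\<pi> i x) (\<pi> i y)"
    "\<pi> i z = z0" "\<pi> i e = o1"
    "x \<in> carrier A \<Longrightarrow> \<pi> i (T l A x) = (if \<pi> i x = l then o1 else z0)"
  using homs_closed[OF proj[OF assms]] homs_lattice_ops[OF sig proj[OF assms]]
    homs_T[OF alg_A proj[OF assms]] by auto

lemma le_iff:
  assumes "x \<in> carrier A" "y \<in> carrier A"
  shows "m x y = x \<longleftrightarrow> (\<forall>i\<in>I. L.m (\<pi> i x) (\<pi> i y) = \<pi> i x)"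
proof
  show "m x y = x \<Longrightarrow> \<forall>i\<in>I. L.m (\<pi> i x) (\<pi> i y) = \<pi> i x" using proj_simps(2) assms by metis
  show "\<forall>i\<in>I. L.m (\<pi> i x) (\<pi> i y) = \<pi> i x \<Longrightarrow> m x y = x"
    using assms by (intro eqI) (auto simp: proj_simps)
qed

text \<open>Each coordinate takes its values in a finite bounded lattice \<open>W i\<close>, so
  joins exist there, and \<open>K\<close> contains an element with any values chosen from the sets
  \<open>W i\<close>. The lemma is used for the carrier with the images of the coordinates, and for
  the skeleton with \<open>{z0, o1}\<close>.\<close>

lemma lub_glb:
  assumes K: "K \<subseteq> carrier A" and W: "\<And>i. i \<in> I \<Longrightarrow> \<pi> i ` K \<subseteq> W i" "\<And>i. i \<in> I \<Longrightarrow> W i \<subseteq> carrier L"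
    "\<And>i. i \<in> I \<Longrightarrow> z0 \<in> W i \<and> o1 \<in> W i"
    "\<And>i x y. i \<in> I \<Longrightarrow> x \<in> W i \<Longrightarrow> y \<in> W i \<Longrightarrow> L.m x y \<in> W i \<and> L.j x y \<in> W i"
    and fill_K: "\<And>s. (\<And>i. i \<in> I \<Longrightarrow> s i \<in> W i) \<Longrightarrow> \<exists>x\<in>K. \<forall>i\<in>I. \<pi> i x = s i"
    and X: "X \<subseteq> K"
  shows "\<exists>x. lub K m X x \<and> (\<forall>i\<in>I. lub (carrier L) L.m (\<pi> i ` X) (\<pi> i x))"
    "\<exists>x. glb K m X x \<and> (\<forall>i\<in>I. glb (carrier L) L.m (\<pi> i ` X) (\<pi> i x))"
proof -
  have ex: "(\<exists>s\<in>W i. lub (carrier L) L.m (\<pi> i ` X) s) \<and> (\<exists>s\<in>W i. glb (carrier L) L.m (\<pi> i ` X) s)"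
    if i: "i \<in> I" for i
  proof (rule L.finite_lub_glb)
    show "\<pi> i ` X \<subseteq> W i" using W(1)[OF i] X by blast
    then show "finite (\<pi> i ` X)" using W(2)[OF i] fin_L finite_subset by metis
  qed (use W i in auto)
  obtain s t where s: "\<And>i. i \<in> I \<Longrightarrow> s i \<in> W i \<and> lub (carrier L) L.m (\<pi> i ` X) (s i)"
    and t: "\<And>i. i \<in> I \<Longrightarrow> t i \<in> W i \<and> glb (carrier L) L.m (\<pi> i ` X) (t i)"
    using ex by metis
  obtain x where x: "x \<in> K" "\<forall>i\<in>I. \<pi> i x = s i" using fill_K[of s] s by blast
  have "lub K m X x"
    unfolding lub_def
  proof (intro conjI ballI impI)
    have XA: "w \<in> carrier A" if "w \<in> K" for w using that K by blast
    fix w assume w: "w \<in> X"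
    show "m w x = w"
      using le_iff[of w x] XA x X w s unfolding lub_def by (metis image_eqI subsetD)
  next
    fix u assume u: "u \<in> K" "\<forall>w\<in>X. m w u = w"
    have "L.m (\<pi> i x) (\<pi> i u) = \<pi> i x" if i: "i \<in> I" for i
    proof -
      have "L.m (\<pi> i w) (\<pi> i u) = \<pi> i w" if "w \<in> X" for w
        using le_iff[of w u] that u X K i by blast
      moreover have "\<pi> i u \<in> carrier L" using proj_simps(1)[OF i] u(1) K by blast
      ultimately show ?thesis using s[OF i] x(2) i unfolding lub_def by auto
    qed
    then show "m x u = x" using le_iff[of x u] x(1) u(1) K by blast
  qed (fact x(1))
  then show "\<exists>x. lub K m X x \<and> (\<forall>i\<in>I. lub (carrier L) L.m (\<pi> i ` X) (\<pi> i x))"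
    using x(2) s by auto
  obtain y where y: "y \<in> K" "\<forall>i\<in>I. \<pi> i y = t i" using fill_K[of t] t by blast
  have "glb K m X y"
    unfolding glb_def
  proof (intro conjI ballI impI)
    have XA: "w \<in> carrier A" if "w \<in> K" for w using that K by blast
    fix w assume w: "w \<in> X"
    show "m y w = y"
      using le_iff[of y w] XA y X w t unfolding glb_def by (metis image_eqI subsetD)
  next
    fix u assume u: "u \<in> K" "\<forall>w\<in>X. m u w = u"
    have "L.m (\<pi> i u) (\<pi> i y) = \<pi> i u" if i: "i \<in> I" for i
    proof -
      have "L.m (\<pi> i u) (\<pi> i w) = \<pi> i u" if "w \<in> X" for w
        using le_iff[of u w] that u X K i by blast
      moreover have "\<pi> i u \<in> carrier L" using proj_simps(1)[OF i] u(1) K by blast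
      ultimately show ?thesis using t[OF i] y(2) i unfolding glb_def by auto
    qed
    then show "m u y = u" using le_iff[of u y] y(1) u(1) K by blast
  qed (fact y(1))
  then show "\<exists>x. glb K m X x \<and> (\<forall>i\<in>I. glb (carrier L) L.m (\<pi> i ` X) (\<pi> i x))"
    using y(2) t by auto
qed

lemma lub_glb_proj:
  assumes "X \<subseteq> carrier A"
  shows "\<exists>x. lub (carrier A) m X x \<and> (\<forall>i\<in>I. lub (carrier L) L.m (\<pi> i ` X) (\<pi> i x))"
    "\<exists>x. glb (carrier A) m X x \<and> (\<forall>i\<in>I. glb (carrier L) L.m (\<pi> i ` X) (\<pi> i x))"
proof -
  have 1: "z0 \<in> \<pi> i ` carrier A \<and> o1 \<in> \<pi> i ` carrier A" if "i \<in> I" for i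
    using proj_simps(4,5)[OF that] closed(3,4) by (metis imageI)
  have 2: "L.m x y \<in> \<pi> i ` carrier A \<and> L.j x y \<in> \<pi> i ` carrier A"
    if "i \<in> I" "x \<in> \<pi> i ` carrier A" "y \<in> \<pi> i ` carrier A" for i x y
    using that proj_simps(2,3)[OF that(1), symmetric] by auto
  show "\<exists>x. lub (carrier A) m X x \<and> (\<forall>i\<in>I. lub (carrier L) L.m (\<pi> i ` X) (\<pi> i x))"
    by (rule lub_glb(1)[where W = "\<lambda>i. \<pi> i ` carrier A"]) (use assms 1 2 fill proj_simps(1) in auto)
  show "\<exists>x. glb (carrier A) m X x \<and> (\<forall>i\<in>I. glb (carrier L) L.m (\<pi> i ` X) (\<pi> i x))"
    by (rule lub_glb(2)[where W = "\<lambda>i. \<pi> i ` carrier A"]) (use assms 1 2 fill proj_simps(1) in auto)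
qed

lemma complete_lattice_A: "complete_lattice (lattice_reduct \<Sigma> A)"
proof (rule complete_latticeI)
  fix X assume "X \<subseteq> carrier A"
  then show "\<exists>s. lub (carrier A) m X s" "\<exists>s. glb (carrier A) m X s" using lub_glb_proj by blast+
qed (fact idem(1), fact le_antisym, fact le_trans)

lemma proj_complete:
  assumes "i \<in> I"
  shows "\<pi> i \<in> complete_homs \<Sigma> A L"
  by (rule complete_homsI[OF HSP_bounded_lattice[OF HSP] bl_L proj[OF assms]])
    (use lub_glb_proj assms in blast)+

lemma skel_iff_proj: "x \<in> skel \<longleftrightarrow> x \<in> carrier A \<and> (\<forall>i\<in>I. \<pi> i x \<in> {z0, o1})"
proof -
  have "T o1 A x = x \<longleftrightarrow> (\<forall>i\<in>I. \<pi> i x \<in> {z0, o1})" if x: "x \<in> carrier A"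
  proof
    show "T o1 A x = x \<Longrightarrow> \<forall>i\<in>I. \<pi> i x \<in> {z0, o1}" using proj_simps(6)[OF _ x, of _ o1] by (metis insertCI)
    show "\<forall>i\<in>I. \<pi> i x \<in> {z0, o1} \<Longrightarrow> T o1 A x = x" using x zero_one by (intro eqI) (auto simp: proj_simps)
  qed
  then show ?thesis by (auto simp: skel_iff)
qed

lemma fill_01:
  assumes "\<And>i. i \<in> I \<Longrightarrow> s i \<in> {z0, o1}"
  shows "\<exists>x\<in>skel. \<forall>i\<in>I. \<pi> i x = s i"
proof -
  have "s i \<in> \<pi> i ` carrier A" if "i \<in> I" for i
    using assms[OF that] proj_simps(4,5)[OF that] closed(3,4) by (metis empty_iff imageI insertE)
  then obtain x where "x \<in> carrier A" "\<forall>i\<in>I. \<pi> i x = s i" using fill by blast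
  then show ?thesis using assms skel_iff_proj by metis
qed

text \<open>The indicator of the coordinate \<open>i\<close>. These elements turn out to be the
  atoms of the skeleton, which recovers the index set from the algebra.\<close>

definition point :: "'i \<Rightarrow> 'a" where
  "point i = (SOME x. x \<in> skel \<and> (\<forall>k\<in>I. \<pi> k x = (if k = i then o1 else z0)))"

lemma point: "point i \<in> skel" "k \<in> I \<Longrightarrow> \<pi> k (point i) = (if k = i then o1 else z0)"
proof -
  have "\<exists>x. x \<in> skel \<and> (\<forall>k\<in>I. \<pi> k x = (if k = i then o1 else z0))"
    using fill_01[of "\<lambda>k. if k = i then o1 else z0"] by (simp add: Bex_def)
  from someI_ex[OF this] show "point i \<in> skel" "k \<in> I \<Longrightarrow> \<pi> k (point i) = (if k = i then o1 else z0)"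
    unfolding point_def by auto
qed

lemma point_carrier: "point i \<in> carrier A"
  using point(1) by (simp add: skel_iff)

lemma point_le:
  assumes "i \<in> I" "x \<in> carrier A" "\<pi> i x = o1"
  shows "m (point i) x = point i"
  unfolding le_iff[OF point_carrier assms(2)] using assms by (auto simp: point proj_simps)

lemma skel_nonzero:
  assumes "x \<in> skel" "x \<noteq> z"
  obtains i where "i \<in> I" "\<pi> i x = o1"
proof -
  have "x \<in> carrier A" using assms(1) by (simp add: skel_iff)
  then obtain i where "i \<in> I" "\<pi> i x \<noteq> z0" using eqI[of x z] assms(2) proj_simps(4) closed(3) by metis
  then show thesis using that assms(1) skel_iff_proj by auto
qed

lemma atoms_subset: "atms \<subseteq> point ` I"
proof
  fix a assume a: "a \<in> atms"
  then have as: "a \<in> skel" "a \<noteq> z" by (auto simp: atoms_iff)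
  obtain i where i: "i \<in> I" "\<pi> i a = o1" using skel_nonzero[OF as] .
  then have "m (point i) a = point i" using point_le atom_carrier[OF a] by blast
  then have "point i = z \<or> point i = a" using a point(1) by (auto simp: atoms_iff)
  moreover have "\<pi> i (point i) \<noteq> \<pi> i z" using i(1) zero_one by (simp add: point proj_simps)
  ultimately show "a \<in> point ` I" using i(1) by auto
qed

lemma point_atom:
  assumes "i \<in> I"
  shows "point i \<in> atms"
  unfolding atoms_iff
proof (intro conjI ballI impI)
  show "point i \<noteq> z" using point(2)[OF assms, of i] proj_simps(4)[OF assms] zero_one by auto
  fix b assume b: "b \<in> skel" "m b (point i) = b"
  have bc: "b \<in> carrier A" using b(1) by (simp add: skel_iff)
  have *: "\<pi> k b = z0" if "k \<in> I" "k \<noteq> i" for k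
  proof -
    have "L.m (\<pi> k b) (\<pi> k (point i)) = \<pi> k b" using b(2) le_iff[OF bc point_carrier] that by blast
    then show ?thesis using that proj_simps(1)[OF that(1) bc] by (simp add: point)
  qed
  show "b = z \<or> b = point i"
  proof (cases "\<pi> i b = o1")
    case True
    then have "m (point i) b = point i" using point_le assms bc by blast
    then show ?thesis using le_antisym[OF bc point_carrier b(2)] by blast
  next
    case False
    then have "\<pi> i b = z0" using b(1) skel_iff_proj assms by auto
    then have "\<pi> k b = z0" if "k \<in> I" for k using * that by (cases "k = i") auto
    then have "b = z" using eqI[OF bc closed(3)] proj_simps(4) by metis
    then show ?thesis by blast
  qed
qed (rule point(1))

text \<open>By \<open>skel_iff_proj\<close> and \<open>fill_01\<close> the skeleton is the power of
  the two-element algebra over \<open>I\<close>. Laws are verified in the coordinates, bounds are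
  taken there, and a nonzero element lies above a point where it has value 1.\<close>

lemma CABA_skeleton: "CABA (skeleton \<Sigma> L A)"
  unfolding CABA_def
proof (intro conjI ballI impI)
  have ops: "bmeet (skeleton \<Sigma> L A) = m" "bjoin (skeleton \<Sigma> L A) = j" "bzero (skeleton \<Sigma> L A) = z"
    "bone (skeleton \<Sigma> L A) = e" "bcompl (skeleton \<Sigma> L A) = T_op \<Sigma> L z0 A"
    unfolding skeleton_def by simp_all
  have sc: "x \<in> carrier A" if "x \<in> skel" for x using that by (simp add: skel_iff)
  have s01: "\<pi> i x = z0 \<or> \<pi> i x = o1" if "x \<in> skel" "i \<in> I" for x i using that skel_iff_proj by auto
  have cl: "m x y \<in> skel" "j x y \<in> skel" if "x \<in> skel" "y \<in> skel" for x y
    unfolding skel_iff_proj using s01[OF that(1)] s01[OF that(2)] sc that by (auto simp: proj_simps) (metis L.bounds(1,4) L.bounds_join(1,4) L.closed(3,4))+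
  have ze: "z \<in> skel" "e \<in> skel" unfolding skel_iff_proj by (auto simp: proj_simps)
  show "is_bool_algebra (skeleton \<Sigma> L A)"
    unfolding is_bool_algebra_def is_bounded_lattice_def is_lattice_def ops
  proof (intro conjI ballI)
    fix x y w assume s: "x \<in> skel" "y \<in> skel" "w \<in> skel"
    show "m x (j y w) = j (m x y) (m x w)"
    proof (rule eqI)
      fix i assume i: "i \<in> I"
      show "\<pi> i (m x (j y w)) = \<pi> i (j (m x y) (m x w))"
        using s01[OF s(1) i] s01[OF s(2) i] s01[OF s(3) i] i sc s by (auto simp: proj_simps)
    qed (use sc s in auto)
  next
    fix x assume s: "x \<in> skel"
    show "j x (T z0 A x) = e"
    proof (rule eqI)
      fix i assume i: "i \<in> I"
      show "\<pi> i (j x (T z0 A x)) = \<pi> i e"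
        using s01[OF s i] zero_one i sc s by (auto simp: proj_simps)
    qed (use sc s in auto)
  qed (use cl ze sc skel_compl(1) comm assoc absorb in auto)
  show "complete_lattice (meet_order skel (bmeet (skeleton \<Sigma> L A)))"
    unfolding ops
  proof (rule complete_latticeI)
    fix X assume X: "X \<subseteq> skel"
    have "\<exists>x. lub skel m X x \<and> (\<forall>i\<in>I. lub (carrier L) L.m (\<pi> i ` X) (\<pi> i x))"
      by (rule lub_glb(1)[where W = "\<lambda>i. {z0, o1}"]) (use X sc fill_01 in \<open>auto simp: skel_iff_proj\<close>)
    then show "\<exists>s. lub skel m X s" by blast
    have "\<exists>x. glb skel m X x \<and> (\<forall>i\<in>I. glb (carrier L) L.m (\<pi> i ` X) (\<pi> i x))"
      by (rule lub_glb(2)[where W = "\<lambda>i. {z0, o1}"]) (use X sc fill_01 in \<open>auto simp: skel_iff_proj\<close>)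
    then show "\<exists>s. glb skel m X s" by blast
  next
    show "\<And>x y w. x \<in> skel \<Longrightarrow> y \<in> skel \<Longrightarrow> w \<in> skel \<Longrightarrow> m x y = x \<Longrightarrow> m y w = y \<Longrightarrow> m x w = x"
      using le_trans sc by blast
  next
    show "\<And>x y. x \<in> skel \<Longrightarrow> y \<in> skel \<Longrightarrow> m x y = x \<Longrightarrow> m y x = y \<Longrightarrow> x = y"
      using le_antisym sc by blast
  qed (use sc in auto)
  fix b assume b: "b \<in> skel" "b \<noteq> bzero (skeleton \<Sigma> L A)"
  then have "b \<noteq> z" using ops by simp
  then obtain i where i: "i \<in> I" "\<pi> i b = o1" using skel_nonzero b(1) by blast
  then have "m (point i) b = point i" using point_le sc[OF b(1)] by blast
  then show "\<exists>a\<in>atms. bmeet (skeleton \<Sigma> L A) a b = a" using point_atom[OF i(1)] ops by auto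
qed

text \<open>The converse of \<open>proj_complete\<close>: a complete homomorphism is concentrated at
  one point. Hence the index set of any product representation is the set of complete homomorphisms
  to \<open>L\<close>.\<close>

lemma complete_hom_is_proj:
  assumes p: "p \<in> complete_homs \<Sigma> A L"
  shows "\<exists>i\<in>I. p = \<pi> i"
proof -
  have ph: "p \<in> homs \<Sigma> A L" using p unfolding complete_homs_def by blast
  note h = homs_lattice_ops[OF sig ph]
  have PA: "point ` I \<subseteq> carrier A" using point_carrier by blast
  have "lub (carrier A) m (point ` I) e"
    unfolding lub_def
  proof (intro conjI ballI impI)
    fix u assume u: "u \<in> carrier A" "\<forall>x\<in>point ` I. m x u = x"
    have "\<pi> i e = \<pi> i u" if i: "i \<in> I" for i
    proof -
      have "L.m (\<pi> i (point i)) (\<pi> i u) = \<pi> i (point i)" using u i le_iff[OF point_carrier u(1)] by blast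
      then show ?thesis using i proj_simps(1)[OF i u(1)] by (simp add: point proj_simps)
    qed
    then have "e = u" using eqI u(1) closed(4) by blast
    then show "m e u = e" using u(1) by simp
  qed (use point_carrier in auto)
  then have "\<Squnion>\<^bsub>lattice_reduct \<Sigma> A\<^esub> (point ` I) = e" by (rule sup_eq[OF PA])
  moreover have "p (\<Squnion>\<^bsub>lattice_reduct \<Sigma> A\<^esub> (point ` I)) = \<Squnion>\<^bsub>lattice_reduct \<Sigma> L\<^esub> (p ` point ` I)"
    using p PA unfolding complete_homs_def by blast
  ultimately have sup: "\<Squnion>\<^bsub>lattice_reduct \<Sigma> L\<^esub> (p ` point ` I) = o1" using h(4) by simp
  \<comment> \<open>The points have join 1 and lie in the skeleton, so \<open>p\<close> sends each
    to 0 or 1. If all went to 0, completeness would force 1 to go to 0.\<close>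
  have "\<exists>i\<in>I. p (point i) = o1"
  proof (rule ccontr)
    assume "\<not> ?thesis"
    then have "p (point i) = z0" if "i \<in> I" for i
      using homs_01[OF ph alg_A point_carrier] point(1)[of i] that by (auto simp: skel_iff)
    then have "lub (carrier L) L.m (p ` point ` I) z0" unfolding lub_def by auto
    moreover have "p ` point ` I \<subseteq> carrier L" using PA homs_closed[OF ph] by blast
    ultimately show False using L.sup_eq sup zero_one by metis
  qed
  then obtain i where i: "i \<in> I" "p (point i) = o1" by blast
  have "p x = \<pi> i x" if x: "x \<in> carrier A" for x
  proof -
    \<comment> \<open>This element is the truth value of the statement that \<open>x\<close> equals
      its own coordinate \<open>\<pi> i x\<close>. It lies above the point, so \<open>p\<close>
      sends it to 1, and that says \<open>p x = \<pi> i x\<close>.\<close>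
    let ?t = "T (\<pi> i x) A x"
    have "m (point i) ?t = point i" using point_le[OF i(1)] x by (simp add: proj_simps i(1))
    then have "L.m (p (point i)) (p ?t) = p (point i)" using h(1)[OF point_carrier] x by (metis TA_closed)
    then have "p ?t = o1" using i(2) homs_closed[OF ph] x by (simp add: TA_closed)
    then have "T (\<pi> i x) L (p x) = o1" using homs_T[OF alg_A ph x] by simp
    then show ?thesis using homs_closed[OF ph x] zero_one by (simp split: if_splits)
  qed
  then show ?thesis using homs_ext[OF ph proj[OF i(1)]] i(1) by blast
qed

lemma complete_homs_eq: "complete_homs \<Sigma> A L = \<pi> ` I"
  using complete_hom_is_proj proj_complete by blast

lemma proj_inj: "inj_on \<pi> I"
proof (rule inj_onI)
  fix i k assume ik: "i \<in> I" "k \<in> I" "\<pi> i = \<pi> k"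
  have "\<pi> k (point i) = o1" using point(2)[OF ik(1), of i] ik(3) by simp
  then show "i = k" using point(2)[OF ik(2), of i] zero_one by (simp split: if_splits)
qed

lemma in_CA: "A \<in> Ob (CA \<Sigma> L)"
  unfolding CA_def using HSP complete_lattice_A CABA_skeleton by simp

text \<open>The universal property of the product of the images: the family \<open>g\<close> has to
  respect the image of each coordinate. Compatibility with the operations is verified
  coordinatewise.\<close>

lemma lift_hom:
  assumes B: "is_algebra \<Sigma> B" and g: "\<And>i. i \<in> I \<Longrightarrow> g i \<in> homs \<Sigma> B L"
    and im: "\<And>i. i \<in> I \<Longrightarrow> g i ` carrier B \<subseteq> \<pi> i ` carrier A"
  obtains h where "h \<in> homs \<Sigma> B A" "\<And>i b. i \<in> I \<Longrightarrow> b \<in> carrier B \<Longrightarrow> \<pi> i (h b) = g i b"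
proof -
  have "\<exists>x\<in>carrier A. \<forall>i\<in>I. \<pi> i x = g i b" if "b \<in> carrier B" for b
    using fill[of "\<lambda>i. g i b"] im that by blast
  then obtain h where h: "\<And>b. b \<in> carrier B \<Longrightarrow> h b \<in> carrier A"
    "\<And>b i. b \<in> carrier B \<Longrightarrow> i \<in> I \<Longrightarrow> \<pi> i (h b) = g i b" by metis
  show thesis
  proof (rule that)
    show "restrict h (carrier B) \<in> homs \<Sigma> B A"
    proof (rule homsI)
      fix f bs assume bs: "bs \<in> tuples (arity \<Sigma> f) (carrier B)"
      have mh: "map (restrict h (carrier B)) bs = map h bs" using bs by (auto simp: tuples_def)
      have hbs: "map h bs \<in> tuples (arity \<Sigma> f) (carrier A)" using tuples_map[OF bs] h(1) by blast
      have "h (oper B f bs) = oper A f (map h bs)"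
      proof (rule eqI)
        fix i assume i: "i \<in> I"
        have "map (\<pi> i) (map h bs) = map (g i) bs" using bs h(2) i by (auto simp: tuples_def)
        then show "\<pi> i (h (oper B f bs)) = \<pi> i (oper A f (map h bs))"
          using homs_oper[OF proj[OF i] hbs] homs_oper[OF g[OF i] bs] h(2)[OF oper_closed[OF B bs] i] by metis
      qed (use h(1) oper_closed[OF B bs] oper_closed[OF alg_A hbs] in auto)
      then show "restrict h (carrier B) (oper B f bs) = oper A f (map (restrict h (carrier B)) bs)"
        unfolding mh using oper_closed[OF B bs] by simp
    qed (use h in auto)
  qed (use h in auto)
qed

end

lemma (in semiprimal) CA_product_rep:
  assumes "A \<in> Ob (CA \<Sigma> L)"
  shows "product_rep A (atoms (skeleton \<Sigma> L A)) (HSP_algebra.atom_hom \<Sigma> L A)"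
proof -
  have H: "HSP \<Sigma> L A" "complete_lattice (lattice_reduct \<Sigma> A)" "CABA (skeleton \<Sigma> L A)"
    using assms unfolding CA_def by auto
  interpret HSP_algebra \<Sigma> L A by unfold_locales (rule H(1))
  show ?thesis
  proof (rule atomic_product_rep[OF H(2)])
    fix b assume "b \<in> skel" "b \<noteq> z"
    moreover have "bzero (skeleton \<Sigma> L A) = z" "bmeet (skeleton \<Sigma> L A) = m" by (simp_all add: skeleton_def)
    ultimately show "\<exists>a\<in>atms. m a b = a" using H(3) unfolding CABA_def by auto
  qed
qed

lemma (in semiprimal) finite_HSP_in_CA:
  assumes "HSP \<Sigma> L A" "finite (carrier A)"
  shows "A \<in> Ob (CA \<Sigma> L)"
proof -
  interpret HSP_algebra \<Sigma> L A by unfold_locales (rule assms(1))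
  interpret product \<Sigma> L A atms atom_hom by unfold_locales (rule finite_product_rep[OF assms(2)])
  show ?thesis by (rule in_CA)
qed

text \<open>Reindexing the atoms by their homomorphisms makes the index set depend on
  \<open>A\<close> in a functorial way, since complete homomorphisms compose.\<close>

lemma (in semiprimal) CA_product:
  assumes "A \<in> Ob (CA \<Sigma> L)"
  shows "product \<Sigma> L A (complete_homs \<Sigma> A L) (\<lambda>p. p)"
proof -
  interpret product \<Sigma> L A "atoms (skeleton \<Sigma> L A)" "HSP_algebra.atom_hom \<Sigma> L A"
    by unfold_locales (rule CA_product_rep[OF assms])
  have "product_rep A (complete_homs \<Sigma> A L) (\<lambda>p. p)"
    unfolding product_rep_def complete_homs_eq
  proof (intro conjI ballI allI impI)
    fix s assume "\<forall>p\<in>HSP_algebra.atom_hom \<Sigma> L A ` atoms (skeleton \<Sigma> L A). s p \<in> p ` carrier A"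
    then show "\<exists>x\<in>carrier A. \<forall>p\<in>HSP_algebra.atom_hom \<Sigma> L A ` atoms (skeleton \<Sigma> L A). p x = s p"
      using fill[of "\<lambda>i. s (HSP_algebra.atom_hom \<Sigma> L A i)"] by auto
  qed (use alg_A proj eqI in auto)
  then show ?thesis by unfold_locales
qed

section \<open>The categories of algebras\<close>

lemma (in category) category_full_subcat: "category (full_subcat C S)"
  unfolding full_subcat_def
  by unfold_locales (auto simp: Id_in Comp_in Comp_Id Id_Comp Comp_assoc)

lemma compose_eqI: "f \<in> extensional S \<Longrightarrow> (\<And>x. x \<in> S \<Longrightarrow> g (h x) = f x) \<Longrightarrow> compose S g h = f"
  unfolding compose_def by (rule extensionalityI[of _ S]) auto

lemma homs_extensional: "h \<in> homs \<Sigma> A B \<Longrightarrow> h \<in> extensional (carrier A)"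
  unfolding homs_def by (auto simp: PiE_def)

lemma complete_homsD: "h \<in> complete_homs \<Sigma> A B \<Longrightarrow> h \<in> homs \<Sigma> A B"
  unfolding complete_homs_def by blast

lemma concrete_category:
  assumes alg: "\<And>A. A \<in> Ob C \<Longrightarrow> is_algebra \<Sigma> A"
    and Hom: "\<And>A B. Hom C A B \<subseteq> homs \<Sigma> A B"
    and Id: "\<And>A. Id C A = (\<lambda>x\<in>carrier A. x)" "\<And>A. A \<in> Ob C \<Longrightarrow> Id C A \<in> Hom C A A"
    and Comp: "\<And>A B D g f. Comp C A B D g f = compose (carrier A) g f"
      "\<And>A B D g f. \<lbrakk>A \<in> Ob C; B \<in> Ob C; D \<in> Ob C; f \<in> Hom C A B; g \<in> Hom C B D\<rbrakk> \<Longrightarrow>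
        compose (carrier A) g f \<in> Hom C A D"
  shows "category C"
proof
  fix A B f assume "A \<in> Ob C" "B \<in> Ob C" "f \<in> Hom C A B"
  then have f: "f \<in> homs \<Sigma> A B" using subsetD[OF Hom] by blast
  show "Comp C A A B f (Id C A) = f"
    unfolding Id Comp by (rule compose_eqI) (use homs_extensional[OF f] in auto)
  show "Comp C A B B (Id C B) f = f"
    unfolding Id Comp by (rule compose_eqI) (use homs_extensional[OF f] homs_closed[OF f] in auto)
next
  fix W X Y Z f g h assume *: "f \<in> Hom C W X" "g \<in> Hom C X Y" "h \<in> Hom C Y Z"
  have "f x \<in> carrier X" if "x \<in> carrier W" for x
    using homs_closed[OF subsetD[OF Hom *(1)] that] .
  then show "Comp C W Y Z h (Comp C W X Y g f) = Comp C W X Z (Comp C X Y Z h g) f"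
    unfolding Comp by (auto simp: compose_def fun_eq_iff)
qed (use Id Comp in auto)

lemma category_Variety: "category (Variety \<Sigma> L)"
  by (rule concrete_category[where \<Sigma> = \<Sigma>])
    (auto simp: Variety_def HSP_def intro: homs_id homs_compose)

lemma Variety_fin_simps:
  "Ob (Variety_fin \<Sigma> L) = {A. HSP \<Sigma> L A \<and> finite (carrier A)}"
  "Hom (Variety_fin \<Sigma> L) = homs \<Sigma>"
  "Id (Variety_fin \<Sigma> L) A = (\<lambda>x\<in>carrier A. x)"
  "Comp (Variety_fin \<Sigma> L) A B D g f = compose (carrier A) g f"
  unfolding Variety_fin_def full_subcat_def Variety_def by auto

lemma category_Variety_fin: "category (Variety_fin \<Sigma> L)"
  unfolding Variety_fin_def by (rule category.category_full_subcat[OF category_Variety])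

context semiprimal
begin

lemma complete_homs_id:
  assumes "A \<in> Ob (CA \<Sigma> L)"
  shows "(\<lambda>x\<in>carrier A. x) \<in> complete_homs \<Sigma> A A"
proof (rule complete_homsI)
  interpret product \<Sigma> L A "complete_homs \<Sigma> A L" "\<lambda>p. p" by (rule CA_product[OF assms])
  show "bounded_lattice_algebra \<Sigma> A" by (rule HSP_bounded_lattice[OF HSP])
  then show "bounded_lattice_algebra \<Sigma> A" .
  show "(\<lambda>x\<in>carrier A. x) \<in> homs \<Sigma> A A" by (rule homs_id[OF alg_A])
  fix X assume X: "X \<subseteq> carrier A"
  then have im: "(\<lambda>x\<in>carrier A. x) ` X = X" by force
  show "\<exists>s. lub (carrier A) m X s \<and> lub (carrier A) m ((\<lambda>x\<in>carrier A. x) ` X) ((\<lambda>x\<in>carrier A. x) s)"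
    using lub_glb_proj(1)[OF X] unfolding im by (auto simp: lub_def)
  show "\<exists>s. glb (carrier A) m X s \<and> glb (carrier A) m ((\<lambda>x\<in>carrier A. x) ` X) ((\<lambda>x\<in>carrier A. x) s)"
    using lub_glb_proj(2)[OF X] unfolding im by (auto simp: glb_def)
qed

lemma complete_homs_compose:
  assumes "A \<in> Ob (CA \<Sigma> L)" "f \<in> complete_homs \<Sigma> A B" "g \<in> complete_homs \<Sigma> B D"
  shows "compose (carrier A) g f \<in> complete_homs \<Sigma> A D"
proof -
  have A: "HSP \<Sigma> L A" "complete_lattice (lattice_reduct \<Sigma> A)" using assms(1) unfolding CA_def by auto
  note f = complete_homsD[OF assms(2)] and g = complete_homsD[OF assms(3)]
  have "compose (carrier A) g f (\<Squnion>\<^bsub>lattice_reduct \<Sigma> A\<^esub> X) = \<Squnion>\<^bsub>lattice_reduct \<Sigma> D\<^esub> (compose (carrier A) g f ` X) \<and>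
      compose (carrier A) g f (\<Sqinter>\<^bsub>lattice_reduct \<Sigma> A\<^esub> X) = \<Sqinter>\<^bsub>lattice_reduct \<Sigma> D\<^esub> (compose (carrier A) g f ` X)"
    if X: "X \<subseteq> carrier A" for X
  proof -
    interpret A: complete_lattice "lattice_reduct \<Sigma> A" by (rule A(2))
    have X': "X \<subseteq> carrier (lattice_reduct \<Sigma> A)" using X by (simp add: meet_order_def)
    \<comment> \<open>Extremal elements must lie in \<open>carrier A\<close>, because
      \<open>compose\<close> is \<open>undefined\<close> elsewhere. This is where completeness of
      the lattice \<open>A\<close> is used.\<close>
    have c: "\<Squnion>\<^bsub>lattice_reduct \<Sigma> A\<^esub> X \<in> carrier A" "\<Sqinter>\<^bsub>lattice_reduct \<Sigma> A\<^esub> X \<in> carrier A"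
      using A.sup_closed[OF X'] A.inf_closed[OF X'] by (simp_all add: meet_order_def)
    have fX: "f ` X \<subseteq> carrier B" using X homs_closed[OF f] by blast
    have im: "compose (carrier A) g f ` X = g ` f ` X" using X by (force simp: compose_def image_iff)
    show ?thesis
      unfolding im using c fX X assms(2,3) unfolding complete_homs_def by (simp add: compose_def)
  qed
  then show ?thesis
    unfolding complete_homs_def using homs_compose[OF HSP_alg[OF A(1)] f g] by blast
qed

lemma category_CA: "category (CA \<Sigma> L)"
proof (rule concrete_category[where \<Sigma> = \<Sigma>])
  show "A \<in> Ob (CA \<Sigma> L) \<Longrightarrow> cat.Id (CA \<Sigma> L) A \<in> Hom (CA \<Sigma> L) A A" for A
    using complete_homs_id[of A] by (simp add: CA_def)
  show "\<lbrakk>A \<in> Ob (CA \<Sigma> L); B \<in> Ob (CA \<Sigma> L); D \<in> Ob (CA \<Sigma> L); f \<in> Hom (CA \<Sigma> L) A B; g \<in> Hom (CA \<Sigma> L) B D\<rbrakk> \<Longrightarrow>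
      compose (carrier A) g f \<in> Hom (CA \<Sigma> L) A D" for A B D f g
    using complete_homs_compose[of A f B g D] by (simp add: CA_def)
qed (auto simp: CA_def HSP_def complete_homs_def)

end

lemma CA_atoms_simps:
  "Ob (CA_atoms \<kappa> \<Sigma> L) = {A \<in> Ob (CA \<Sigma> L). |atoms (skeleton \<Sigma> L A)| <o \<kappa>}"
  "Hom (CA_atoms \<kappa> \<Sigma> L) = complete_homs \<Sigma>"
  "Id (CA_atoms \<kappa> \<Sigma> L) A = (\<lambda>x\<in>carrier A. x)"
  "Comp (CA_atoms \<kappa> \<Sigma> L) A B D g f = compose (carrier A) g f"
  unfolding CA_atoms_def full_subcat_def CA_def by auto

section \<open>Sets weighted by subsets of \<open>L\<close>\<close>

text \<open>Objects are sets with a subset of \<open>L\<close> attached to each point. The direction of morphisms is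
  reversed, so that the functors of points into this category are covariant.\<close>

definition weighted_sets :: "('p set \<times> ('p \<Rightarrow> 'l set), 'p \<Rightarrow> 'p) cat" where
  "weighted_sets = \<lparr>Ob = UNIV,
     Hom = (\<lambda>P Q. {f \<in> fst Q \<rightarrow>\<^sub>E fst P. \<forall>y \<in> fst Q. snd P (f y) \<subseteq> snd Q y}),
     Id = (\<lambda>P. \<lambda>x\<in>fst P. x), Comp = (\<lambda>P Q R g f. compose (fst R) f g)\<rparr>"

lemma weighted_sets_simps:
  "Ob weighted_sets = UNIV"
  "Hom weighted_sets P Q = {f \<in> fst Q \<rightarrow>\<^sub>E fst P. \<forall>y \<in> fst Q. snd P (f y) \<subseteq> snd Q y}"
  "Id weighted_sets P = (\<lambda>x\<in>fst P. x)"
  "Comp weighted_sets P Q R g f = compose (fst R) f g"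
  unfolding weighted_sets_def by simp_all

lemma category_weighted_sets: "category weighted_sets"
proof (unfold_locales, unfold weighted_sets_simps)
  fix P Q R :: "'a set \<times> ('a \<Rightarrow> 'b set)" and f g
  assume *: "f \<in> {f \<in> fst Q \<rightarrow>\<^sub>E fst P. \<forall>y\<in>fst Q. snd P (f y) \<subseteq> snd Q y}"
    "g \<in> {f \<in> fst R \<rightarrow>\<^sub>E fst Q. \<forall>y\<in>fst R. snd Q (f y) \<subseteq> snd R y}"
  then show "compose (fst R) f g \<in> {f \<in> fst R \<rightarrow>\<^sub>E fst P. \<forall>y\<in>fst R. snd P (f y) \<subseteq> snd R y}"
    by (fastforce simp: compose_def)
next
  fix P Q :: "'a set \<times> ('a \<Rightarrow> 'b set)" and f
  assume f: "f \<in> {f \<in> fst Q \<rightarrow>\<^sub>E fst P. \<forall>y\<in>fst Q. snd P (f y) \<subseteq> snd Q y}"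
  show "compose (fst Q) (\<lambda>x\<in>fst P. x) f = f"
    by (rule compose_eqI) (use f in \<open>auto simp: PiE_def\<close>)
  show "compose (fst Q) f (\<lambda>x\<in>fst Q. x) = f"
    by (rule compose_eqI) (use f in \<open>auto simp: PiE_def\<close>)
next
  fix W X Y Z :: "'a set \<times> ('a \<Rightarrow> 'b set)" and f g h
  assume "h \<in> {f \<in> fst Z \<rightarrow>\<^sub>E fst Y. \<forall>y\<in>fst Z. snd Y (f y) \<subseteq> snd Z y}"
  then have "h x \<in> fst Y" if "x \<in> fst Z" for x using that by (auto simp: PiE_def)
  then show "compose (fst Z) (compose (fst Y) f g) h = compose (fst Z) f (compose (fst Z) g h)"
    by (auto simp: compose_def fun_eq_iff)
qed auto

text \<open>Arrows from \<open>P\<close> to \<open>Q\<close> are maps of points from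
  \<open>Q\<close> to \<open>P\<close>, so \<open>f\<close> runs backwards. Equality of weights
  makes its inverse an arrow as well.\<close>

lemma weighted_sets_isoI:
  assumes "bij_betw f (fst Q) (fst P)" "f \<in> extensional (fst Q)" "\<And>y. y \<in> fst Q \<Longrightarrow> snd P (f y) = snd Q y"
  shows "is_iso weighted_sets P Q f"
proof -
  let ?g = "\<lambda>x\<in>fst P. inv_into (fst Q) f x"
  have g: "?g x \<in> fst Q" "f (?g x) = x" if "x \<in> fst P" for x
    using that assms(1) by (auto simp: bij_betw_def inv_into_into f_inv_into_f)
  have fg: "f y \<in> fst P" "?g (f y) = y" if "y \<in> fst Q" for y
    using that assms(1) by (auto simp: bij_betw_def)
  have "f \<in> Hom weighted_sets P Q"
    using assms(2,3) fg(1) by (auto simp: weighted_sets_simps PiE_def)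
  moreover have "?g \<in> Hom weighted_sets Q P"
    using g assms(3) by (force simp: weighted_sets_simps)
  moreover have "Comp weighted_sets P Q P ?g f = Id weighted_sets P"
    "Comp weighted_sets Q P Q f ?g = Id weighted_sets Q"
    unfolding weighted_sets_simps by (rule compose_eqI; use g fg in simp)+
  ultimately show ?thesis unfolding is_iso_def by blast
qed

section \<open>Points of complete algebras\<close>

context semiprimal
begin

text \<open>The sum type gives the points of algebras and the points of pro-objects a common type.\<close>

definition CA_points :: "(('f, 'a) algebra, 'a \<Rightarrow> 'a,
    ('x + ('a \<Rightarrow> 'l)) set \<times> ('x + ('a \<Rightarrow> 'l) \<Rightarrow> 'l set), ('x + ('a \<Rightarrow> 'l)) \<Rightarrow> ('x + ('a \<Rightarrow> 'l))) fctr" where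
  "CA_points = \<lparr>omap = (\<lambda>A. (Inr ` complete_homs \<Sigma> A L, \<lambda>q. projr q ` carrier A)),
     amap = (\<lambda>A B f. \<lambda>q\<in>Inr ` complete_homs \<Sigma> B L. Inr (compose (carrier A) (projr q) f))\<rparr>"

lemma CA_points_functor: "is_functor (CA_atoms \<kappa> \<Sigma> L) weighted_sets CA_points"
proof (unfold_locales, unfold CA_atoms_simps)
  fix A B :: "('f, 'a) algebra" and f
  assume AB: "A \<in> {A \<in> Ob (CA \<Sigma> L). |atoms (skeleton \<Sigma> L A)| <o \<kappa>}" and f: "f \<in> complete_homs \<Sigma> A B"
  show "amap CA_points A B f \<in> Hom weighted_sets (omap CA_points A) (omap CA_points B)"
    using AB complete_homs_compose[OF _ f] homs_closed[OF complete_homsD[OF f]]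
    by (auto simp: CA_points_def weighted_sets_simps compose_def)
next
  fix A B D :: "('f, 'a) algebra" and f g
  assume A: "A \<in> {A \<in> Ob (CA \<Sigma> L). |atoms (skeleton \<Sigma> L A)| <o \<kappa>}"
    "B \<in> {A \<in> Ob (CA \<Sigma> L). |atoms (skeleton \<Sigma> L A)| <o \<kappa>}"
    and f: "f \<in> complete_homs \<Sigma> A B" and g: "g \<in> complete_homs \<Sigma> B D"
  have "f x \<in> carrier B" if "x \<in> carrier A" for x using homs_closed[OF complete_homsD[OF f] that] .
  then have eq: "compose (carrier A) p (compose (carrier A) g f) = compose (carrier A) (compose (carrier B) p g) f" for p :: "'a \<Rightarrow> 'l"
    by (auto simp: compose_def fun_eq_iff)
  have cg: "compose (carrier B) p g \<in> complete_homs \<Sigma> B L" if "p \<in> complete_homs \<Sigma> D L" for p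
    using complete_homs_compose[OF _ g that] A(2) by simp
  show "amap CA_points A D (compose (carrier A) g f) =
      Comp weighted_sets (omap CA_points A) (omap CA_points B) (omap CA_points D) (amap CA_points B D g) (amap CA_points A B f)"
    using cg by (auto simp: CA_points_def weighted_sets_simps compose_def[of "Inr ` _"] eq fun_eq_iff inj_image_mem_iff)
next
  fix A :: "('f, 'a) algebra"
  have "compose (carrier A) p (\<lambda>x\<in>carrier A. x) = p" if "p \<in> complete_homs \<Sigma> A L" for p
    by (rule compose_eqI) (use homs_extensional[OF complete_homsD[OF that]] in auto)
  then show "amap CA_points A A (\<lambda>x\<in>carrier A. x) = cat.Id weighted_sets (omap CA_points A)"
    by (auto simp: CA_points_def weighted_sets_simps fun_eq_iff)
qed (simp add: weighted_sets_simps)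

text \<open>Faithfulness holds because complete homomorphisms to \<open>L\<close> separate the
  elements of \<open>B\<close>. For fullness a map of points prescribes all coordinates of a
  homomorphism, and the inclusion of weights is the condition on images in
  \<open>lift_hom\<close>.\<close>

lemma CA_points_fully_faithful: "fully_faithful (CA_atoms \<kappa> \<Sigma> L) weighted_sets
  (CA_points :: (('f, 'a) algebra, 'a \<Rightarrow> 'a, ('x + ('a \<Rightarrow> 'l)) set \<times> _, _) fctr)"
  unfolding fully_faithful_def
proof (intro ballI)
  fix A B :: "('f, 'a) algebra"
  assume "A \<in> Ob (CA_atoms \<kappa> \<Sigma> L)" "B \<in> Ob (CA_atoms \<kappa> \<Sigma> L)"
  then have A: "A \<in> Ob (CA \<Sigma> L)" and B: "B \<in> Ob (CA \<Sigma> L)" by (auto simp: CA_atoms_simps)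
  interpret A: product \<Sigma> L A "complete_homs \<Sigma> A L" "\<lambda>p. p" by (rule CA_product[OF A])
  interpret B: product \<Sigma> L B "complete_homs \<Sigma> B L" "\<lambda>p. p" by (rule CA_product[OF B])
  let ?H = "Hom weighted_sets (omap CA_points A) (omap CA_points B) :: ('x + ('a \<Rightarrow> 'l) \<Rightarrow> 'x + ('a \<Rightarrow> 'l)) set"
  show "bij_betw (amap CA_points A B) (Hom (CA_atoms \<kappa> \<Sigma> L) A B) ?H"
    unfolding CA_atoms_simps
  proof (intro bij_betw_imageI inj_onI equalityI subsetI)
    fix f g assume f: "f \<in> complete_homs \<Sigma> A B" and g: "g \<in> complete_homs \<Sigma> A B"
      and eq: "amap CA_points A B f = (amap CA_points A B g :: 'x + ('a \<Rightarrow> 'l) \<Rightarrow> 'x + ('a \<Rightarrow> 'l))"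
    have p: "compose (carrier A) p f = compose (carrier A) p g" if "p \<in> complete_homs \<Sigma> B L" for p
    proof -
      have "(amap CA_points A B f :: 'x + ('a \<Rightarrow> 'l) \<Rightarrow> 'x + ('a \<Rightarrow> 'l)) (Inr p) = amap CA_points A B g (Inr p)"
        using eq by simp
      then show ?thesis using that by (simp add: CA_points_def)
    qed
    show "f = g"
    proof (rule homs_ext)
      fix x assume x: "x \<in> carrier A"
      show "f x = g x"
      proof (rule B.eqI)
        fix p assume "p \<in> complete_homs \<Sigma> B L"
        then show "p (f x) = p (g x)" using fun_cong[OF p, of p x] x by (simp add: compose_def)
      qed (use x f g complete_homsD homs_closed in metis)+
    qed (use f g complete_homsD in auto)
  next
    fix t :: "'x + ('a \<Rightarrow> 'l) \<Rightarrow> 'x + ('a \<Rightarrow> 'l)" assume "t \<in> amap CA_points A B ` complete_homs \<Sigma> A B"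
    then obtain f where f: "f \<in> complete_homs \<Sigma> A B" "t = amap CA_points A B f" by blast
    show "t \<in> ?H"
      unfolding f(2) using complete_homs_compose[OF A f(1)] homs_closed[OF complete_homsD[OF f(1)]]
      by (auto simp: CA_points_def weighted_sets_simps compose_def)
  next
    fix t :: "'x + ('a \<Rightarrow> 'l) \<Rightarrow> 'x + ('a \<Rightarrow> 'l)" assume t: "t \<in> ?H"
    define g where "g p = projr (t (Inr p))" for p
    have tg: "t (Inr p) = Inr (g p)" "g p \<in> complete_homs \<Sigma> A L" "g p ` carrier A \<subseteq> p ` carrier B"
      if p: "p \<in> complete_homs \<Sigma> B L" for p
    proof -
      have "t (Inr p) \<in> Inr ` complete_homs \<Sigma> A L" "projr (t (Inr p)) ` carrier A \<subseteq> p ` carrier B"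
        using t p by (auto simp: CA_points_def weighted_sets_simps PiE_def Pi_def)
      then show "t (Inr p) = Inr (g p)" "g p \<in> complete_homs \<Sigma> A L" "g p ` carrier A \<subseteq> p ` carrier B"
        unfolding g_def by auto
    qed
    obtain h where h: "h \<in> homs \<Sigma> A B" "\<And>p x. p \<in> complete_homs \<Sigma> B L \<Longrightarrow> x \<in> carrier A \<Longrightarrow> p (h x) = g p x"
      using B.lift_hom[OF A.alg_A, of g] complete_homsD[OF tg(2)] tg(3) by blast
    have "h \<in> complete_homs \<Sigma> A B"
    proof (rule complete_homsI[OF HSP_bounded_lattice[OF A.HSP] HSP_bounded_lattice[OF B.HSP] h(1)])
      fix X assume X: "X \<subseteq> carrier A"
      have hX: "h ` X \<subseteq> carrier B" using X homs_closed[OF h(1)] by blast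
      have im: "p ` h ` X = g p ` X" if "p \<in> complete_homs \<Sigma> B L" for p
        using h(2)[OF that] X by force
      obtain s where s: "lub (carrier A) A.m X s" "\<forall>p\<in>complete_homs \<Sigma> A L. lub (carrier L) L.m (p ` X) (p s)"
        using A.lub_glb_proj(1)[OF X] by blast
      obtain t where t: "lub (carrier B) B.m (h ` X) t" "\<forall>p\<in>complete_homs \<Sigma> B L. lub (carrier L) L.m (p ` h ` X) (p t)"
        using B.lub_glb_proj(1)[OF hX] by blast
      have c: "s \<in> carrier A" "h s \<in> carrier B" "t \<in> carrier B"
        using s(1) t(1) homs_closed[OF h(1)] unfolding lub_def by auto
      have "h s = t"
      proof (rule B.eqI[OF c(2,3)])
        fix p assume p: "p \<in> complete_homs \<Sigma> B L"
        have "g p ` X \<subseteq> carrier L" using X homs_closed[OF complete_homsD[OF tg(2)[OF p]]] by blast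
        then show "p (h s) = p t"
          using L.sup_eq[of "g p ` X"] bspec[OF s(2) tg(2)[OF p]] bspec[OF t(2) p] h(2)[OF p c(1)] im[OF p] by metis
      qed
      then show "\<exists>s. lub (carrier A) A.m X s \<and> lub (carrier B) B.m (h ` X) (h s)" using s t by blast
      obtain s where s: "glb (carrier A) A.m X s" "\<forall>p\<in>complete_homs \<Sigma> A L. glb (carrier L) L.m (p ` X) (p s)"
        using A.lub_glb_proj(2)[OF X] by blast
      obtain t where t: "glb (carrier B) B.m (h ` X) t" "\<forall>p\<in>complete_homs \<Sigma> B L. glb (carrier L) L.m (p ` h ` X) (p t)"
        using B.lub_glb_proj(2)[OF hX] by blast
      have c: "s \<in> carrier A" "h s \<in> carrier B" "t \<in> carrier B"
        using s(1) t(1) homs_closed[OF h(1)] unfolding glb_def by auto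
      have "h s = t"
      proof (rule B.eqI[OF c(2,3)])
        fix p assume p: "p \<in> complete_homs \<Sigma> B L"
        have "g p ` X \<subseteq> carrier L" using X homs_closed[OF complete_homsD[OF tg(2)[OF p]]] by blast
        then show "p (h s) = p t"
          using L.inf_eq[of "g p ` X"] bspec[OF s(2) tg(2)[OF p]] bspec[OF t(2) p] h(2)[OF p c(1)] im[OF p] by metis
      qed
      then show "\<exists>s. glb (carrier A) A.m X s \<and> glb (carrier B) B.m (h ` X) (h s)" using s t by blast
    qed
    moreover have "amap CA_points A B h = t"
    proof (rule extensionalityI[of _ "Inr ` complete_homs \<Sigma> B L"])
      show "t \<in> extensional (Inr ` complete_homs \<Sigma> B L)"
        using t by (auto simp: CA_points_def weighted_sets_simps PiE_def)
      show "amap CA_points A B h \<in> extensional (Inr ` complete_homs \<Sigma> B L)" by (simp add: CA_points_def)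
      fix q :: "'x + ('a \<Rightarrow> 'l)" assume "q \<in> Inr ` complete_homs \<Sigma> B L"
      then obtain p where p: "p \<in> complete_homs \<Sigma> B L" "q = Inr p" by blast
      have "compose (carrier A) p h = g p"
        by (rule compose_eqI) (use homs_extensional[OF complete_homsD[OF tg(2)[OF p(1)]]] h(2)[OF p(1)] in auto)
      then show "amap CA_points A B h q = t q" using p tg(1)[OF p(1)] by (simp add: CA_points_def)
    qed
    ultimately show "t \<in> amap CA_points A B ` complete_homs \<Sigma> A B" by blast
  qed
qed

end

section \<open>Small sets\<close>

lemma finite_ordLess_Cinfinite: "Cinfinite \<kappa> \<Longrightarrow> finite X \<Longrightarrow> |X| <o \<kappa>"
  using finite_ordLess_infinite card_of_Field_ordIso unfolding cinfinite_def
  by (metis Field_card_of card_of_Well_order card_order_on_well_order_on)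

lemma finite_ordLeq_infinite: "finite X \<Longrightarrow> infinite Y \<Longrightarrow> |X| \<le>o |Y|"
  by (metis card_of_Well_order card_of_ordLeq_finite ordLeq_total)

lemma infinite_ordLess_Times:
  assumes "Cinfinite \<kappa>" "|X| <o \<kappa>" "|Y| <o \<kappa>"
  shows "|X \<times> Y| <o \<kappa>"
proof (cases "finite X \<and> finite Y")
  case True
  then show ?thesis by (intro finite_ordLess_Cinfinite[OF assms(1)]) auto
next
  case False
  then consider "infinite X" "|Y| \<le>o |X|" | "infinite Y" "|X| \<le>o |Y|"
    by (metis card_of_Well_order card_of_ordLeq_finite ordLeq_total)
  then show ?thesis
  proof cases
    case 1
    have "|X \<times> Y| \<le>o |X|" by (rule card_of_Sigma_ordLeq_infinite) (use 1 in \<open>auto simp: card_of_mono1\<close>)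
    then show ?thesis using assms(2) ordLeq_ordLess_trans by blast
  next
    case 2
    have "|X \<times> Y| \<le>o |Y|" by (rule card_of_Sigma_ordLeq_infinite) (use 2 in \<open>auto simp: card_of_mono1\<close>)
    then show ?thesis using assms(3) ordLeq_ordLess_trans by blast
  qed
qed

text \<open>The cardinal \<kappa> may be singular, so the sum is bounded by \<open>|X|\<close>
  itself when \<open>X\<close> is infinite; finite fibres make this possible.\<close>

lemma Sigma_finite_ordLess:
  assumes "Cinfinite \<kappa>" "|X| <o \<kappa>" "\<And>x. x \<in> X \<Longrightarrow> finite (F x)"
  shows "|SIGMA x : X. F x| <o \<kappa>"
proof (cases "finite X")
  case True
  then show ?thesis using finite_ordLess_Cinfinite assms finite_SigmaI by metis
next
  case False
  have "|F x| \<le>o |X|" if "x \<in> X" for x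
    using finite_ordLeq_infinite[OF assms(3)[OF that] False] .
  then have "|SIGMA x : X. F x| \<le>o |X|"
    by (intro card_of_Sigma_ordLeq_infinite False) (auto simp: card_of_refl ordIso_imp_ordLeq)
  then show ?thesis using assms(2) ordLeq_ordLess_trans by blast
qed

text \<open>Finite subsets are the sets of entries of finite lists, and the lists of each length
  over an infinite set are no more numerous than its elements.\<close>

lemma Fpow_ordLess:
  assumes "Cinfinite \<kappa>" "|X| <o \<kappa>"
  shows "|Fpow X| <o \<kappa>"
proof (cases "finite X")
  case True
  then have "finite (Fpow X)" by (metis Fpow_subset_Pow finite_Pow_iff finite_subset)
  then show ?thesis using finite_ordLess_Cinfinite assms by blast
next
  case False
  let ?l = "\<lambda>n. {xs. set xs \<subseteq> X \<and> length xs = n}"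
  have l: "|?l n| \<le>o |X|" for n
  proof (induction n)
    case 0
    have "finite (?l 0)" by simp
    then show ?case by (rule finite_ordLeq_infinite[OF _ False])
  next
    case (Suc n)
    have "?l (Suc n) \<subseteq> (\<lambda>(x, xs). x # xs) ` (X \<times> ?l n)"
    proof
      fix xs assume "xs \<in> ?l (Suc n)"
      then show "xs \<in> (\<lambda>(x, xs). x # xs) ` (X \<times> ?l n)" by (cases xs) auto
    qed
    then have "|?l (Suc n)| \<le>o |(\<lambda>(x, xs). x # xs) ` (X \<times> ?l n)|" by (rule card_of_mono1)
    also have "|(\<lambda>(x, xs). x # xs) ` (X \<times> ?l n)| \<le>o |X \<times> ?l n|" by (rule card_of_image)
    also have "|X \<times> ?l n| \<le>o |X|"
      by (rule card_of_Sigma_ordLeq_infinite[OF False]) (use Suc in \<open>auto simp: card_of_refl ordIso_imp_ordLeq\<close>)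
    finally show ?case .
  qed
  have "|UNIV :: nat set| \<le>o |X|" using False infinite_iff_card_of_nat by blast
  then have "|\<Union>n. ?l n| \<le>o |X|"
    by (rule card_of_UNION_ordLeq_infinite[OF False]) (use l in blast)
  moreover have "Fpow X \<subseteq> set ` (\<Union>n. ?l n)"
  proof
    fix S assume "S \<in> Fpow X"
    then have "S \<subseteq> X" "finite S" by (auto simp: Fpow_def)
    then obtain xs where "set xs = S" using finite_list by blast
    with \<open>S \<subseteq> X\<close> show "S \<in> set ` (\<Union>n. ?l n)" by auto
  qed
  then have "|Fpow X| \<le>o |\<Union>n. ?l n|"
    by (rule ordLeq_transitive[OF card_of_mono1 card_of_image])
  ultimately have "|Fpow X| \<le>o |X|" by (blast intro: ordLeq_transitive)
  then show ?thesis using assms(2) ordLeq_ordLess_trans by blast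
qed

lemma small_embed:
  assumes "Cinfinite \<kappa>" "|X| <o (\<kappa> :: 'k rel)"
  obtains t :: "'x \<Rightarrow> 'k" where "inj_on t X" "|t ` X| <o \<kappa>"
proof -
  have "|X| \<le>o |Field \<kappa>|"
    using assms(1) ordLess_imp_ordLeq[OF assms(2)] card_of_Field_ordIso ordIso_symmetric ordLeq_ordIso_trans
    by blast
  then obtain t :: "'x \<Rightarrow> 'k" where t: "inj_on t X" using card_of_ordLeq[of X "Field \<kappa>"] by auto
  have "|t ` X| \<le>o |X|" by (rule card_of_image)
  then show thesis using that t assms(2) ordLeq_ordLess_trans by blast
qed

text \<open>A function is coded by its graph, a subset of the small set \<open>X \<times> F\<close>,
  which in turn is coded in \<open>'k\<close>. A family of values in \<open>L\<close> thus becomes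
  an element of a small power set.\<close>

lemma small_functions_embed:
  assumes \<kappa>: "Cinfinite \<kappa>" "|X| <o (\<kappa> :: 'k rel)" and F: "finite F"
  obtains K :: "'k set" and g :: "('x \<Rightarrow> 'l) \<Rightarrow> 'k set" where "|K| <o \<kappa>" "inj_on g (X \<rightarrow>\<^sub>E F)" "range g \<subseteq> Pow K"
proof -
  have "|X \<times> F| <o \<kappa>" using infinite_ordLess_Times[OF \<kappa>] finite_ordLess_Cinfinite[OF \<kappa>(1) F] by blast
  then obtain t :: "'x \<times> 'l \<Rightarrow> 'k" where t: "inj_on t (X \<times> F)" "|t ` (X \<times> F)| <o \<kappa>"
    using small_embed[OF \<kappa>(1)] by blast
  \<comment> \<open>Intersecting with \<open>X \<times> F\<close> changes nothing for functions from
    \<open>X\<close> to \<open>F\<close>, and keeps the code of any other function inside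
    \<open>K\<close>.\<close>
  let ?g = "\<lambda>s. t ` ((\<lambda>x. (x, s x)) ` X \<inter> X \<times> F)"
  have "inj_on ?g (X \<rightarrow>\<^sub>E F)"
  proof (rule inj_onI)
    fix r s assume rs: "r \<in> X \<rightarrow>\<^sub>E F" "s \<in> X \<rightarrow>\<^sub>E F" "?g r = ?g s"
    then have "(\<lambda>x. (x, r x)) ` X \<inter> X \<times> F = (\<lambda>x. (x, s x)) ` X \<inter> X \<times> F"
      using inj_on_image_eq_iff[OF t(1)] by blast
    moreover have "(\<lambda>x. (x, r x)) ` X \<subseteq> X \<times> F" "(\<lambda>x. (x, s x)) ` X \<subseteq> X \<times> F" using rs by auto
    ultimately have "(\<lambda>x. (x, r x)) ` X = (\<lambda>x. (x, s x)) ` X" by blast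
    then have "r x = s x" if "x \<in> X" for x using that by (auto simp: set_eq_iff image_iff)
    then show "r = s" using rs by (auto intro: PiE_ext)
  qed
  then show thesis using that[OF t(2)] by auto
qed

section \<open>Existence of products\<close>

text \<open>The product of the subalgebras \<open>v i\<close> is formed on families of values and
  transported along \<open>g\<close>, because its carrier has to lie in a prescribed type.\<close>

lemma (in semiprimal) product_exists:
  fixes v :: "'i \<Rightarrow> 'l set" and g :: "('i \<Rightarrow> 'l) \<Rightarrow> 'a"
  assumes v: "\<And>i. i \<in> I \<Longrightarrow> subuniverse \<Sigma> L (v i)" and g: "inj_on g (\<Pi>\<^sub>E i\<in>I. v i)"
  obtains A :: "('f, 'a) algebra" and \<pi> where "product \<Sigma> L A I \<pi>" "\<And>i. i \<in> I \<Longrightarrow> \<pi> i ` carrier A = v i"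
proof -
  let ?P = "\<Pi>\<^sub>E i\<in>I. v i" let ?op = "oper (power_algebra L I)"
  let ?d = "inv_into ?P g"
  define A where "A = \<lparr>carrier = g ` ?P, oper = (\<lambda>f as. g (?op f (map ?d as)))\<rparr>"
  have dg: "?d (g s) = s" if "s \<in> ?P" for s using that g by simp
  have cA: "carrier A = g ` ?P" and opA: "oper A f as = g (?op f (map ?d as))" for f as
    by (simp_all add: A_def)
  have lift: "map ?d as \<in> tuples n ?P" if "as \<in> tuples n (carrier A)" for n as
    by (rule tuples_map[OF that]) (use dg in \<open>auto simp: cA\<close>)
  have opP: "?op f ss \<in> ?P" if ss: "ss \<in> tuples (arity \<Sigma> f) ?P" for f ss
  proof -
    have "oper L f (map (\<lambda>s. s i) ss) \<in> v i" if i: "i \<in> I" for i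
      using v[OF i] tuples_map[OF ss, of "\<lambda>s. s i" "v i"] i unfolding subuniverse_def by (auto simp: PiE_mem)
    then show ?thesis by (simp add: power_algebra_def)
  qed
  have alg: "is_algebra \<Sigma> A"
    unfolding is_algebra_def subuniverse_def using opP lift by (auto simp: cA opA)
  define \<pi> where "\<pi> i = (\<lambda>x\<in>carrier A. ?d x i)" for i
  have \<pi>g: "\<pi> i (g s) = s i" if "s \<in> ?P" for i s using that by (simp add: \<pi>_def cA dg)
  have vL: "v i \<subseteq> carrier L" if "i \<in> I" for i using v[OF that] unfolding subuniverse_def by blast
  \<comment> \<open>Each \<open>v i\<close> contains the constant 0. The other coordinates of a
    family can then be filled arbitrarily, so that the projections of the product are onto.\<close>
  have ne: "v i \<noteq> {}" if "i \<in> I" for i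
  proof -
    have "oper L (zero_sym \<Sigma>) [] \<in> v i"
      using v[OF that] sig unfolding subuniverse_def lattice_signature_def tuples_def by simp
    then show ?thesis by blast
  qed
  have im: "\<pi> i ` carrier A = v i" if i: "i \<in> I" for i
  proof
    show "\<pi> i ` carrier A \<subseteq> v i" using \<pi>g i by (auto simp: cA PiE_mem)
    show "v i \<subseteq> \<pi> i ` carrier A"
    proof
      fix l assume l: "l \<in> v i"
      have "\<forall>k. \<exists>x. k \<in> I \<longrightarrow> x \<in> v k" using ne by blast
      then obtain c where c: "\<And>k. k \<in> I \<Longrightarrow> c k \<in> v k" by metis
      have s: "(\<lambda>k\<in>I. if k = i then l else c k) \<in> ?P" using c l by auto
      have "l = \<pi> i (g (\<lambda>k\<in>I. if k = i then l else c k))" using \<pi>g[OF s] i by simp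
      then show "l \<in> \<pi> i ` carrier A" by (rule image_eqI) (use s in \<open>simp add: cA\<close>)
    qed
  qed
  have "product_rep A I \<pi>"
    unfolding product_rep_def
  proof (intro conjI ballI allI impI alg)
    fix i assume i: "i \<in> I"
    show "\<pi> i \<in> homs \<Sigma> A L"
    proof (rule homsI)
      fix x assume "x \<in> carrier A"
      then show "\<pi> i x \<in> carrier L" using im[OF i] vL[OF i] by blast
    next
      fix f as assume as: "as \<in> tuples (arity \<Sigma> f) (carrier A)"
      have eq: "map (\<pi> i) as = map (\<lambda>s. s i) (map ?d as)"
        using as by (auto simp: \<pi>_def tuples_def)
      then show "\<pi> i (oper A f as) = oper L f (map (\<pi> i) as)"
        unfolding opA \<pi>g[OF opP[OF lift[OF as]]] eq using i by (simp add: power_algebra_def)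
    qed (simp add: \<pi>_def)
  next
    fix x y assume xy: "x \<in> carrier A" "y \<in> carrier A" "\<forall>i\<in>I. \<pi> i x = \<pi> i y"
    then obtain s t where st: "s \<in> ?P" "x = g s" "t \<in> ?P" "y = g t" by (auto simp: cA)
    have "s = t" by (rule PiE_ext[OF st(1,3)]) (use xy(3) st \<pi>g in auto)
    then show "x = y" using st by simp
  next
    fix s assume s: "\<forall>i\<in>I. s i \<in> \<pi> i ` carrier A"
    then have r: "restrict s I \<in> ?P" using im by auto
    then have "\<forall>i\<in>I. \<pi> i (g (restrict s I)) = s i" using \<pi>g by simp
    moreover have "g (restrict s I) \<in> carrier A" unfolding cA by (rule imageI[OF r])
    ultimately show "\<exists>x\<in>carrier A. \<forall>i\<in>I. \<pi> i x = s i" by blast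
  qed
  then have "product \<Sigma> L A I \<pi>" by unfold_locales
  then show thesis using that im by blast
qed

lemma (in product) carrier_embed:
  "inj_on (\<lambda>x. \<lambda>i\<in>I. \<pi> i x) (carrier A)" "(\<lambda>x. \<lambda>i\<in>I. \<pi> i x) ` carrier A \<subseteq> I \<rightarrow>\<^sub>E carrier L"
proof -
  show "inj_on (\<lambda>x. \<lambda>i\<in>I. \<pi> i x) (carrier A)"
  proof (rule inj_onI)
    fix x y assume xy: "x \<in> carrier A" "y \<in> carrier A" "(\<lambda>i\<in>I. \<pi> i x) = (\<lambda>i\<in>I. \<pi> i y)"
    show "x = y"
      by (rule eqI[OF xy(1,2)]) (use fun_cong[OF xy(3)] in \<open>simp add: restrict_def, metis\<close>)
  qed
qed (auto simp: proj_simps)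

lemma (in product) finite_carrier: "finite I \<Longrightarrow> finite (carrier A)"
  using carrier_embed fin_L finite_PiE inj_on_finite by metis

section \<open>Points of pro-objects\<close>

text \<open>\<open>M\<close> is a copy of \<open>L\<close> on the type of the algebras in the variety, and \<open>d\<close> the isomorphism.\<close>

locale semiprimal_copy = semiprimal \<Sigma> L for \<Sigma> :: "'f signature" and L :: "('f, 'l) algebra" +
  fixes M :: "('f, 'a) algebra" and d :: "'a \<Rightarrow> 'l"
  assumes copy: "product \<Sigma> L M {()} (\<lambda>_. d)" and d_surj: "d ` carrier M = carrier L"
begin

abbreviation "C \<equiv> Variety_fin \<Sigma> L :: (('f, 'a) algebra, 'a \<Rightarrow> 'a) cat"

lemma M_in: "M \<in> Ob C"
proof -
  interpret M: product \<Sigma> L M "{()}" "\<lambda>_. d" by (rule copy)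
  show ?thesis using M.HSP M.finite_carrier by (simp add: Variety_fin_simps)
qed

lemma d_hom: "d \<in> homs \<Sigma> M L"
  using product.proj[OF copy] by simp

lemma d_inj: "x \<in> carrier M \<Longrightarrow> y \<in> carrier M \<Longrightarrow> d x = d y \<Longrightarrow> x = y"
  using product.eqI[OF copy] by simp

lemma lift_to_M:
  assumes "is_algebra \<Sigma> A" "p \<in> homs \<Sigma> A L"
  obtains h where "h \<in> homs \<Sigma> A M" "\<And>x. x \<in> carrier A \<Longrightarrow> d (h x) = p x"
  using product.lift_hom[OF copy assms(1), of "\<lambda>_. p"] assms(2) homs_closed[OF assms(2)] d_surj by auto

lemma C_alg: "A \<in> Ob C \<Longrightarrow> is_algebra \<Sigma> A"
  by (simp add: Variety_fin_simps HSP_alg)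

lemma finite_homs_M: "A \<in> Ob C \<Longrightarrow> finite (homs \<Sigma> A M)"
proof -
  assume "A \<in> Ob C"
  then have "finite (carrier A \<rightarrow>\<^sub>E carrier M)" using M_in by (intro finite_PiE) (auto simp: Variety_fin_simps)
  then show ?thesis by (rule finite_subset[rotated]) (auto simp: homs_def)
qed

text \<open>Finiteness of \<open>A\<close> makes every homomorphism to \<open>L\<close> complete, so
  \<open>A\<close> is the product over all of them. Composition with \<open>d\<close> identifies
  these with the homomorphisms to \<open>M\<close>, which are the morphisms available inside
  \<open>C\<close>.\<close>

lemma homs_M_product:
  assumes "A \<in> Ob C"
  shows "product \<Sigma> L A (homs \<Sigma> A M) (\<lambda>p. compose (carrier A) d p)"
proof -
  have A: "HSP \<Sigma> L A" "finite (carrier A)" using assms by (auto simp: Variety_fin_simps)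
  interpret A: product \<Sigma> L A "complete_homs \<Sigma> A L" "\<lambda>p. p" by (rule CA_product[OF finite_HSP_in_CA[OF A]])
  have ch: "complete_homs \<Sigma> A L = homs \<Sigma> A L"
    using finite_homs_complete[OF sig HSP_bounded_lattice[OF A(1)] bl_L _ A(2)] complete_homsD by blast
  have dp: "compose (carrier A) d p \<in> homs \<Sigma> A L" if "p \<in> homs \<Sigma> A M" for p
    by (rule homs_compose[OF A.alg_A that d_hom])
  have ex: "\<exists>p\<in>homs \<Sigma> A M. q = compose (carrier A) d p" if q: "q \<in> homs \<Sigma> A L" for q
  proof -
    obtain h where h: "h \<in> homs \<Sigma> A M" "\<And>x. x \<in> carrier A \<Longrightarrow> d (h x) = q x"
      using lift_to_M[OF A.alg_A q] by blast
    have "compose (carrier A) d h = q" by (rule compose_eqI[OF homs_extensional[OF q]]) (use h(2) in auto)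
    then show ?thesis using h(1) by blast
  qed
  have uniq: "p = p'" if "p \<in> homs \<Sigma> A M" "p' \<in> homs \<Sigma> A M" "compose (carrier A) d p = compose (carrier A) d p'" for p p'
  proof (rule homs_ext[OF that(1,2)])
    fix x assume x: "x \<in> carrier A"
    then have "d (p x) = d (p' x)" using fun_cong[OF that(3), of x] by (simp add: compose_def)
    then show "p x = p' x" using d_inj homs_closed[OF that(1) x] homs_closed[OF that(2) x] by blast
  qed
  have "product_rep A (homs \<Sigma> A M) (\<lambda>p. compose (carrier A) d p)"
    unfolding product_rep_def
  proof (intro conjI ballI allI impI A.alg_A dp)
    fix x y assume xy: "x \<in> carrier A" "y \<in> carrier A"
      "\<forall>p\<in>homs \<Sigma> A M. compose (carrier A) d p x = compose (carrier A) d p y"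
    show "x = y" by (rule A.eqI[OF xy(1,2)]) (use xy(3) ex ch in auto)
  next
    fix s assume s: "\<forall>p\<in>homs \<Sigma> A M. s p \<in> compose (carrier A) d p ` carrier A"
    \<comment> \<open>The inverse of composition with \<open>d\<close>, by which the values
      \<open>s\<close> are reindexed.\<close>
    define u where "u q = (SOME p. p \<in> homs \<Sigma> A M \<and> q = compose (carrier A) d p)" for q
    have u: "u q \<in> homs \<Sigma> A M" "q = compose (carrier A) d (u q)" if "q \<in> homs \<Sigma> A L" for q
      using someI_ex[of "\<lambda>p. p \<in> homs \<Sigma> A M \<and> q = compose (carrier A) d p"] ex[OF that]
      unfolding u_def by blast+
    have "s (u q) \<in> q ` carrier A" if "q \<in> complete_homs \<Sigma> A L" for q
      using s u[of q] that ch by metis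
    then obtain x where x: "x \<in> carrier A" "\<forall>q\<in>complete_homs \<Sigma> A L. q x = s (u q)"
      using A.fill[of "\<lambda>q. s (u q)"] by blast
    have "compose (carrier A) d p x = s p" if p: "p \<in> homs \<Sigma> A M" for p
    proof -
      have "u (compose (carrier A) d p) = p" using uniq u[OF dp[OF p]] p by metis
      then show ?thesis using bspec[OF x(2), of "compose (carrier A) d p"] dp[OF p] ch by metis
    qed
    then show "\<exists>x\<in>carrier A. \<forall>p\<in>homs \<Sigma> A M. compose (carrier A) d p x = s p" using x(1) by blast
  qed
  then show ?thesis by unfold_locales
qed

lemma homs_M_separate:
  assumes "A \<in> Ob C" "x \<in> carrier A" "y \<in> carrier A" "\<And>p. p \<in> homs \<Sigma> A M \<Longrightarrow> p x = p y"
  shows "x = y"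
proof (rule product.eqI[OF homs_M_product[OF assms(1)] assms(2,3)])
  fix p assume "p \<in> homs \<Sigma> A M"
  then have "p x = p y" by (rule assms(4))
  then show "compose (carrier A) d p x = compose (carrier A) d p y" using assms(2,3) by (simp add: compose_eq)
qed

text \<open>Restricting a representative can only shrink its image. The intersection is the eventual
  image, independent of the representative chosen.\<close>

definition weight :: "('k, ('f, 'a) algebra, 'a \<Rightarrow> 'a) diagram \<Rightarrow> ('k \<times> ('a \<Rightarrow> 'a)) set \<Rightarrow> 'l set" where
  "weight X c = (\<Inter>(i, f)\<in>c. d ` f ` carrier (obj X i))"

definition pro_points :: "(('k, ('f, 'a) algebra, 'a \<Rightarrow> 'a) diagram, 'k \<Rightarrow> ('k \<times> ('a \<Rightarrow> 'a)) set,
    (('k \<times> ('a \<Rightarrow> 'a)) set + ('a \<Rightarrow> 'l)) set \<times> (('k \<times> ('a \<Rightarrow> 'a)) set + ('a \<Rightarrow> 'l) \<Rightarrow> 'l set),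
    (('k \<times> ('a \<Rightarrow> 'a)) set + ('a \<Rightarrow> 'l)) \<Rightarrow> (('k \<times> ('a \<Rightarrow> 'a)) set + ('a \<Rightarrow> 'l))) fctr" where
  "pro_points = \<lparr>omap = (\<lambda>X. (Inl ` colim_hom C X M, \<lambda>q. weight X (projl q))),
     amap = (\<lambda>X Y \<phi>. \<lambda>q\<in>Inl ` colim_hom C Y M. Inl (pro_act C X Y M \<phi> (projl q)))\<rparr>"

end

section \<open>Germs of homomorphisms over a diagram of finite algebras\<close>

locale algebra_diagram = semiprimal_copy \<Sigma> L M d + cofiltered_diagram "Variety_fin \<Sigma> L" X
  for \<Sigma> :: "'f signature" and L :: "('f, 'l) algebra" and M :: "('f, 'a) algebra" and d
    and X :: "('k, ('f, 'a) algebra, 'a \<Rightarrow> 'a) diagram"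
begin

lemma ob_alg: "i \<in> idx X \<Longrightarrow> is_algebra \<Sigma> (obj X i)"
  using C_alg X.omap_in by blast

text \<open>The injective half of the exchange of filtered colimits with finite products. The
  homomorphisms from \<open>A\<close> to \<open>M\<close> are finite in number, so one index
  witnesses all the equalities of germs at once. There the two representatives agree after each of
  these homomorphisms, hence agree.\<close>

lemma colim_map_jointly_inj:
  assumes A: "A \<in> Ob C" and c: "c \<in> colim_hom C X A" "c' \<in> colim_hom C X A"
    and eq: "\<And>p. p \<in> homs \<Sigma> A M \<Longrightarrow> colim_map C X A M p c = colim_map C X A M p c'"
  shows "c = c'"
proof -
  obtain i f where f: "i \<in> idx X" "f \<in> Hom C (obj X i) A" "c = germ C X A i f"
    using c(1) by (rule colim_homE)
  obtain i' f' where f': "i' \<in> idx X" "f' \<in> Hom C (obj X i') A" "c' = germ C X A i' f'"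
    using c(2) by (rule colim_homE)
  obtain k u v where k: "k \<in> idx X" "u \<in> ihom X k i" "v \<in> ihom X k i'"
    using I.cone_pair[OF f(1) f'(1)] by blast
  let ?X = "obj X"
  let ?h = "restr C X A f k i u"
  let ?h' = "restr C X A f' k i' v"
  have h: "?h \<in> Hom C (?X k) A" "?h' \<in> Hom C (?X k) A"
    using C.Comp_in[OF X.omap_in[OF k(1)] X.omap_in[OF f(1)] A X.amap_in[OF k(1) f(1) k(2)] f(2)]
      C.Comp_in[OF X.omap_in[OF k(1)] X.omap_in[OF f'(1)] A X.amap_in[OF k(1) f'(1) k(3)] f'(2)] by auto
  have ck: "c = germ C X A k ?h" "c' = germ C X A k ?h'"
    using germ_restrict[OF A f(1,2) k(1,2)] germ_restrict[OF A f'(1,2) k(1,3)] f(3) f'(3) by auto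
  have "\<exists>l\<in>idx X. \<exists>w\<in>ihom X l k. \<forall>p\<in>homs \<Sigma> A M.
      Comp C (?X l) (?X k) M (Comp C (?X k) A M p ?h) (arr X l k w) =
      Comp C (?X l) (?X k) M (Comp C (?X k) A M p ?h') (arr X l k w)"
  proof (rule finite_common_equalizer[OF finite_homs_M[OF A] M_in _ _ k(1)])
    fix p assume p: "p \<in> homs \<Sigma> A M"
    then have p': "p \<in> Hom C A M" by (simp add: Variety_fin_simps)
    show "Comp C (?X k) A M p ?h \<in> Hom C (?X k) M" "Comp C (?X k) A M p ?h' \<in> Hom C (?X k) M"
      using C.Comp_in[OF X.omap_in[OF k(1)] A M_in _ p'] h by blast+
    show "germ C X M k (Comp C (?X k) A M p ?h) = germ C X M k (Comp C (?X k) A M p ?h')"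
      using eq[OF p] unfolding ck colim_map_germ[OF A M_in p' k(1) h(1)] colim_map_germ[OF A M_in p' k(1) h(2)] .
  qed
  then obtain l w where l: "l \<in> idx X" "w \<in> ihom X l k" "\<And>p. p \<in> homs \<Sigma> A M \<Longrightarrow>
      Comp C (?X l) (?X k) M (Comp C (?X k) A M p ?h) (arr X l k w) =
      Comp C (?X l) (?X k) M (Comp C (?X k) A M p ?h') (arr X l k w)" by blast
  have w: "arr X l k w \<in> homs \<Sigma> (?X l) (?X k)"
    using X.amap_in[OF l(1) k(1) l(2)] by (simp add: Variety_fin_simps)
  have hh: "?h \<in> homs \<Sigma> (?X k) A" "?h' \<in> homs \<Sigma> (?X k) A" using h by (auto simp: Variety_fin_simps)
  have "Comp C (?X l) (?X k) A ?h (arr X l k w) = Comp C (?X l) (?X k) A ?h' (arr X l k w)"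
    unfolding Variety_fin_simps(4)[of \<Sigma> L "?X l"]
  proof (rule homs_ext)
    fix x assume x: "x \<in> carrier (?X l)"
    have wx: "arr X l k w x \<in> carrier (?X k)" using homs_closed[OF w x] .
    have "?h (arr X l k w x) = ?h' (arr X l k w x)"
    proof (rule homs_M_separate[OF A])
      fix p assume "p \<in> homs \<Sigma> A M"
      from fun_cong[OF l(3)[OF this], of x]
      show "p (?h (arr X l k w x)) = p (?h' (arr X l k w x))"
        using x wx by (simp add: Variety_fin_simps compose_eq)
    qed (use homs_closed[OF hh(1) wx] homs_closed[OF hh(2) wx] in auto)
    then show "compose (carrier (?X l)) ?h (arr X l k w) x = compose (carrier (?X l)) ?h' (arr X l k w) x"
      using x by (simp add: compose_eq)
  qed (use homs_compose[OF ob_alg[OF l(1)] w] hh in auto)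
  then show ?thesis
    using germ_restrict[OF A k(1) h(1) l(1,2)] germ_restrict[OF A k(1) h(2) l(1,2)] ck by simp
qed

text \<open>A representative whose image has least cardinality is chosen. It has a common
  restriction with any other one, still in the class, whose image lies in both images; minimality
  makes it the whole of the first. So the least image is contained in all others.\<close>

lemma weight_attained:
  assumes c: "c \<in> colim_hom C X M"
  obtains i f where "(i, f) \<in> c" "i \<in> idx X" "f \<in> homs \<Sigma> (obj X i) M"
    "d ` f ` carrier (obj X i) = weight X c"
proof -
  let ?X = "obj X"
  let ?im = "\<lambda>(i, f). d ` f ` carrier (?X i)"
  obtain i0 f0 where "(i0, f0) \<in> c"
    using c by (elim colim_homE) (use germ_self[OF M_in] in blast)
  then obtain x where x: "x \<in> c" "\<And>y. y \<in> c \<Longrightarrow> card (?im x) \<le> card (?im y)"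
    using ex_has_least_nat[of "\<lambda>x. x \<in> c" "(i0, f0)" "\<lambda>x. card (?im x)"] by blast
  obtain i f where [simp]: "x = (i, f)" by fastforce
  have f: "i \<in> idx X" "f \<in> Hom C (?X i) M" "c = germ C X M i f"
    using mem_colim[OF M_in c] x(1) by auto
  have "?im x \<subseteq> ?im y" if y: "y \<in> c" for y
  proof -
    obtain i' f' where [simp]: "y = (i', f')" by fastforce
    have f': "i' \<in> idx X" "f' \<in> Hom C (?X i') M" "c = germ C X M i' f'"
      using mem_colim[OF M_in c] y by auto
    obtain k u v where k: "k \<in> idx X" "u \<in> ihom X k i" "v \<in> ihom X k i'"
      "restr C X M f k i u = restr C X M f' k i' v"
      using germ_eq_iff[OF M_in f(1,2) f'(1,2)] f(3) f'(3) by auto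
    let ?h = "restr C X M f k i u"
    have h: "?h \<in> Hom C (?X k) M"
      using C.Comp_in[OF X.omap_in[OF k(1)] X.omap_in[OF f(1)] M_in X.amap_in[OF k(1) f(1) k(2)] f(2)] .
    have "(k, ?h) \<in> germ C X M k ?h" by (rule germ_self[OF M_in k(1) h])
    then have kc: "(k, ?h) \<in> c" using germ_restrict[OF M_in f(1,2) k(1,2)] f(3) by simp
    have u: "arr X k i u \<in> homs \<Sigma> (?X k) (?X i)" "arr X k i' v \<in> homs \<Sigma> (?X k) (?X i')"
      using X.amap_in k f(1) f'(1) by (auto simp: Variety_fin_simps)
    have hx1: "?h x = f (arr X k i u x)" if "x \<in> carrier (?X k)" for x
      using that by (simp add: Variety_fin_simps compose_eq)
    have hx2: "?h x = f' (arr X k i' v x)" if "x \<in> carrier (?X k)" for x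
      unfolding k(4) using that by (simp add: Variety_fin_simps compose_eq)
    have "?h ` carrier (?X k) \<subseteq> f ` carrier (?X i)" "?h ` carrier (?X k) \<subseteq> f' ` carrier (?X i')"
      using hx1 homs_closed[OF u(1)] hx2 homs_closed[OF u(2)] by blast+
    then have sub: "?im (k, ?h) \<subseteq> ?im x" "?im (k, ?h) \<subseteq> ?im y"
      by (simp_all add: image_mono)
    have "finite (carrier (?X i))" using X.omap_in[OF f(1)] by (simp add: Variety_fin_simps)
    then have "finite (?im x)" by simp
    then have "?im (k, ?h) = ?im x" using sub(1) x(2)[OF kc] by (metis card_seteq)
    then show ?thesis using sub(2) by simp
  qed
  then have "weight X c = ?im x" unfolding weight_def using x(1) by fast
  then show thesis using that[of i f] x(1) f by (simp add: Variety_fin_simps)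
qed

text \<open>The surjective half of the exchange, with a condition on weights. Representatives
  attaining the weights are restricted to one common index; their images still lie in the images of
  the maps \<open>p\<close>, so they are the coordinates of a single homomorphism to
  \<open>A\<close>.\<close>

lemma colim_map_jointly_surj:
  assumes A: "A \<in> Ob C" and s: "\<And>p. p \<in> homs \<Sigma> A M \<Longrightarrow> s p \<in> colim_hom C X M"
    and w: "\<And>p. p \<in> homs \<Sigma> A M \<Longrightarrow> weight X (s p) \<subseteq> d ` p ` carrier A"
  shows "\<exists>c\<in>colim_hom C X A. \<forall>p\<in>homs \<Sigma> A M. colim_map C X A M p c = s p"
proof -
  let ?X = "obj X"
  have "\<exists>i f. (i, f) \<in> s p \<and> i \<in> idx X \<and> f \<in> homs \<Sigma> (?X i) M \<and> d ` f ` carrier (?X i) = weight X (s p)"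
    if "p \<in> homs \<Sigma> A M" for p
    using weight_attained[OF s[OF that]] by metis
  then obtain i f where f: "\<And>p. p \<in> homs \<Sigma> A M \<Longrightarrow> (i p, f p) \<in> s p \<and> i p \<in> idx X \<and>
      f p \<in> homs \<Sigma> (?X (i p)) M \<and> d ` f p ` carrier (?X (i p)) = weight X (s p)"
    by metis
  have g: "(i p, f p) \<in> germs C X M" if "p \<in> homs \<Sigma> A M" for p
    using f[OF that] by (simp add: germsD Variety_fin_simps)
  obtain k g where k: "k \<in> idx X" "\<And>p. p \<in> homs \<Sigma> A M \<Longrightarrow> g p \<in> Hom C (?X k) M"
    "\<And>p. p \<in> homs \<Sigma> A M \<Longrightarrow> germ C X M k (g p) = germ C X M (i p) (f p)"
    "\<And>p. p \<in> homs \<Sigma> A M \<Longrightarrow> \<exists>u \<in> ihom X k (i p).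
       g p = restr C X M (f p) k (i p) u"
    using finite_common_index[of "homs \<Sigma> A M" "\<lambda>_. M" i f, OF finite_homs_M[OF A] M_in g] by blast
  have gM: "g p \<in> homs \<Sigma> (?X k) M" if "p \<in> homs \<Sigma> A M" for p
    using k(2)[OF that] by (simp add: Variety_fin_simps)
  have im: "compose (carrier (?X k)) d (g p) ` carrier (?X k) \<subseteq> compose (carrier A) d p ` carrier A"
    if p: "p \<in> homs \<Sigma> A M" for p
  proof -
    obtain u where u: "u \<in> ihom X k (i p)" "g p = restr C X M (f p) k (i p) u"
      using k(4)[OF p] by blast
    have uh: "arr X k (i p) u \<in> homs \<Sigma> (?X k) (?X (i p))"
      using X.amap_in[OF k(1) _ u(1)] f[OF p] by (simp add: Variety_fin_simps)
    have "g p x = f p (arr X k (i p) u x)" if "x \<in> carrier (?X k)" for x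
      unfolding u(2) using that by (simp add: Variety_fin_simps compose_eq)
    then have "g p ` carrier (?X k) \<subseteq> f p ` carrier (?X (i p))"
      using homs_closed[OF uh] by (simp add: image_subset_iff)
    from image_mono[OF this, of d] have "d ` g p ` carrier (?X k) \<subseteq> weight X (s p)" using f[OF p] by simp
    then have "d ` g p ` carrier (?X k) \<subseteq> d ` p ` carrier A" using w[OF p] by (rule subset_trans)
    then show ?thesis by (simp add: compose_def image_restrict_eq image_image)
  qed
  have dg: "compose (carrier (?X k)) d (g p) \<in> homs \<Sigma> (?X k) L" if "p \<in> homs \<Sigma> A M" for p
    by (rule homs_compose[OF ob_alg[OF k(1)] gM[OF that] d_hom])
  obtain h where h: "h \<in> homs \<Sigma> (?X k) A" "\<And>p b. p \<in> homs \<Sigma> A M \<Longrightarrow> b \<in> carrier (?X k) \<Longrightarrow>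
      compose (carrier A) d p (h b) = compose (carrier (?X k)) d (g p) b"
    using product.lift_hom[OF homs_M_product[OF A] ob_alg[OF k(1)] dg im] by blast
  have hC: "h \<in> Hom C (?X k) A" using h(1) by (simp add: Variety_fin_simps)
  have "colim_map C X A M p (germ C X A k h) = s p" if p: "p \<in> homs \<Sigma> A M" for p
  proof -
    have "compose (carrier (?X k)) p h = g p"
    proof (rule compose_eqI[OF homs_extensional[OF gM[OF p]]])
      fix b assume b: "b \<in> carrier (?X k)"
      have "d (p (h b)) = d (g p b)" using h(2)[OF p b] homs_closed[OF h(1) b] b by (simp add: compose_eq)
      then show "p (h b) = g p b"
        using d_inj homs_closed[OF p homs_closed[OF h(1) b]] homs_closed[OF gM[OF p] b] by blast
    qed
    moreover have "s p = germ C X M (i p) (f p)" using mem_colim(3)[OF M_in s[OF p]] f[OF p] by blast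
    ultimately show ?thesis
      using colim_map_germ[OF A M_in _ k(1) hC, of p] p k(3)[OF p] by (simp add: Variety_fin_simps)
  qed
  then show ?thesis using germ_in[OF k(1) hC] by blast
qed

end

context semiprimal_copy
begin

lemma algebra_diagramI: "X \<in> pro_objects \<kappa> C \<Longrightarrow> algebra_diagram \<Sigma> L M d X"
  using pro_objectsD[OF category_Variety_fin] semiprimal_copy_axioms by (simp add: algebra_diagram_def)

lemma cofiltered_diagramsI: "X \<in> pro_objects \<kappa> C \<Longrightarrow> Y \<in> pro_objects \<kappa> C \<Longrightarrow> cofiltered_diagrams C X Y"
  using pro_objectsD[OF category_Variety_fin] unfolding cofiltered_diagrams_def by blast

text \<open>A representative \<open>g\<close> of \<open>c\<close> yields a representative of the new
  germ that factors through \<open>g\<close>, so its image is contained in that of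
  \<open>g\<close>.\<close>

lemma weight_pro_act:
  assumes XY: "X \<in> pro_objects \<kappa> C" "Y \<in> pro_objects \<kappa> C" and \<phi>: "\<phi> \<in> pro_hom C X Y" and c: "c \<in> colim_hom C Y M"
  shows "weight X (pro_act C X Y M \<phi> c) \<subseteq> weight Y c"
proof -
  interpret cofiltered_diagrams C X Y by (rule cofiltered_diagramsI[OF XY])
  have "weight X (pro_act C X Y M \<phi> c) \<subseteq> d ` g ` carrier (obj Y j)" if "(j, g) \<in> c" for j g
  proof -
    let ?X = "obj X" let ?Y = "obj Y"
    have jg: "j \<in> idx Y" "g \<in> Hom C (?Y j) M" "c = germ C Y M j g"
      using Y.mem_colim[OF M_in c that] by auto
    obtain i h where h: "i \<in> idx X" "h \<in> Hom C (?X i) (?Y j)" "\<phi> j = germ C X (?Y j) i h"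
      using pro_hom_in[OF \<phi> jg(1)] by (rule X.colim_homE)
    have gh: "Comp C (?X i) (?Y j) M g h \<in> Hom C (?X i) M"
      using X.C.Comp_in[OF X.X.omap_in[OF h(1)] Y.X.omap_in[OF jg(1)] M_in h(2) jg(2)] .
    have "pro_act C X Y M \<phi> c = germ C X M i (Comp C (?X i) (?Y j) M g h)"
      unfolding jg(3) pro_act_germ[OF \<phi> M_in jg(1,2)] h(3)
      by (rule X.colim_map_germ[OF Y.X.omap_in[OF jg(1)] M_in jg(2) h(1,2)])
    then have "(i, Comp C (?X i) (?Y j) M g h) \<in> pro_act C X Y M \<phi> c"
      using X.germ_self[OF M_in h(1) gh] by simp
    then have "weight X (pro_act C X Y M \<phi> c) \<subseteq> d ` Comp C (?X i) (?Y j) M g h ` carrier (?X i)"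
      unfolding weight_def by blast
    also have "\<dots> \<subseteq> d ` g ` carrier (?Y j)"
      using h(2) homs_closed by (fastforce simp: Variety_fin_simps compose_eq)
    finally show ?thesis .
  qed
  then show ?thesis unfolding weight_def[of Y] by blast
qed

lemma pro_points_functor:
  "is_functor (Pro (\<kappa> :: 'k rel) C) weighted_sets pro_points"
proof (unfold_locales, unfold pro_simps)
  fix X Y :: "('k, ('f, 'a) algebra, 'a \<Rightarrow> 'a) diagram" and f
  assume XY: "X \<in> pro_objects \<kappa> C" "Y \<in> pro_objects \<kappa> C" and f: "f \<in> pro_hom C X Y"
  interpret cofiltered_diagrams C X Y by (rule cofiltered_diagramsI[OF XY])
  show "amap pro_points X Y f \<in> Hom weighted_sets (omap pro_points X) (omap pro_points Y)"
    using pro_act_in[OF f M_in] weight_pro_act[OF XY f] by (auto simp: pro_points_def weighted_sets_simps)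
next
  fix X :: "('k, ('f, 'a) algebra, 'a \<Rightarrow> 'a) diagram"
  assume X: "X \<in> pro_objects \<kappa> C"
  interpret cofiltered_diagram C X using cofiltered_diagramsI[OF X X] by (simp add: cofiltered_diagrams_def)
  show "amap pro_points X X (cat.Id (Pro \<kappa> C) X) = cat.Id weighted_sets (omap pro_points X)"
    using pro_act_Id[OF M_in] by (auto simp: pro_points_def weighted_sets_simps fun_eq_iff)
next
  fix X Y Z :: "('k, ('f, 'a) algebra, 'a \<Rightarrow> 'a) diagram" and f g
  assume XYZ: "X \<in> pro_objects \<kappa> C" "Y \<in> pro_objects \<kappa> C" "Z \<in> pro_objects \<kappa> C"
    and f: "f \<in> pro_hom C X Y" and g: "g \<in> pro_hom C Y Z"
  interpret cofiltered_diagrams3 C X Y Z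
    using cofiltered_diagramsI XYZ unfolding cofiltered_diagrams3_def by blast
  show "amap pro_points X Z (Comp (Pro \<kappa> C) X Y Z g f) = Comp weighted_sets (omap pro_points X)
      (omap pro_points Y) (omap pro_points Z) (amap pro_points Y Z g) (amap pro_points X Y f)"
    using pro_act_Comp[OF f g M_in] YZ.pro_act_in[OF g M_in]
    by (auto simp: pro_points_def weighted_sets_simps compose_def fun_eq_iff inj_image_mem_iff)
qed (simp add: weighted_sets_simps)

text \<open>The component \<phi> at \<open>j\<close> is determined by its images under the
  homomorphisms \<open>p\<close> from \<open>obj Y j\<close> to \<open>M\<close>, and these images
  are the action of \<phi> on the germs of the maps \<open>p\<close>. Joint injectivity gives
  faithfulness, joint surjectivity gives fullness.\<close>

lemma pro_points_fully_faithful: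
  "fully_faithful (Pro (\<kappa> :: 'k rel) C) weighted_sets pro_points"
  unfolding fully_faithful_def pro_simps
proof (intro ballI bij_betw_imageI inj_onI equalityI subsetI)
  fix X Y :: "('k, ('f, 'a) algebra, 'a \<Rightarrow> 'a) diagram" and \<phi> \<psi>
  assume XY: "X \<in> pro_objects \<kappa> C" "Y \<in> pro_objects \<kappa> C" and \<phi>: "\<phi> \<in> pro_hom C X Y" and \<psi>: "\<psi> \<in> pro_hom C X Y"
    and eq: "amap pro_points X Y \<phi> = amap pro_points X Y \<psi>"
  interpret cofiltered_diagrams C X Y by (rule cofiltered_diagramsI[OF XY])
  interpret algebra_diagram \<Sigma> L M d X by (rule algebra_diagramI[OF XY(1)])
  have act: "pro_act C X Y M \<phi> c = pro_act C X Y M \<psi> c" if "c \<in> colim_hom C Y M" for c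
    using fun_cong[OF eq, of "Inl c"] that by (simp add: pro_points_def)
  show "\<phi> = \<psi>"
  proof (rule pro_hom_ext[OF \<phi> \<psi>])
    fix j assume j: "j \<in> idx Y"
    show "\<phi> j = \<psi> j"
    proof (rule colim_map_jointly_inj[OF Y.X.omap_in[OF j] pro_hom_in[OF \<phi> j] pro_hom_in[OF \<psi> j]])
      fix p assume "p \<in> homs \<Sigma> (obj Y j) M"
      then have p: "p \<in> Hom C (obj Y j) M" by (simp add: Variety_fin_simps)
      show "colim_map C X (obj Y j) M p (\<phi> j) = colim_map C X (obj Y j) M p (\<psi> j)"
        using act[OF Y.germ_in[OF j p]] pro_act_germ[OF \<phi> M_in j p] pro_act_germ[OF \<psi> M_in j p] by simp
    qed
  qed
next
  fix X Y :: "('k, ('f, 'a) algebra, 'a \<Rightarrow> 'a) diagram" and t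
  assume XY: "X \<in> pro_objects \<kappa> C" "Y \<in> pro_objects \<kappa> C" and t: "t \<in> amap pro_points X Y ` pro_hom C X Y"
  then show "t \<in> Hom weighted_sets (omap pro_points X) (omap pro_points Y)"
    using is_functor.amap_in[OF pro_points_functor, of X \<kappa> Y] by (auto simp: pro_simps)
next
  fix X Y :: "('k, ('f, 'a) algebra, 'a \<Rightarrow> 'a) diagram" and t
  assume XY: "X \<in> pro_objects \<kappa> C" "Y \<in> pro_objects \<kappa> C"
    and t: "t \<in> Hom weighted_sets (omap pro_points X) (omap pro_points Y)"
  interpret cofiltered_diagrams C X Y by (rule cofiltered_diagramsI[OF XY])
  interpret algebra_diagram \<Sigma> L M d X by (rule algebra_diagramI[OF XY(1)])
  let ?Y = "obj Y"
  define s where "s c = projl (t (Inl c))" for c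
  have s: "t (Inl c) = Inl (s c)" "s c \<in> colim_hom C X M" "weight X (s c) \<subseteq> weight Y c" if "c \<in> colim_hom C Y M" for c
  proof -
    have "t (Inl c) \<in> Inl ` colim_hom C X M" "weight X (projl (t (Inl c))) \<subseteq> weight Y c"
      using t that by (auto simp: pro_points_def weighted_sets_simps PiE_def Pi_def)
    then show "t (Inl c) = Inl (s c)" "s c \<in> colim_hom C X M" "weight X (s c) \<subseteq> weight Y c"
      unfolding s_def by auto
  qed
  have gY: "germ C Y M j p \<in> colim_hom C Y M" if "j \<in> idx Y" "p \<in> homs \<Sigma> (?Y j) M" for j p
    using Y.germ_in[OF that(1)] that(2) by (simp add: Variety_fin_simps)
  have "\<exists>c\<in>colim_hom C X (?Y j). \<forall>p\<in>homs \<Sigma> (?Y j) M. colim_map C X (?Y j) M p c = s (germ C Y M j p)"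
    if j: "j \<in> idx Y" for j
  proof (rule colim_map_jointly_surj[OF Y.X.omap_in[OF j]])
    fix p assume p: "p \<in> homs \<Sigma> (?Y j) M"
    show "s (germ C Y M j p) \<in> colim_hom C X M" using s(2) gY[OF j p] by blast
    have "(j, p) \<in> germ C Y M j p" using Y.germ_self[OF M_in j] p by (simp add: Variety_fin_simps)
    then have "weight Y (germ C Y M j p) \<subseteq> d ` p ` carrier (?Y j)" unfolding weight_def by blast
    then show "weight X (s (germ C Y M j p)) \<subseteq> d ` p ` carrier (?Y j)" using s(3)[OF gY[OF j p]] by blast
  qed
  then obtain \<phi>0 where \<phi>0: "\<And>j. j \<in> idx Y \<Longrightarrow> \<phi>0 j \<in> colim_hom C X (?Y j)"
    "\<And>j p. j \<in> idx Y \<Longrightarrow> p \<in> homs \<Sigma> (?Y j) M \<Longrightarrow> colim_map C X (?Y j) M p (\<phi>0 j) = s (germ C Y M j p)"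
    by metis
  define \<phi> where "\<phi> = restrict \<phi>0 (idx Y)"
  \<comment> \<open>Components were chosen separately for each index. They are compatible because
    each is the only class with its images under the maps to \<open>M\<close>, and \<open>p\<close>
    and its restriction along \<open>u\<close> have the same germ.\<close>
  have compat: "colim_map C X (?Y j) (?Y j') (arr Y j j' u) (\<phi>0 j) = \<phi>0 j'"
    if j: "j \<in> idx Y" "j' \<in> idx Y" and u: "u \<in> ihom Y j j'" for j j' u
  proof -
    note uC = Y.X.amap_in[OF j u] and jC = Y.X.omap_in[OF j(1)] Y.X.omap_in[OF j(2)]
    show ?thesis
    proof (rule colim_map_jointly_inj[OF jC(2) X.colim_map_in[OF jC uC \<phi>0(1)[OF j(1)]] \<phi>0(1)[OF j(2)]])
      fix p assume p: "p \<in> homs \<Sigma> (?Y j') M"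
      then have pC: "p \<in> Hom C (?Y j') M" by (simp add: Variety_fin_simps)
      have pu: "restr C Y M p j j' u \<in> homs \<Sigma> (?Y j) M"
        using X.C.Comp_in[OF jC M_in uC pC] by (simp add: Variety_fin_simps)
      show "colim_map C X (?Y j') M p (colim_map C X (?Y j) (?Y j') (arr Y j j' u) (\<phi>0 j)) =
          colim_map C X (?Y j') M p (\<phi>0 j')"
        unfolding X.colim_map_Comp[OF jC M_in uC pC \<phi>0(1)[OF j(1)]] \<phi>0(2)[OF j(1) pu] \<phi>0(2)[OF j(2) p]
          Y.germ_restrict[OF M_in j(2) pC j(1) u] ..
    qed
  qed
  then have \<phi>: "\<phi> \<in> pro_hom C X Y"
    unfolding pro_hom_def \<phi>_def using \<phi>0(1) by auto
  have "amap pro_points X Y \<phi> = t"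
  proof (rule extensionalityI[of _ "Inl ` colim_hom C Y M"])
    show "t \<in> extensional (Inl ` colim_hom C Y M)"
      using t by (auto simp: pro_points_def weighted_sets_simps PiE_def)
    show "amap pro_points X Y \<phi> \<in> extensional (Inl ` colim_hom C Y M)" by (simp add: pro_points_def)
    fix q :: "('k \<times> ('a \<Rightarrow> 'a)) set + ('a \<Rightarrow> 'l)" assume "q \<in> Inl ` colim_hom C Y M"
    then obtain c where c: "c \<in> colim_hom C Y M" "q = Inl c" by blast
    obtain j p where p: "j \<in> idx Y" "p \<in> Hom C (?Y j) M" "c = germ C Y M j p"
      using c(1) by (rule Y.colim_homE)
    have "pro_act C X Y M \<phi> c = s c"
      unfolding p(3) pro_act_germ[OF \<phi> M_in p(1,2)] using \<phi>0(2)[OF p(1)] p(1,2)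
      by (simp add: \<phi>_def Variety_fin_simps)
    then show "amap pro_points X Y \<phi> q = t q" using c s(1)[OF c(1)] by (simp add: pro_points_def)
  qed
  then show "t \<in> amap pro_points X Y ` pro_hom C X Y" using \<phi> by blast
qed

end

section \<open>Essential images\<close>

lemma hom_image_subuniverse:
  assumes "is_algebra \<Sigma> A" "h \<in> homs \<Sigma> A B"
  shows "subuniverse \<Sigma> B (h ` carrier A)"
  unfolding subuniverse_def
proof (intro conjI allI ballI)
  show "h ` carrier A \<subseteq> carrier B" using homs_closed[OF assms(2)] by blast
  fix f bs assume bs: "bs \<in> tuples (arity \<Sigma> f) (h ` carrier A)"
  let ?as = "map (inv_into (carrier A) h) bs"
  have as: "?as \<in> tuples (arity \<Sigma> f) (carrier A)" by (rule tuples_map[OF bs]) (simp add: inv_into_into)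
  have "map h ?as = bs"
    unfolding map_map by (rule map_idI) (use bs in \<open>auto simp: tuples_def f_inv_into_f\<close>)
  then show "oper B f bs \<in> h ` carrier A"
    using homs_oper[OF assms(2) as] oper_closed[OF assms(1) as] by (metis imageI)
qed

text \<open>The elements of the product are coded as subsets of a small set \<open>K\<close> in
  \<open>'k\<close>, and \<open>pow\<close> embeds the power set of \<open>K\<close> in
  \<open>'a\<close>.\<close>

lemma (in semiprimal) small_product_exists:
  fixes I :: "'i set" and v :: "'i \<Rightarrow> 'l set" and \<kappa> :: "'k rel"
  assumes \<kappa>: "Cinfinite \<kappa>" and pow: "\<And>X :: 'k set. |X| <o \<kappa> \<Longrightarrow> |Pow X| \<le>o |UNIV :: 'a set|"
    and I: "|I| <o \<kappa>" and v: "\<And>i. i \<in> I \<Longrightarrow> subuniverse \<Sigma> L (v i)"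
  obtains A :: "('f, 'a) algebra" and \<pi> where "product \<Sigma> L A I \<pi>" "\<And>i. i \<in> I \<Longrightarrow> \<pi> i ` carrier A = v i"
proof -
  obtain K :: "'k set" and g :: "('i \<Rightarrow> 'l) \<Rightarrow> 'k set"
    where g: "|K| <o \<kappa>" "inj_on g (I \<rightarrow>\<^sub>E carrier L)" "range g \<subseteq> Pow K"
    using small_functions_embed[OF \<kappa> I fin_L] by blast
  obtain r :: "'k set \<Rightarrow> 'a" where r: "inj_on r (Pow K)"
    using pow[OF g(1)] card_of_ordLeq[of "Pow K" "UNIV :: 'a set"] by auto
  have "inj_on (r \<circ> g) (I \<rightarrow>\<^sub>E carrier L)"
    by (rule comp_inj_on[OF g(2)]) (rule inj_on_subset[OF r], use g(3) in blast)
  moreover have "(\<Pi>\<^sub>E i\<in>I. v i) \<subseteq> I \<rightarrow>\<^sub>E carrier L"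
    using v unfolding subuniverse_def by (intro PiE_mono) blast
  ultimately have "inj_on (r \<circ> g) (\<Pi>\<^sub>E i\<in>I. v i)" by (rule inj_on_subset)
  from product_exists[OF v this] show thesis using that by metis
qed

locale small_semiprimal_copy = semiprimal_copy \<Sigma> L M d
  for \<Sigma> :: "'f signature" and L :: "('f, 'l) algebra" and M :: "('f, 'a) algebra" and d +
  fixes \<kappa> :: "'k rel"
  assumes \<kappa>: "Cinfinite \<kappa>" and pow: "\<And>X :: 'k set. |X| <o \<kappa> \<Longrightarrow> |Pow X| \<le>o |UNIV :: 'a set|"
begin

abbreviation "D \<equiv> CA_atoms \<kappa> \<Sigma> L :: (('f, 'a) algebra, 'a \<Rightarrow> 'a) cat"

lemma product_in_D:
  assumes "product \<Sigma> L (A :: ('f, 'a) algebra) I \<pi>" "|I| <o \<kappa>"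
  shows "A \<in> Ob D"
proof -
  interpret product \<Sigma> L A I \<pi> by fact
  have "|atms| \<le>o |point ` I|" using atoms_subset by (rule card_of_mono1)
  also have "|point ` I| \<le>o |I|" by (rule card_of_image)
  finally have "|atms| <o \<kappa>" using assms(2) ordLeq_ordLess_trans by blast
  then show ?thesis using in_CA by (simp add: CA_atoms_simps)
qed

text \<open>The algebra is the product of the weights over all germs. Weights are subalgebras
  because each is the image of a representative, and there are few germs: each index contributes
  finitely many homomorphisms to \<open>M\<close>.\<close>

lemma pro_object_iso_algebra:
  assumes X: "X \<in> pro_objects \<kappa> C"
  shows "\<exists>A\<in>Ob D. \<exists>e. is_iso weighted_sets (omap CA_points A) (omap pro_points X) e"
proof -
  interpret algebra_diagram \<Sigma> L M d X by (rule algebra_diagramI[OF X])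
  let ?I = "colim_hom C X M"
  have "|idx X| <o \<kappa>"
  proof -
    \<comment> \<open>Smallness of a shape is measured by its arrows; each index is the source of
      its identity.\<close>
    have "idx X \<subseteq> fst ` arrows (shape X)"
      using I.Id_in unfolding arrows_def by force
    then have "|idx X| \<le>o |arrows (shape X)|" by (rule ordLeq_transitive[OF card_of_mono1 card_of_image])
    then show ?thesis using X ordLeq_ordLess_trans unfolding pro_objects_def by blast
  qed
  then have "|germs C X M| <o \<kappa>"
    unfolding germs_def using finite_homs_M X.omap_in
    by (intro Sigma_finite_ordLess[OF \<kappa>]) (auto simp: Variety_fin_simps(2))
  moreover have "?I \<subseteq> (\<lambda>x. germ_rel C X M `` {x}) ` germs C X M"
    unfolding colim_hom_def quotient_def by blast
  then have "|?I| \<le>o |germs C X M|" by (rule ordLeq_transitive[OF card_of_mono1 card_of_image])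
  ultimately have I: "|?I| <o \<kappa>" using ordLeq_ordLess_trans by blast
  have v: "subuniverse \<Sigma> L (weight X c)" if c: "c \<in> ?I" for c
  proof -
    obtain i f where f: "i \<in> idx X" "f \<in> homs \<Sigma> (obj X i) M"
      "d ` f ` carrier (obj X i) = weight X c" using weight_attained[OF c] by metis
    have "compose (carrier (obj X i)) d f \<in> homs \<Sigma> (obj X i) L"
      by (rule homs_compose[OF ob_alg[OF f(1)] f(2) d_hom])
    from hom_image_subuniverse[OF ob_alg[OF f(1)] this] show ?thesis
      using f(3) by (simp add: compose_def image_image)
  qed
  obtain A :: "('f, 'a) algebra" and \<pi> where A: "product \<Sigma> L A ?I \<pi>" "\<And>c. c \<in> ?I \<Longrightarrow> \<pi> c ` carrier A = weight X c"
    using small_product_exists[OF \<kappa> pow I, where v = "weight X"] v by blast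
  interpret A: product \<Sigma> L A ?I \<pi> by (rule A(1))
  let ?e = "\<lambda>q\<in>Inl ` ?I. Inr (\<pi> (projl q)) :: ('k \<times> ('a \<Rightarrow> 'a)) set + ('a \<Rightarrow> 'l)"
  have "is_iso weighted_sets (omap CA_points A) (omap pro_points X) ?e"
  proof (rule weighted_sets_isoI)
    show "bij_betw ?e (fst (omap pro_points X)) (fst (omap CA_points A))"
      unfolding bij_betw_def CA_points_def pro_points_def using A.proj_inj
      by (auto simp: inj_on_def A.complete_homs_eq image_image)
    show "?e \<in> extensional (fst (omap pro_points X))" by (simp add: pro_points_def)
    fix q assume "q \<in> fst (omap pro_points X)"
    then obtain c where c: "c \<in> ?I" "q = Inl c" by (auto simp: pro_points_def)
    then show "snd (omap CA_points A) (?e q) = snd (omap pro_points X) q"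
      using A(2)[OF c(1)] by (simp add: pro_points_def CA_points_def)
  qed
  then show ?thesis using product_in_D[OF A(1) I] by blast
qed

lemma finite_product_homs:
  assumes "product \<Sigma> L A S \<pi>" "finite S" "p \<in> homs \<Sigma> A L"
  shows "\<exists>i\<in>S. p = \<pi> i"
proof -
  interpret product \<Sigma> L A S \<pi> by fact
  have "p \<in> complete_homs \<Sigma> A L"
    by (rule finite_homs_complete[OF sig HSP_bounded_lattice[OF HSP] bl_L assms(3) finite_carrier[OF assms(2)]])
  then show ?thesis by (rule complete_hom_is_proj)
qed

text \<open>A weighted set is the set of points of the diagram of its finite subsets, ordered by
  reverse inclusion.\<close>

lemma weighted_set_pro_object:
  fixes I :: "'i set" and v :: "'i \<Rightarrow> 'l set"
  assumes I: "|I| <o \<kappa>" and v: "\<And>i. i \<in> I \<Longrightarrow> subuniverse \<Sigma> L (v i)"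
  obtains X b where "X \<in> pro_objects \<kappa> C" "bij_betw b I (colim_hom C X M)"
    "\<And>i. i \<in> I \<Longrightarrow> weight X (b i) = v i"
proof -
  have F: "finite S" "S \<subseteq> I" if "S \<in> Fpow I" for S using that by (auto simp: Fpow_def)
  have "\<exists>A \<pi>. product \<Sigma> L (A :: ('f, 'a) algebra) S \<pi> \<and> (\<forall>i\<in>S. \<pi> i ` carrier A = v i)" if S: "S \<in> Fpow I" for S
    using small_product_exists[OF \<kappa> pow finite_ordLess_Cinfinite[OF \<kappa> F(1)[OF S]], of v] v F(2)[OF S]
    by (metis subsetD)
  then obtain B :: "'i set \<Rightarrow> ('f, 'a) algebra" and \<pi>
    where B: "\<And>S. S \<in> Fpow I \<Longrightarrow> product \<Sigma> L (B S) S (\<pi> S)"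
      "\<And>S i. S \<in> Fpow I \<Longrightarrow> i \<in> S \<Longrightarrow> \<pi> S i ` carrier (B S) = v i" by metis
  have B_alg: "is_algebra \<Sigma> (B S)" if "S \<in> Fpow I" for S using product.alg_A[OF B(1)[OF that]] .
  have BC: "B S \<in> Ob C" if S: "S \<in> Fpow I" for S
  proof -
    interpret product \<Sigma> L "B S" S "\<pi> S" by (rule B(1)[OF S])
    show ?thesis using HSP finite_carrier[OF F(1)[OF S]] by (simp add: Variety_fin_simps)
  qed
  \<comment> \<open>The projection that forgets the coordinates outside \<open>S\<close>. Both
    factors at \<open>i\<close> are \<open>v i\<close>, so the condition on images holds.\<close>
  have ex_r: "\<exists>h. h \<in> homs \<Sigma> (B T) (B S) \<and> (\<forall>i\<in>S. \<forall>x\<in>carrier (B T). \<pi> S i (h x) = \<pi> T i x)"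
    if ST: "S \<in> Fpow I" "T \<in> Fpow I" "S \<subseteq> T" for S T
  proof -
    have "\<pi> T i \<in> homs \<Sigma> (B T) L" "\<pi> T i ` carrier (B T) \<subseteq> \<pi> S i ` carrier (B S)" if "i \<in> S" for i
      using product.proj[OF B(1)[OF ST(2)]] B(2)[OF ST(1) that] B(2)[OF ST(2), of i] that ST(3) by auto
    then show ?thesis using product.lift_hom[OF B(1)[OF ST(1)] B_alg[OF ST(2)], of "\<pi> T"] by metis
  qed
  define r where "r T S = (SOME h. h \<in> homs \<Sigma> (B T) (B S) \<and> (\<forall>i\<in>S. \<forall>x\<in>carrier (B T). \<pi> S i (h x) = \<pi> T i x))" for T S
  have r: "r T S \<in> homs \<Sigma> (B T) (B S)" "i \<in> S \<Longrightarrow> x \<in> carrier (B T) \<Longrightarrow> \<pi> S i (r T S x) = \<pi> T i x"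
    if "S \<in> Fpow I" "T \<in> Fpow I" "S \<subseteq> T" for S T i x
    using someI_ex[OF ex_r[OF that]] unfolding r_def by blast+
  have "\<exists>h. h \<in> homs \<Sigma> (B S) M \<and> (\<forall>x\<in>carrier (B S). d (h x) = \<pi> S i x)" if "S \<in> Fpow I" "i \<in> S" for S i
    using lift_to_M[OF B_alg[OF that(1)] product.proj[OF B(1)[OF that(1)] that(2)]] by metis
  then obtain q where q: "\<And>S i. S \<in> Fpow I \<Longrightarrow> i \<in> S \<Longrightarrow> q S i \<in> homs \<Sigma> (B S) M"
    "\<And>S i x. S \<in> Fpow I \<Longrightarrow> i \<in> S \<Longrightarrow> x \<in> carrier (B S) \<Longrightarrow> d (q S i x) = \<pi> S i x"
    by metis
  have d_eqI: "f = g" if "f \<in> homs \<Sigma> A M" "g \<in> homs \<Sigma> A M" "\<And>x. x \<in> carrier A \<Longrightarrow> d (f x) = d (g x)"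
    for f g and A :: "('f, 'a) algebra"
    by (rule homs_ext[OF that(1,2)]) (use d_inj homs_closed[OF that(1)] homs_closed[OF that(2)] that(3) in blast)
  have hom_q: "\<exists>i\<in>S. p = q S i" if S: "S \<in> Fpow I" and p: "p \<in> homs \<Sigma> (B S) M" for S p
  proof -
    obtain i where i: "i \<in> S" "compose (carrier (B S)) d p = \<pi> S i"
      using finite_product_homs[OF B(1)[OF S] F(1)[OF S] homs_compose[OF B_alg[OF S] p d_hom]] by blast
    have "p = q S i"
    proof (rule d_eqI[OF p q(1)[OF S i(1)]])
      fix x assume "x \<in> carrier (B S)"
      then show "d (p x) = d (q S i x)" using q(2)[OF S i(1)] fun_cong[OF i(2), of x] by (simp add: compose_eq)
    qed
    then show ?thesis using i(1) by blast
  qed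
  \<comment> \<open>The shape must have its objects in \<open>'k\<close>, so finite subsets of
    \<open>I\<close> are replaced by codes, with \<delta> as decoding.\<close>
  obtain \<iota> :: "'i set \<Rightarrow> 'k" where \<iota>: "inj_on \<iota> (Fpow I)" "|\<iota> ` Fpow I| <o \<kappa>"
    using small_embed[OF \<kappa> Fpow_ordLess[OF \<kappa> I]] .
  define \<delta> where "\<delta> = inv_into (Fpow I) \<iota>"
  have \<delta>\<iota> [simp]: "\<delta> (\<iota> S) = S" if "S \<in> Fpow I" for S using \<iota>(1) that by (simp add: \<delta>_def)
  have \<delta>: "\<delta> k \<in> Fpow I" "\<iota> (\<delta> k) = k" if "k \<in> \<iota> ` Fpow I" for k
    using that by (auto simp: \<delta>_def inv_into_into f_inv_into_f)
  \<comment> \<open>A poset as a category: the only arrow between two comparable objects is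
    \<open>undefined\<close>. Unions of finite sets make it cofiltered, and parallel arrows are
    equal.\<close>
  define Sh :: "('k, 'k) cat" where "Sh = \<lparr>Ob = \<iota> ` Fpow I,
    Hom = (\<lambda>k l. if \<delta> l \<subseteq> \<delta> k then {undefined} else {}), Id = (\<lambda>_. undefined), Comp = (\<lambda>_ _ _ _ _. undefined)\<rparr>"
  define X :: "('k, ('f, 'a) algebra, 'a \<Rightarrow> 'a) diagram" where
    "X = \<lparr>shape = Sh, dia = \<lparr>omap = (\<lambda>k. B (\<delta> k)), amap = (\<lambda>k l _. r (\<delta> k) (\<delta> l))\<rparr>\<rparr>"
  have Xs: "shape X = Sh" "obj X k = B (\<delta> k)" "arr X k l u = r (\<delta> k) (\<delta> l)" for k l u
    by (simp_all add: X_def)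
  have Shs: "Ob Sh = \<iota> ` Fpow I" "u \<in> Hom Sh k l \<longleftrightarrow> \<delta> l \<subseteq> \<delta> k \<and> u = undefined" for u k l
    by (auto simp: Sh_def)
  have cof: "cofiltered Sh"
  proof
    show "Ob Sh \<noteq> {}" unfolding Shs by (auto simp: Fpow_def)
    fix i j assume ij: "i \<in> Ob Sh" "j \<in> Ob Sh"
    then have U: "\<delta> i \<union> \<delta> j \<in> Fpow I" using \<delta>(1) unfolding Shs Fpow_def by blast
    have "undefined \<in> Hom Sh (\<iota> (\<delta> i \<union> \<delta> j)) i" "undefined \<in> Hom Sh (\<iota> (\<delta> i \<union> \<delta> j)) j" using U by (simp_all add: Shs)
    then show "\<exists>k\<in>Ob Sh. Hom Sh k i \<noteq> {} \<and> Hom Sh k j \<noteq> {}" using U unfolding Shs(1) by blast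
  next
    fix i j u w assume "i \<in> Ob Sh" "u \<in> Hom Sh i j" "w \<in> Hom Sh i j"
    then show "\<exists>k\<in>Ob Sh. \<exists>s\<in>Hom Sh k i. Comp Sh k i j u s = Comp Sh k i j w s"
      by (intro bexI[of _ i] bexI[of _ undefined]) (auto simp: Shs)
  qed (auto simp: Shs(2), auto simp: Sh_def)
  have "arrows Sh \<subseteq> Ob Sh \<times> (Ob Sh \<times> {undefined})" unfolding arrows_def by (auto simp: Shs(2))
  then have "|arrows Sh| \<le>o |Ob Sh \<times> (Ob Sh \<times> {undefined :: 'k})|" by (rule card_of_mono1)
  moreover have "|Ob Sh \<times> (Ob Sh \<times> {undefined :: 'k})| <o \<kappa>"
    unfolding Shs(1)
    by (intro infinite_ordLess_Times[OF \<kappa> \<iota>(2)] infinite_ordLess_Times[OF \<kappa> \<iota>(2)]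
        finite_ordLess_Cinfinite[OF \<kappa>]) simp
  ultimately have arr: "|arrows Sh| <o \<kappa>" using ordLeq_ordLess_trans by blast
  have r_Id: "r S S = (\<lambda>x\<in>carrier (B S). x)" if S: "S \<in> Fpow I" for S
  proof (rule homs_ext)
    fix x assume x: "x \<in> carrier (B S)"
    show "r S S x = (\<lambda>x\<in>carrier (B S). x) x"
      by (rule product.eqI[OF B(1)[OF S]]) (use x r(2)[OF S S] homs_closed[OF r(1)[OF S S] x] in auto)
  qed (use r(1)[OF S S] homs_id[OF B_alg[OF S]] in auto)
  have r_Comp: "r U S = compose (carrier (B U)) (r T S) (r U T)"
    if S: "S \<in> Fpow I" and T: "T \<in> Fpow I" and U: "U \<in> Fpow I" and sub: "S \<subseteq> T" "T \<subseteq> U" for S T U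
  proof (rule homs_ext)
    have SU: "S \<subseteq> U" using sub by blast
    show "r U S \<in> homs \<Sigma> (B U) (B S)" by (rule r(1)[OF S U SU])
    show "compose (carrier (B U)) (r T S) (r U T) \<in> homs \<Sigma> (B U) (B S)"
      by (rule homs_compose[OF B_alg[OF U] r(1)[OF T U sub(2)] r(1)[OF S T sub(1)]])
    fix x assume x: "x \<in> carrier (B U)"
    have y: "r U T x \<in> carrier (B T)" by (rule homs_closed[OF r(1)[OF T U sub(2)] x])
    have "r U S x = r T S (r U T x)"
    proof (rule product.eqI[OF B(1)[OF S]])
      fix i assume i: "i \<in> S"
      then have "i \<in> T" using sub by blast
      then show "\<pi> S i (r U S x) = \<pi> S i (r T S (r U T x))"
        using r(2)[OF S U SU i x] r(2)[OF S T sub(1) i y] r(2)[OF T U sub(2) _ x] by simp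
    qed (use homs_closed[OF r(1)[OF S U SU] x] homs_closed[OF r(1)[OF S T sub(1)] y] in auto)
    then show "r U S x = compose (carrier (B U)) (r T S) (r U T) x" using x by (simp add: compose_eq)
  qed
  have "is_functor Sh C (dia X)"
  proof (unfold_locales, unfold Shs Xs Variety_fin_simps(2-))
    fix k assume k: "k \<in> \<iota> ` Fpow I"
    show "B (\<delta> k) \<in> Ob C" by (rule BC[OF \<delta>(1)[OF k]])
    show "r (\<delta> k) (\<delta> k) = (\<lambda>x\<in>carrier (B (\<delta> k)). x)" by (rule r_Id[OF \<delta>(1)[OF k]])
    fix l u assume l: "l \<in> \<iota> ` Fpow I" and u: "\<delta> l \<subseteq> \<delta> k \<and> u = undefined"
    show "r (\<delta> k) (\<delta> l) \<in> homs \<Sigma> (B (\<delta> k)) (B (\<delta> l))"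
      using r(1)[OF \<delta>(1)[OF l] \<delta>(1)[OF k]] u by blast
    fix n w assume n: "n \<in> \<iota> ` Fpow I" and w: "\<delta> n \<subseteq> \<delta> l \<and> w = undefined"
    show "r (\<delta> k) (\<delta> n) = compose (carrier (B (\<delta> k))) (r (\<delta> l) (\<delta> n)) (r (\<delta> k) (\<delta> l))"
      using r_Comp[OF \<delta>(1)[OF n] \<delta>(1)[OF l] \<delta>(1)[OF k]] u w by blast
  qed
  then have X: "X \<in> pro_objects \<kappa> C" using cof arr by (simp add: pro_objects_def Xs(1))
  interpret algebra_diagram \<Sigma> L M d X by (rule algebra_diagramI[OF X])
  have single: "{i} \<in> Fpow I" if "i \<in> I" for i using that by (simp add: Fpow_def)
  \<comment> \<open>The point \<open>i\<close> becomes the germ of the only coordinate over the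
    one-element set. Coordinate \<open>i\<close> over any larger finite set is a restriction of it,
    hence has the same germ.\<close>
  define b where "b i = germ C X M (\<iota> {i}) (q {i} i)" for i
  have qC: "\<iota> S \<in> idx X" "q S i \<in> Hom C (obj X (\<iota> S)) M" if "S \<in> Fpow I" "i \<in> S" for S i
    using that q(1)[OF that] by (simp_all add: Xs Shs Variety_fin_simps)
  have qr: "compose (carrier (B S)) (q {i} i) (r S {i}) = q S i" if S: "S \<in> Fpow I" "i \<in> S" for S i
  proof -
    have i: "{i} \<in> Fpow I" "{i} \<subseteq> S" using F(2)[OF S(1)] S(2) single by auto
    show ?thesis
    proof (rule d_eqI[OF homs_compose[OF B_alg[OF S(1)] r(1)[OF i(1) S(1) i(2)] q(1)[OF i(1)]] q(1)[OF S]])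
      fix x assume x: "x \<in> carrier (B S)"
      show "d (compose (carrier (B S)) (q {i} i) (r S {i}) x) = d (q S i x)"
        using q(2)[OF i(1) _ homs_closed[OF r(1)[OF i(1) S(1) i(2)] x]] r(2)[OF i(1) S(1) i(2) _ x] q(2)[OF S x] x
        by (simp add: compose_eq)
    qed simp
  qed
  have germ_q: "germ C X M (\<iota> S) (q S i) = b i" if S: "S \<in> Fpow I" "i \<in> S" for S i
  proof -
    have i: "{i} \<in> Fpow I" using F(2)[OF S(1)] S(2) single by auto
    have u: "undefined \<in> ihom X (\<iota> S) (\<iota> {i})" using S i by (simp add: Xs Shs)
    have "germ C X M (\<iota> S) (Comp C (obj X (\<iota> S)) (obj X (\<iota> {i})) M (q {i} i)
        (arr X (\<iota> S) (\<iota> {i}) undefined)) = b i"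
      unfolding b_def using germ_restrict[OF M_in qC[OF i] qC(1)[OF S] u] by simp
    then show ?thesis using qr[OF S] S i by (simp add: Xs Variety_fin_simps)
  qed
  \<comment> \<open>A homomorphism from a finite product of subalgebras to \<open>M\<close> is one
    of the coordinates. So every representative of every germ is some \<open>q S i\<close>.\<close>
  have mem_germ: "\<exists>S i. S \<in> Fpow I \<and> i \<in> S \<and> k = \<iota> S \<and> f = q S i"
    if k: "k \<in> idx X" "f \<in> Hom C (obj X k) M" for k f
  proof -
    have \<delta>k: "\<delta> k \<in> Fpow I" "\<iota> (\<delta> k) = k" using \<delta> k(1) by (auto simp: Xs Shs)
    moreover obtain i where "i \<in> \<delta> k" "f = q (\<delta> k) i"
      using hom_q[OF \<delta>k(1), of f] k(2) by (auto simp: Xs Variety_fin_simps)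
    ultimately show ?thesis by metis
  qed
  have inj: "i = j" if ij: "i \<in> I" "j \<in> I" "b i = b j" for i j
  proof -
    note si = single[OF ij(1)] and sj = single[OF ij(2)]
    obtain k u w where k: "k \<in> idx X" "u \<in> ihom X k (\<iota> {i})" "w \<in> ihom X k (\<iota> {j})"
      "restr C X M (q {i} i) k (\<iota> {i}) u =
       restr C X M (q {j} j) k (\<iota> {j}) w"
      using germ_eq_iff[OF M_in qC[OF si singletonI] qC[OF sj singletonI]] ij(3) unfolding b_def by auto
    let ?T = "\<delta> k"
    have T: "?T \<in> Fpow I" "i \<in> ?T" "j \<in> ?T" using k \<delta>(1) si sj by (auto simp: Xs Shs)
    have "q ?T i = q ?T j"
      using k(4) qr[OF T(1,2)] qr[OF T(1,3)] si sj by (simp add: Xs Variety_fin_simps)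
    then have "\<pi> ?T i x = \<pi> ?T j x" if "x \<in> carrier (B ?T)" for x
      using q(2)[OF T(1,2) that] q(2)[OF T(1,3) that] by simp
    \<comment> \<open>Equal germs agree over some finite set containing both points, and there
      distinct coordinates are distinct maps.\<close>
    then have "\<pi> ?T i = \<pi> ?T j"
      using homs_ext[OF product.proj[OF B(1)[OF T(1)] T(2)] product.proj[OF B(1)[OF T(1)] T(3)]] by blast
    then show ?thesis using product.proj_inj[OF B(1)[OF T(1)]] T(2,3) by (auto dest: inj_onD)
  qed
  have b_in: "b i \<in> colim_hom C X M" if "i \<in> I" for i
    unfolding b_def using germ_in[OF qC[OF single[OF that]]] by simp
  have "bij_betw b I (colim_hom C X M)"
    unfolding bij_betw_def
  proof (intro conjI inj_onI equalityI subsetI)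
    fix c assume "c \<in> colim_hom C X M"
    then obtain k f where k: "k \<in> idx X" "f \<in> Hom C (obj X k) M" "c = germ C X M k f"
      by (rule colim_homE)
    obtain S i where S: "S \<in> Fpow I" "i \<in> S" "k = \<iota> S" "f = q S i" using mem_germ[OF k(1,2)] by blast
    then have "c = b i" using k(3) germ_q by simp
    then show "c \<in> b ` I" using F(2)[OF S(1)] S(2) by blast
  qed (use inj b_in in auto)
  moreover have "weight X (b i) = v i" if i: "i \<in> I" for i
  proof -
    \<comment> \<open>All representatives have the same image \<open>v i\<close>, so the
      intersection defining the weight is \<open>v i\<close>.\<close>
    have *: "d ` f ` carrier (obj X k) = v i" if kf: "(k, f) \<in> b i" for k f
    proof -
      have k: "k \<in> idx X" "f \<in> Hom C (obj X k) M" "b i = germ C X M k f"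
        using mem_colim[OF M_in b_in[OF i] kf] by auto
      obtain S j where S: "S \<in> Fpow I" "j \<in> S" "k = \<iota> S" "f = q S j" using mem_germ[OF k(1,2)] by blast
      have "b i = b j" using k(3) germ_q[OF S(1,2)] S(3,4) by simp
      then have j: "j = i" using inj[OF i] F(2)[OF S(1)] S(2) by blast
      have "d ` q S j ` carrier (B S) = \<pi> S j ` carrier (B S)"
        using q(2)[OF S(1,2)] by (simp add: image_image)
      then show ?thesis using B(2)[OF S(1,2)] S j by (simp add: Xs)
    qed
    have "(\<iota> {i}, q {i} i) \<in> b i"
      unfolding b_def by (rule germ_self[OF M_in]) (use qC[OF single[OF i]] in auto)
    then show ?thesis unfolding weight_def using * by fast
  qed
  ultimately show thesis using that[OF X] by blast
qed

text \<open>The points of \<open>A\<close> are indexed by its atoms, hence few, and the values at a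
  point form a subalgebra of \<open>L\<close>. This is the data from which a diagram of finite
  subsets is built.\<close>

lemma algebra_iso_pro_object:
  assumes A: "A \<in> Ob D"
  shows "\<exists>X\<in>pro_objects \<kappa> C. \<exists>e. is_iso weighted_sets (omap pro_points X) (omap CA_points A) e"
proof -
  have ACA: "A \<in> Ob (CA \<Sigma> L)" "|atoms (skeleton \<Sigma> L A)| <o \<kappa>" using A by (auto simp: CA_atoms_simps)
  let ?I = "complete_homs \<Sigma> A L"
  interpret at: product \<Sigma> L A "atoms (skeleton \<Sigma> L A)" "HSP_algebra.atom_hom \<Sigma> L A"
    by unfold_locales (rule CA_product_rep[OF ACA(1)])
  have "|?I| \<le>o |atoms (skeleton \<Sigma> L A)|" unfolding at.complete_homs_eq by (rule card_of_image)
  then have I: "|?I| <o \<kappa>" using ACA(2) ordLeq_ordLess_trans by blast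
  have v: "subuniverse \<Sigma> L (p ` carrier A)" if "p \<in> ?I" for p
    by (rule hom_image_subuniverse[OF at.alg_A complete_homsD[OF that]])
  obtain X b where X: "X \<in> pro_objects \<kappa> C" "bij_betw b ?I (colim_hom C X M)"
    "\<And>p. p \<in> ?I \<Longrightarrow> weight X (b p) = p ` carrier A"
    using weighted_set_pro_object[OF I, where v = "\<lambda>p. p ` carrier A"] v by blast
  let ?e = "\<lambda>q\<in>Inr ` ?I. Inl (b (projr q)) :: ('k \<times> ('a \<Rightarrow> 'a)) set + ('a \<Rightarrow> 'l)"
  have "is_iso weighted_sets (omap pro_points X) (omap CA_points A) ?e"
  proof (rule weighted_sets_isoI)
    show "bij_betw ?e (fst (omap CA_points A)) (fst (omap pro_points X))"
    proof (rule bij_betw_imageI)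
      show "inj_on ?e (fst (omap CA_points A))"
        using X(2) by (auto simp: CA_points_def bij_betw_def inj_on_def)
      have "?e ` Inr ` ?I = Inl ` b ` ?I" by (simp add: image_image)
      moreover have "fst (omap CA_points A) = Inr ` ?I" "fst (omap pro_points X) = Inl ` colim_hom C X M"
        by (simp_all add: CA_points_def pro_points_def)
      ultimately show "?e ` fst (omap CA_points A) = fst (omap pro_points X)"
        using X(2) unfolding bij_betw_def by metis
    qed
    show "?e \<in> extensional (fst (omap CA_points A))" by (simp add: CA_points_def)
    fix q assume "q \<in> fst (omap CA_points A)"
    then obtain p where p: "p \<in> ?I" "q = Inr p" by (auto simp: CA_points_def)
    then show "snd (omap pro_points X) (?e q) = snd (omap CA_points A) q"
      using X(3)[OF p(1)] by (simp add: pro_points_def CA_points_def)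
  qed
  then show ?thesis using X(1) by blast
qed

lemma Pro_equivalent_CA_atoms: "equivalent_cats (Pro \<kappa> C) D"
proof (rule equivalent_via_common_target)
  show "category (Pro \<kappa> C)" by (rule category_Pro[OF category_Variety_fin])
  show "category D" unfolding CA_atoms_def by (rule category.category_full_subcat[OF category_CA])
  show "X \<in> Ob (Pro \<kappa> C) \<Longrightarrow> \<exists>A\<in>Ob D. \<exists>e. is_iso weighted_sets (omap CA_points A) (omap pro_points X) e" for X
    using pro_object_iso_algebra by (simp add: pro_simps)
  show "A \<in> Ob D \<Longrightarrow> \<exists>X\<in>Ob (Pro \<kappa> C). \<exists>e. is_iso weighted_sets (omap pro_points X) (omap CA_points A) e" for A
    using algebra_iso_pro_object by (simp add: pro_simps)
qed (rule category_weighted_sets pro_points_functor CA_points_functor pro_points_fully_faithful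
  CA_points_fully_faithful)+

end

text \<open>Atoms are elements, so a small algebra has few of them. Conversely the coordinates at
  the atoms embed the carrier in the power set of a small set, and a strong limit keeps this
  small.\<close>

lemma (in semiprimal) CA_small_eq_CA_atoms:
  assumes \<kappa>: "Cinfinite \<kappa>" and sl: "strong_limit (\<kappa> :: 'k rel)"
  shows "(CA_small \<kappa> \<Sigma> L :: (('f, 'a) algebra, 'a \<Rightarrow> 'a) cat) = CA_atoms \<kappa> \<Sigma> L"
proof -
  have "|carrier A| <o \<kappa> \<longleftrightarrow> |atoms (skeleton \<Sigma> L A)| <o \<kappa>" if A: "A \<in> Ob (CA \<Sigma> L)" for A :: "('f, 'a) algebra"
  proof -
    interpret product \<Sigma> L A "atoms (skeleton \<Sigma> L A)" "HSP_algebra.atom_hom \<Sigma> L A"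
      by unfold_locales (rule CA_product_rep[OF A])
    have "|atms| \<le>o |carrier A|" using atom_carrier by (intro card_of_mono1) blast
    moreover have "|carrier A| <o \<kappa>" if at: "|atms| <o \<kappa>"
    proof -
      obtain K :: "'k set" and g :: "('a \<Rightarrow> 'l) \<Rightarrow> 'k set"
        where g: "|K| <o \<kappa>" "inj_on g (atms \<rightarrow>\<^sub>E carrier L)" "range g \<subseteq> Pow K"
        using small_functions_embed[OF \<kappa> at fin_L] by blast
      let ?e = "\<lambda>x. \<lambda>a\<in>atms. HSP_algebra.atom_hom \<Sigma> L A a x"
      have "inj_on (g \<circ> ?e) (carrier A)"
        by (rule comp_inj_on[OF carrier_embed(1) inj_on_subset[OF g(2) carrier_embed(2)]])
      moreover have "(g \<circ> ?e) ` carrier A \<subseteq> Pow K" using g(3) by auto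
      ultimately have "|carrier A| \<le>o |Pow K|" using card_of_ordLeq[of "carrier A" "Pow K"] by blast
      then show ?thesis using sl g(1) ordLeq_ordLess_trans unfolding strong_limit_def by blast
    qed
    ultimately show ?thesis using ordLeq_ordLess_trans by blast
  qed
  then have "Ob (CA \<Sigma> L) \<inter> {A :: ('f, 'a) algebra. |carrier A| <o \<kappa>} =
      Ob (CA \<Sigma> L) \<inter> {A. |atoms (skeleton \<Sigma> L A)| <o \<kappa>}" by blast
  then show ?thesis unfolding CA_small_def CA_atoms_def full_subcat_def by simp
qed

theorem theorem5p10:
  fixes \<Sigma> :: "'f signature" and L :: "('f, 'l) algebra" and \<kappa> :: "'k rel"
  assumes "lattice_signature \<Sigma>"
    and "is_algebra \<Sigma> L" and "finite (carrier L)"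
    and "bounded_lattice_algebra \<Sigma> L" and "alg_zero \<Sigma> L \<noteq> alg_one \<Sigma> L"
    and "semi_primal \<Sigma> L"
    and "Cinfinite \<kappa>"
    and "\<And>X :: 'k set. |X| <o \<kappa> \<Longrightarrow> |Pow X| \<le>o |UNIV :: 'a set|"
  shows "(strong_limit \<kappa> \<longrightarrow>
      equivalent_cats
        (Pro \<kappa> (Variety_fin \<Sigma> L :: (('f, 'a) algebra, 'a \<Rightarrow> 'a) cat))
        (CA_small \<kappa> \<Sigma> L :: (('f, 'a) algebra, 'a \<Rightarrow> 'a) cat)) \<and>
    equivalent_cats
        (Pro \<kappa> (Variety_fin \<Sigma> L :: (('f, 'a) algebra, 'a \<Rightarrow> 'a) cat))
        (CA_atoms \<kappa> \<Sigma> L :: (('f, 'a) algebra, 'a \<Rightarrow> 'a) cat)"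
proof -
  interpret semiprimal \<Sigma> L using assms(1-6) by unfold_locales
  have unit: "|{()}| <o \<kappa>" by (rule finite_ordLess_Cinfinite[OF assms(7)]) simp
  \<comment> \<open>The copy of \<open>L\<close> in the type \<open>'a\<close> is the product with
    one factor; one point is small because \<kappa> is infinite.\<close>
  obtain M :: "('f, 'a) algebra" and \<pi>
    where M: "product \<Sigma> L M {()} \<pi>" "\<pi> () ` carrier M = carrier L"
  proof (rule small_product_exists[OF assms(7) assms(8) unit])
    show "subuniverse \<Sigma> L (carrier L)" using assms(2) by (simp add: is_algebra_def)
  qed simp_all
  have eta: "(\<lambda>_. \<pi> ()) = \<pi>" by (simp add: fun_eq_iff)
  interpret small_semiprimal_copy \<Sigma> L M "\<pi> ()" \<kappa>
  proof unfold_locales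
    show "product_rep M {()} (\<lambda>_. \<pi> ())" unfolding eta by (rule product.rep[OF M(1)])
    show "|Pow X| \<le>o |UNIV :: 'a set|" if "|X| <o \<kappa>" for X :: "'k set" by (rule assms(8)[OF that])
  qed (fact M(2), fact assms(7))+
  have "(CA_small \<kappa> \<Sigma> L :: (('f, 'a) algebra, 'a \<Rightarrow> 'a) cat) = CA_atoms \<kappa> \<Sigma> L" if "strong_limit \<kappa>"
    by (rule CA_small_eq_CA_atoms[OF assms(7) that])
  then show ?thesis using Pro_equivalent_CA_atoms by auto
qed

end
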